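(* Let $U$ and $U_0$ be two unitary operators on a separable Hilbert space $\mathcal{H}$ such that $U-U_0\in\mathcal{B}_2(\mathcal{H})$, and let $A\in\mathcal{B}_2(\mathcal{H})$ be a self-adjoint operator such that $U=e^{iA}U_0$. Denote $U_s=e^{isA}U_0$, $s\in\mathbb{R}$. Then for every trigonometric polynomial $p$ on $\mathbb{T}$ with complex coefficients, $$p(U)-p(U_0)-\frac{d}{ds}p(U_s)\Big|_{s=0}\in\mathcal{B}_1(\mathcal{H}),$$ and there exists a function $\eta\in L^1([0,2\pi])$, independent of $p$, such that for every trigonometric polynomial $p$ on $\mathbb{T}$ with complex coefficients $$\operatorname{Tr}\Big\{p(U)-p(U_0)-\frac{d}{ds}p(U_s)\Big|_{s=0}\Big\}=\int_{0}^{2\pi}\frac{d^2}{dt^2}\big\{p(e^{it})\big\}\,\eta(t)\,dt .$$ The function $\eta$ satisfying this for all such $p$ is unique up to an additive constant. Moreover, $\eta$ can be chosen so that $\|\eta\|_{L^1([0,2\pi])}\le\frac{\pi}{2}\|A\|_2^2$.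
   Context: $\mathcal{B}_1(\mathcal{H})$ and $\mathcal{B}_2(\mathcal{H})$ denote the trace class and Hilbert-Schmidt class operators on $\mathcal{H}$, $\|\cdot\|_2$ is the Hilbert-Schmidt norm and $\operatorname{Tr}$ the trace. $\mathbb{T}$ is the unit circle. A trigonometric polynomial on $\mathbb{T}$ is a finite sum $p(\lambda)=\sum_r a_r\lambda^r$, $r\in\mathbb{Z}$, $a_r\in\mathbb{C}$, and $p(V)=\sum_r a_rV^r$ for unitary $V$. The derivative $\frac{d}{ds}p(U_s)$ is taken in operator norm. Whenever $U-U_0\in\mathcal{B}_2(\mathcal{H})$, a self-adjoint $A\in\mathcal{B}_2(\mathcal{H})$ with $U=e^{iA}U_0$ exists. *)

theory Defs
  imports "HOL-Analysis.Analysis"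
begin

text \<open>
  The remaining axioms of a complex vector space and of a complex inner product (unit law,
  positivity, definiteness) follow from those of \<^class>\<open>real_inner\<close>, since the real structure is
  required to be the one underlying the complex structure. The inner product is linear in its
  first argument.
\<close>

class chilbert_space = real_inner + banach +
  fixes scaleC :: "complex \<Rightarrow> 'a \<Rightarrow> 'a" (infixr \<open>*\<^sub>C\<close> 75)
    and cinner :: "'a \<Rightarrow> 'a \<Rightarrow> complex"
  assumes scaleC_add_right: "c *\<^sub>C (x + y) = c *\<^sub>C x + c *\<^sub>C y"
    and scaleC_add_left: "(c + d) *\<^sub>C x = c *\<^sub>C x + d *\<^sub>C x"
    and scaleC_scaleC: "c *\<^sub>C (d *\<^sub>C x) = (c * d) *\<^sub>C x"
    and scaleR_scaleC: "r *\<^sub>R x = complex_of_real r *\<^sub>C x"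
    and cinner_add_left: "cinner (x + y) z = cinner x z + cinner y z"
    and cinner_scaleC_left: "cinner (c *\<^sub>C x) y = c * cinner x y"
    and cinner_commute: "cinner x y = cnj (cinner y x)"
    and inner_eq_Re_cinner: "inner x y = Re (cinner x y)"

instantiation complex :: chilbert_space
begin

definition scaleC_complex :: "complex \<Rightarrow> complex \<Rightarrow> complex"
  where "scaleC_complex c x = c * x"

definition cinner_complex :: "complex \<Rightarrow> complex \<Rightarrow> complex"
  where "cinner_complex x y = x * cnj y"

instance
  by standard
    (simp_all add: scaleC_complex_def cinner_complex_def inner_complex_def algebra_simps scaleR_conv_of_real)

end

lemma cinner_self: "cinner x x = complex_of_real ((norm x)\<^sup>2)" for x :: "'a::chilbert_space"
proof (rule complex_eqI)
  show "Re (cinner x x) = Re (complex_of_real ((norm x)\<^sup>2))"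
    by (simp add: inner_eq_Re_cinner [symmetric] power2_norm_eq_inner)
  have "Im (cinner x x) = - Im (cinner x x)"
    using arg_cong [OF cinner_commute [of x x], of Im] by simp
  then show "Im (cinner x x) = Im (complex_of_real ((norm x)\<^sup>2))" by simp
qed

lemma cinner_scaleC_right: "cinner x (c *\<^sub>C y) = cnj c * cinner x y" for x y :: "'a::chilbert_space"
  by (metis cinner_commute cinner_scaleC_left complex_cnj_mult)

lemma norm_scaleC: "norm (c *\<^sub>C x) = cmod c * norm x" for x :: "'a::chilbert_space"
proof -
  have "complex_of_real ((norm (c *\<^sub>C x))\<^sup>2) = cnj c * (c * cinner x x)"
    unfolding cinner_self [symmetric] cinner_scaleC_left cinner_scaleC_right ..
  also have "\<dots> = (c * cnj c) * complex_of_real ((norm x)\<^sup>2)"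
    unfolding cinner_self by (simp only: mult.assoc mult.left_commute)
  also have "\<dots> = complex_of_real ((cmod c * norm x)\<^sup>2)"
    unfolding complex_norm_square [symmetric] of_real_mult [symmetric] power_mult_distrib ..
  finally have "(norm (c *\<^sub>C x))\<^sup>2 = (cmod c * norm x)\<^sup>2"
    by (simp only: of_real_eq_iff)
  then show ?thesis
    by (simp add: power2_eq_iff_nonneg)
qed

lemma bounded_linear_scaleC: "bounded_linear (\<lambda>x::'a::chilbert_space. c *\<^sub>C x)"
  by (rule bounded_linear_intro [where K = "cmod c"])
    (simp_all add: scaleC_add_right scaleR_scaleC scaleC_scaleC mult.commute norm_scaleC)

text \<open>By completeness, the last condition says that the span of \<open>B\<close> is dense.\<close>

definition is_onb :: "'a::chilbert_space set \<Rightarrow> bool" where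
  "is_onb B \<longleftrightarrow>
     (\<forall>e\<in>B. norm e = 1) \<and>
     (\<forall>e\<in>B. \<forall>f\<in>B. e \<noteq> f \<longrightarrow> cinner e f = 0) \<and>
     (\<forall>x. (\<forall>e\<in>B. cinner x e = 0) \<longrightarrow> x = 0)"

lemma ex_onb: "\<exists>B::'a::chilbert_space set. is_onb B"
proof -
  define P :: "'a set \<Rightarrow> bool" where
    "P B \<longleftrightarrow> (\<forall>e\<in>B. norm e = 1) \<and> (\<forall>e\<in>B. \<forall>f\<in>B. e \<noteq> f \<longrightarrow> cinner e f = 0)" for B
  have "\<exists>M\<in>{B. P B}. \<forall>X\<in>{B. P B}. M \<subseteq> X \<longrightarrow> X = M"
  proof (rule subset_Zorn', goal_cases)
    case (1 C)
    then have C: "B \<in> C \<Longrightarrow> P B" and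
      chain: "B \<in> C \<Longrightarrow> D \<in> C \<Longrightarrow> B \<subseteq> D \<or> D \<subseteq> B" for B D
      by (auto simp: subset_chain_def)
    have "cinner e f = 0" if "e \<in> B" "B \<in> C" "f \<in> D" "D \<in> C" "e \<noteq> f" for e f B D
      using chain [OF that(2,4)] C [OF that(2)] C [OF that(4)] that unfolding P_def by blast
    moreover have "norm e = 1" if "e \<in> B" "B \<in> C" for e B
      using C that unfolding P_def by blast
    ultimately show ?case
      unfolding P_def mem_Collect_eq by blast
  qed
  then obtain M where M: "P M" and max: "\<And>X. P X \<Longrightarrow> M \<subseteq> X \<Longrightarrow> X = M"
    by blast
  have "x = 0" if x: "\<forall>e\<in>M. cinner x e = 0" for x
  proof (rule ccontr)
    assume "x \<noteq> 0"
    define u where "u = complex_of_real (1 / norm x) *\<^sub>C x"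
    have nu: "norm u = 1"
      using \<open>x \<noteq> 0\<close> unfolding u_def norm_scaleC norm_of_real by simp
    have ul: "cinner u e = 0" if "e \<in> M" for e
      using x that by (simp add: u_def cinner_scaleC_left)
    have ur: "cinner e u = 0" if "e \<in> M" for e
      by (subst cinner_commute) (simp add: ul that)
    have "P (insert u M)"
      using M nu ul ur unfolding P_def by auto
    then have "u \<in> M"
      using max [of "insert u M"] by auto
    then have "cinner u u = 0" by (rule ul)
    then show False
      using nu by (simp add: cinner_self)
  qed
  then have "is_onb M"
    using M unfolding P_def is_onb_def by (intro conjI) simp_all
  then show ?thesis ..
qed

text \<open>
  The Hilbert-Schmidt norm, the trace and the two operator classes do not depend on the
  orthonormal basis, so a single one is fixed.
\<close>

definition some_onb :: "'a::chilbert_space set" where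
  "some_onb = (SOME B. is_onb B)"

lemma is_onb_some_onb: "is_onb (some_onb :: 'a::chilbert_space set)"
  unfolding some_onb_def by (rule someI_ex [OF ex_onb])

text \<open>
  The type \<open>'a \<Rightarrow>\<^sub>L 'a\<close> consists of the bounded real-linear operators; the operators of
  interest are those satisfying \<open>clinear\<close>. Their norm in this type is the usual operator norm.
\<close>

definition clinear :: "('a::chilbert_space \<Rightarrow>\<^sub>L 'a) \<Rightarrow> bool" where
  "clinear T \<longleftrightarrow> (\<forall>c x. blinfun_apply T (c *\<^sub>C x) = c *\<^sub>C blinfun_apply T x)"

lift_definition scaleC_op :: "complex \<Rightarrow> ('a::chilbert_space \<Rightarrow>\<^sub>L 'a) \<Rightarrow> 'a \<Rightarrow>\<^sub>L 'a"
  is "\<lambda>c T x. c *\<^sub>C T x"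
  by (rule bounded_linear_compose [OF bounded_linear_scaleC])

definition adj :: "('a::chilbert_space \<Rightarrow>\<^sub>L 'a) \<Rightarrow> 'a \<Rightarrow>\<^sub>L 'a" where
  "adj T = (THE S. \<forall>x y. cinner (blinfun_apply T x) y = cinner x (blinfun_apply S y))"

definition selfadjoint_op :: "('a::chilbert_space \<Rightarrow>\<^sub>L 'a) \<Rightarrow> bool" where
  "selfadjoint_op T \<longleftrightarrow> clinear T \<and> adj T = T"

definition unitary_op :: "('a::chilbert_space \<Rightarrow>\<^sub>L 'a) \<Rightarrow> bool" where
  "unitary_op U \<longleftrightarrow> clinear U \<and> adj U o\<^sub>L U = id_blinfun \<and> U o\<^sub>L adj U = id_blinfun"

definition positive_op :: "('a::chilbert_space \<Rightarrow>\<^sub>L 'a) \<Rightarrow> bool" where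
  "positive_op T \<longleftrightarrow> clinear T \<and>
     (\<forall>x. Im (cinner (blinfun_apply T x) x) = 0 \<and> 0 \<le> Re (cinner (blinfun_apply T x) x))"

definition abs_op :: "('a::chilbert_space \<Rightarrow>\<^sub>L 'a) \<Rightarrow> 'a \<Rightarrow>\<^sub>L 'a" where
  "abs_op T = (THE P. positive_op P \<and> P o\<^sub>L P = adj T o\<^sub>L T)"

definition hilbert_schmidt :: "('a::chilbert_space \<Rightarrow>\<^sub>L 'a) \<Rightarrow> bool" where
  "hilbert_schmidt T \<longleftrightarrow> clinear T \<and> (\<lambda>e. (norm (blinfun_apply T e))\<^sup>2) summable_on some_onb"

definition hs_norm :: "('a::chilbert_space \<Rightarrow>\<^sub>L 'a) \<Rightarrow> real" where
  "hs_norm T = sqrt (\<Sum>\<^sub>\<infinity>e\<in>some_onb. (norm (blinfun_apply T e))\<^sup>2)"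

definition trace_class :: "('a::chilbert_space \<Rightarrow>\<^sub>L 'a) \<Rightarrow> bool" where
  "trace_class T \<longleftrightarrow> clinear T \<and> (\<lambda>e. cinner (blinfun_apply (abs_op T) e) e) summable_on some_onb"

definition trace_op :: "('a::chilbert_space \<Rightarrow>\<^sub>L 'a) \<Rightarrow> complex" where
  "trace_op T = (\<Sum>\<^sub>\<infinity>e\<in>some_onb. cinner (blinfun_apply T e) e)"

primrec op_power :: "('a::chilbert_space \<Rightarrow>\<^sub>L 'a) \<Rightarrow> nat \<Rightarrow> 'a \<Rightarrow>\<^sub>L 'a" where
  "op_power T 0 = id_blinfun"
| "op_power T (Suc n) = T o\<^sub>L op_power T n"

definition exp_op :: "('a::chilbert_space \<Rightarrow>\<^sub>L 'a) \<Rightarrow> 'a \<Rightarrow>\<^sub>L 'a" where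
  "exp_op T = (\<Sum>n. op_power T n /\<^sub>R fact n)"

definition inv_op :: "('a::chilbert_space \<Rightarrow>\<^sub>L 'a) \<Rightarrow> 'a \<Rightarrow>\<^sub>L 'a" where
  "inv_op T = (THE S. S o\<^sub>L T = id_blinfun \<and> T o\<^sub>L S = id_blinfun)"

definition op_powi :: "('a::chilbert_space \<Rightarrow>\<^sub>L 'a) \<Rightarrow> int \<Rightarrow> 'a \<Rightarrow>\<^sub>L 'a" where
  "op_powi V r = (if r \<ge> 0 then op_power V (nat r) else op_power (inv_op V) (nat (- r)))"

text \<open>
  A trigonometric polynomial is given by its coefficients \<open>a :: int \<Rightarrow> complex\<close>, of which only
  finitely many are nonzero.
\<close>

definition is_trig_poly :: "(int \<Rightarrow> complex) \<Rightarrow> bool" where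
  "is_trig_poly a \<longleftrightarrow> finite {r. a r \<noteq> 0}"

definition trig_poly :: "(int \<Rightarrow> complex) \<Rightarrow> complex \<Rightarrow> complex" where
  "trig_poly a z = (\<Sum>r | a r \<noteq> 0. a r * z powi r)"

definition trig_poly_op :: "(int \<Rightarrow> complex) \<Rightarrow> ('a::chilbert_space \<Rightarrow>\<^sub>L 'a) \<Rightarrow> 'a \<Rightarrow>\<^sub>L 'a" where
  "trig_poly_op a V = (\<Sum>r | a r \<noteq> 0. scaleC_op (a r) (op_powi V r))"

definition unitary_path :: "('a::chilbert_space \<Rightarrow>\<^sub>L 'a) \<Rightarrow> ('a \<Rightarrow>\<^sub>L 'a) \<Rightarrow> real \<Rightarrow> 'a \<Rightarrow>\<^sub>L 'a" where
  "unitary_path A U0 s = exp_op (scaleC_op (\<i> * complex_of_real s) A) o\<^sub>L U0"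

definition taylor_remainder ::
  "(int \<Rightarrow> complex) \<Rightarrow> ('a::chilbert_space \<Rightarrow>\<^sub>L 'a) \<Rightarrow> ('a \<Rightarrow>\<^sub>L 'a) \<Rightarrow> ('a \<Rightarrow>\<^sub>L 'a) \<Rightarrow> 'a \<Rightarrow>\<^sub>L 'a" where
  "taylor_remainder a A U U0 =
     trig_poly_op a U - trig_poly_op a U0
       - vector_derivative (\<lambda>s. trig_poly_op a (unitary_path A U0 s)) (at 0)"

definition second_deriv_circle :: "(int \<Rightarrow> complex) \<Rightarrow> real \<Rightarrow> complex" where
  "second_deriv_circle a t =
     vector_derivative (\<lambda>u. vector_derivative (\<lambda>v. trig_poly a (exp (\<i> * complex_of_real v))) (at u)) (at t)"

definition satisfies_trace_formula ::
  "('a::chilbert_space \<Rightarrow>\<^sub>L 'a) \<Rightarrow> ('a \<Rightarrow>\<^sub>L 'a) \<Rightarrow> ('a \<Rightarrow>\<^sub>L 'a) \<Rightarrow> (real \<Rightarrow> complex) \<Rightarrow> bool" where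
  "satisfies_trace_formula A U U0 \<eta> \<longleftrightarrow>
     set_integrable lebesgue {0..2 * pi} \<eta> \<and>
     (\<forall>a. is_trig_poly a \<longrightarrow>
        trace_op (taylor_remainder a A U U0) =
          (LINT t:{0..2 * pi}|lebesgue. second_deriv_circle a t * \<eta> t))"

end

theory Submission
  imports Defs
begin

text \<open>
  Put \<open>U\<^sub>s = exp (i s A) U\<^sub>0\<close> and let \<open>\<rho> n\<close> be the trace of the Taylor remainder for \<open>p(z) = z\<^sup>n\<close>.
  Telescoping \<open>U\<^sup>n - U\<^sub>0\<^sup>n\<close> writes the remainder as a finite sum of products of two Hilbert-Schmidt
  operators. The formula says that \<open>\<gamma> n = - \<rho> n / n\<^sup>2\<close> (\<open>n \<noteq> 0\<close>) are the Fourier coefficients of \<open>\<eta>\<close>,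
  so uniqueness is that of Fourier coefficients.

  For existence, the trace of the remainder on \<open>[0, s]\<close> is differentiable in \<open>s\<close> with derivative
  \<open>Tr (A (q(U\<^sub>s) - q(U\<^sub>0)))\<close>, where \<open>q = dp/dt\<close>. Since \<open>q\<close> has Lipschitz constant
  \<open>\<pi>/2 \<parallel>p''\<parallel>\<close> for the chordal distance on the circle, and
  \<open>\<parallel>q(U) - q(V)\<parallel>\<^sub>2 \<le> Lip(q) \<parallel>U - V\<parallel>\<^sub>2\<close> for unitary \<open>U\<close>, \<open>V\<close>, integration over \<open>s\<close> bounds the trace by
  \<open>\<pi>/4 \<parallel>A\<parallel>\<^sub>2\<^sup>2 \<parallel>p''\<parallel>\<close>. Subtracting the mean of a trigonometric polynomial at most doubles its norm, so
  \<open>\<gamma>\<close> is a functional of norm at most \<open>\<pi>/2 \<parallel>A\<parallel>\<^sub>2\<^sup>2\<close>, and by duality its Fejer means are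
  bounded by this constant in \<open>L\<^sup>1\<close>. The same estimate for the difference of two generators shows that
  \<open>\<gamma>\<close> depends continuously on \<open>A\<close>; if \<open>A\<close> has finite rank then \<open>\<rho> n = O(n)\<close>, so \<open>\<gamma>\<close> is
  square summable and its Fejer means converge. Hence they are Cauchy in \<open>L\<^sup>1\<close> for every \<open>A\<close>.
\<close>

section \<open>Orthonormal expansions\<close>

text \<open>A bounded functional on trigonometric polynomials is in general only a measure; the
  detour through finite rank generators is what produces a density. If \<open>Y = Y P\<close> with
  \<open>Y\<close> and \<open>P\<close> Hilbert-Schmidt, then \<open>Tr (Y (W^n - V^n))\<close> is
  bounded uniformly in \<open>n\<close> for unitary \<open>W\<close>, \<open>V\<close>, so only the
  factor \<open>n\<close> from differentiating \<open>z^n\<close> is left to grow.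

  The derivative of \<open>U_s^n\<close> alone is merely Hilbert-Schmidt and need not have a trace.
  Its difference at two points of the path does, and cyclicity gives all \<open>n\<close> telescoped
  terms the same trace; hence the derivative formula.

  The factor \<open>\<pi>/2\<close> is the largest ratio of arc to chord for arcs up to a half
  circle. The Lipschitz estimate holds in Hilbert-Schmidt norm with the scalar constant because left
  multiplication by \<open>U\<close> and right multiplication by \<open>V\<close> are commuting
  unitaries on the Hilbert space of Hilbert-Schmidt operators, so a double operator integral is
  bounded there by the supremum of its symbol. The symbol here is the divided difference of
  \<open>q\<close>.\<close>

lemma scaleC_one [simp]: "1 *\<^sub>C x = (x::'a::chilbert_space)"
  using scaleR_scaleC [of 1 x] by simp

lemma cinner_add_right: "cinner x (y + z) = cinner x y + cinner x z" for x y z :: "'a::chilbert_space"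
  by (metis cinner_add_left cinner_commute complex_cnj_add)

lemma cinner_scaleR_left: "cinner (r *\<^sub>R x) y = r *\<^sub>R cinner x y" for x y :: "'a::chilbert_space"
  by (simp add: scaleR_scaleC [of r x] cinner_scaleC_left scaleR_conv_of_real)

lemma cinner_scaleR_right: "cinner x (r *\<^sub>R y) = r *\<^sub>R cinner x y" for x y :: "'a::chilbert_space"
  by (simp add: scaleR_scaleC [of r y] cinner_scaleC_right scaleR_conv_of_real)

text \<open>Multiplying \<open>x\<close> by the unimodular scalar \<open>c\<close> makes the complex
  inner product real and nonnegative, which reduces the claim to the real Cauchy-Schwarz
  inequality.\<close>

lemma cmod_cinner_le: "cmod (cinner x y) \<le> norm x * norm y" for x y :: "'a::chilbert_space"
proof (cases "cinner x y = 0")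
  case False
  define c where "c = cnj (cinner x y) / cmod (cinner x y)"
  have c: "cmod c = 1"
    using False by (simp add: c_def norm_divide)
  have "c * cinner x y = of_real (cmod (cinner x y))"
    using False unfolding c_def
    by (simp add: divide_simps) (metis complex_norm_square mult.commute power2_eq_square of_real_mult)
  then have "cmod (cinner x y) = inner (c *\<^sub>C x) y"
    by (simp add: inner_eq_Re_cinner cinner_scaleC_left)
  also have "\<dots> \<le> norm (c *\<^sub>C x) * norm y"
    by (rule norm_cauchy_schwarz)
  finally show ?thesis
    by (simp add: norm_scaleC c)
qed simp

lemma bounded_bilinear_cinner: "bounded_bilinear (cinner :: 'a::chilbert_space \<Rightarrow> 'a \<Rightarrow> complex)"
  by (rule bounded_bilinear.intro)
    (auto simp: cinner_add_left cinner_add_right cinner_scaleR_left cinner_scaleR_right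
      intro!: exI [of _ 1] cmod_cinner_le)

lemma bounded_bilinear_scaleC: "bounded_bilinear (scaleC :: complex \<Rightarrow> 'a::chilbert_space \<Rightarrow> 'a)"
proof (rule bounded_bilinear.intro)
  fix r and a :: complex and b :: 'a
  show "(r *\<^sub>R a) *\<^sub>C b = r *\<^sub>R (a *\<^sub>C b)"
    by (simp only: scaleR_conv_of_real scaleR_scaleC [where 'a = 'a] scaleC_scaleC)
  show "a *\<^sub>C (r *\<^sub>R b) = r *\<^sub>R (a *\<^sub>C b)"
    by (simp only: scaleR_scaleC [where 'a = 'a] scaleC_scaleC mult.commute)
qed (auto simp: scaleC_add_left scaleC_add_right norm_scaleC intro!: exI [of _ 1])

interpretation cinner: bounded_bilinear "cinner :: 'a::chilbert_space \<Rightarrow> 'a \<Rightarrow> complex"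
  by (rule bounded_bilinear_cinner)

interpretation scaleC: bounded_bilinear "scaleC :: complex \<Rightarrow> 'a::chilbert_space \<Rightarrow> 'a"
  by (rule bounded_bilinear_scaleC)

lemma cinner_eqI_right: "(\<And>z. cinner z x = cinner z y) \<Longrightarrow> x = y" for x y :: "'a::chilbert_space"
  using cinner_self [of "x - y"] by (simp add: cinner.diff_right)

definition orthonormal :: "'a::chilbert_space set \<Rightarrow> bool" where
  "orthonormal B \<longleftrightarrow> (\<forall>e\<in>B. \<forall>f\<in>B. cinner e f = (if e = f then 1 else 0))"

lemma is_onb_orthonormal: "is_onb B \<Longrightarrow> orthonormal B"
  by (auto simp: is_onb_def orthonormal_def cinner_self)

lemma orthonormal_norm_sum:
  assumes "orthonormal B" "finite F" "F \<subseteq> B"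
  shows "(norm (\<Sum>e\<in>F. a e *\<^sub>C e))\<^sup>2 = (\<Sum>e\<in>F. (cmod (a e))\<^sup>2)"
proof -
  have "complex_of_real ((norm (\<Sum>e\<in>F. a e *\<^sub>C e))\<^sup>2)
      = (\<Sum>e\<in>F. \<Sum>f\<in>F. a e * (cnj (a f) * cinner e f))"
    unfolding cinner_self [symmetric] cinner.sum_left
    by (simp add: cinner.sum_right cinner_scaleC_left cinner_scaleC_right sum_distrib_left mult_ac)
  also have "\<dots> = (\<Sum>e\<in>F. \<Sum>f\<in>F. if f = e then a e * cnj (a e) else 0)"
    using assms unfolding orthonormal_def by (intro sum.cong) (auto split: if_splits)
  also have "\<dots> = (\<Sum>e\<in>F. a e * cnj (a e))"
    using assms by simp
  also have "\<dots> = of_real (\<Sum>e\<in>F. (cmod (a e))\<^sup>2)"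
    unfolding of_real_sum complex_norm_square ..
  finally show ?thesis
    by (simp only: of_real_eq_iff)
qed

lemma bessel_finite:
  assumes "orthonormal B" "finite F" "F \<subseteq> B"
  shows "(\<Sum>e\<in>F. (cmod (cinner x e))\<^sup>2) \<le> (norm x)\<^sup>2"
proof -
  define y where "y = (\<Sum>e\<in>F. cinner x e *\<^sub>C e)"
  have "cinner x y = (\<Sum>e\<in>F. cinner x e * cnj (cinner x e))"
    unfolding y_def cinner.sum_right cinner_scaleC_right by (simp add: mult.commute)
  also have "\<dots> = of_real (\<Sum>e\<in>F. (cmod (cinner x e))\<^sup>2)"
    unfolding of_real_sum complex_norm_square ..
  finally have *: "inner x y = (\<Sum>e\<in>F. (cmod (cinner x e))\<^sup>2)"
    by (simp add: inner_eq_Re_cinner)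
  have "(norm y)\<^sup>2 = (\<Sum>e\<in>F. (cmod (cinner x e))\<^sup>2)"
    unfolding y_def by (rule orthonormal_norm_sum [OF assms])
  then have "0 \<le> (norm x)\<^sup>2 - (\<Sum>e\<in>F. (cmod (cinner x e))\<^sup>2)"
    using * zero_le_power2 [of "norm (x - y)"]
    by (simp add: power2_norm_eq_inner inner_diff_left inner_diff_right inner_commute)
  then show ?thesis by simp
qed

lemma bessel_summable:
  assumes "orthonormal B"
  shows "(\<lambda>e. (cmod (cinner x e))\<^sup>2) summable_on B"
  by (rule nonneg_bdd_above_summable_on)
    (auto intro!: bdd_aboveI2 [where M = "(norm x)\<^sup>2"] bessel_finite assms)

text \<open>Orthogonal series converge unconditionally without converging absolutely, so comparison
  of norms cannot be used for them. Two partial sums over sets containing \<open>F\<close> differ by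
  two sums over sets disjoint from \<open>F\<close>.\<close>

lemma summable_on_Cauchy_banach:
  fixes f :: "'i \<Rightarrow> 'b::banach"
  assumes "\<And>e. e > 0 \<Longrightarrow> \<exists>F. finite F \<and> F \<subseteq> A \<and> (\<forall>G. finite G \<longrightarrow> G \<subseteq> A - F \<longrightarrow> norm (sum f G) < e)"
  shows "f summable_on A"
proof -
  have "\<exists>x. filtermap (sum f) (finite_subsets_at_top A) \<le> nhds x"
  proof -
    let ?Fl = "filtermap (sum f) (finite_subsets_at_top A)"
    have "cauchy_filter ?Fl"
      unfolding cauchy_filter_metric_filtermap
    proof (intro allI impI)
      fix e :: real assume "e > 0"
      then obtain F where F: "finite F" "F \<subseteq> A"
        "\<And>G. finite G \<Longrightarrow> G \<subseteq> A - F \<Longrightarrow> norm (sum f G) < e / 2"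
        using assms [of "e / 2"] by auto
      have "dist (sum f X) (sum f Y) < e"
        if X: "finite X" "F \<subseteq> X" "X \<subseteq> A" and Y: "finite Y" "F \<subseteq> Y" "Y \<subseteq> A" for X Y
      proof -
        have "sum f X = sum f F + sum f (X - F)" "sum f Y = sum f F + sum f (Y - F)"
          using X Y by (simp_all add: sum.subset_diff)
        then have "dist (sum f X) (sum f Y) = norm (sum f (X - F) - sum f (Y - F))"
          by (simp add: dist_norm)
        also have "\<dots> \<le> norm (sum f (X - F)) + norm (sum f (Y - F))"
          by (rule norm_triangle_ineq4)
        also have "\<dots> < e / 2 + e / 2"
          using X Y by (intro add_strict_mono F(3)) auto
        finally show ?thesis by simp
      qed
      moreover have "eventually (\<lambda>X. finite X \<and> F \<subseteq> X \<and> X \<subseteq> A) (finite_subsets_at_top A)"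
        using F by (auto simp: eventually_finite_subsets_at_top)
      ultimately show "\<exists>P. eventually P (finite_subsets_at_top A) \<and>
          (\<forall>x y. P x \<and> P y \<longrightarrow> dist (sum f x) (sum f y) < e)"
        by (intro exI [of _ "\<lambda>X. finite X \<and> F \<subseteq> X \<and> X \<subseteq> A"]) simp
    qed
    then have "convergent_filter ?Fl"
      by (simp add: cauchy_filter_convergent)
    then show ?thesis by (simp add: convergent_filter_iff)
  qed
  then show ?thesis
    by (auto simp: summable_on_def has_sum_def filterlim_def)
qed

text \<open>By Pythagoras the squared norm of a piece of the series is the corresponding piece of a
  convergent numerical series, so the Cauchy criterion applies.\<close>

lemma orthonormal_summable:
  assumes B: "orthonormal B" and a: "(\<lambda>e. (cmod (a e))\<^sup>2) summable_on B"
  shows "(\<lambda>e. a e *\<^sub>C e) summable_on B"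
proof (rule summable_on_Cauchy_banach)
  fix r :: real assume r: "r > 0"
  obtain F where F: "finite F" "F \<subseteq> B"
    "dist (\<Sum>e\<in>F. (cmod (a e))\<^sup>2) (infsum (\<lambda>e. (cmod (a e))\<^sup>2) B) \<le> r\<^sup>2 / 2"
    using infsum_finite_approximation [OF a, of "r\<^sup>2 / 2"] r by auto
  have "norm (\<Sum>e\<in>G. a e *\<^sub>C e) < r" if G: "finite G" "G \<subseteq> B - F" for G
  proof -
    have "(\<Sum>e\<in>F. (cmod (a e))\<^sup>2) + (\<Sum>e\<in>G. (cmod (a e))\<^sup>2) = (\<Sum>e\<in>F \<union> G. (cmod (a e))\<^sup>2)"
      using F G by (intro sum.union_disjoint [symmetric]) auto
    also have "\<dots> \<le> infsum (\<lambda>e. (cmod (a e))\<^sup>2) B"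
      using F G by (intro finite_sum_le_infsum a) auto
    finally have "(\<Sum>e\<in>G. (cmod (a e))\<^sup>2) \<le> r\<^sup>2 / 2"
      using F(3) unfolding dist_real_def by linarith
    then have "(norm (\<Sum>e\<in>G. a e *\<^sub>C e))\<^sup>2 \<le> r\<^sup>2 / 2"
      using orthonormal_norm_sum [OF B] G by (metis Diff_subset order_trans)
    then have "(norm (\<Sum>e\<in>G. a e *\<^sub>C e))\<^sup>2 < r\<^sup>2"
      using r by (smt (verit) field_sum_of_halves zero_less_power)
    then show ?thesis
      using r by (simp add: power_less_imp_less_base)
  qed
  with F show "\<exists>F. finite F \<and> F \<subseteq> B \<and> (\<forall>G. finite G \<longrightarrow> G \<subseteq> B - F \<longrightarrow> norm (\<Sum>e\<in>G. a e *\<^sub>C e) < r)"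
    by blast
qed

text \<open>The series converges to some \<open>y\<close> by Bessel; \<open>x - y\<close> is
  orthogonal to all of \<open>B\<close>, hence zero by the last clause of
  \<open>is_onb\<close>.\<close>

lemma onb_expansion:
  assumes "is_onb B"
  shows "((\<lambda>e. cinner x e *\<^sub>C e) has_sum x) B"
proof -
  note B = is_onb_orthonormal [OF assms]
  have s: "(\<lambda>e. cinner x e *\<^sub>C e) summable_on B"
    by (intro orthonormal_summable bessel_summable B)
  define y where "y = infsum (\<lambda>e. cinner x e *\<^sub>C e) B"
  have y: "((\<lambda>e. cinner x e *\<^sub>C e) has_sum y) B"
    using s by (simp add: y_def)
  have "cinner (x - y) f = 0" if f: "f \<in> B" for f
  proof -
    have "((\<lambda>e. cinner (cinner x e *\<^sub>C e) f) has_sum cinner y f) B"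
      using has_sum_bounded_linear [OF cinner.bounded_linear_left y, of f] by (simp add: o_def)
    moreover have "((\<lambda>e. cinner (cinner x e *\<^sub>C e) f) has_sum cinner x f) B"
      using f B by (intro has_sum_finite_neutralI [of "{f}"]) (auto simp: cinner_scaleC_left orthonormal_def)
    ultimately show ?thesis
      by (metis cinner.diff_left has_sum_unique right_minus_eq)
  qed
  then have "x = y"
    using assms unfolding is_onb_def by (metis eq_iff_diff_eq_0)
  with y show ?thesis by simp
qed

lemma parseval_cinner:
  assumes "is_onb B"
  shows "((\<lambda>e. cinner x e * cinner e y) has_sum cinner x y) B"
  using has_sum_bounded_linear [OF cinner.bounded_linear_left onb_expansion [OF assms, of x], of y]
  by (simp add: o_def cinner_scaleC_left)

lemma parseval:
  assumes "is_onb B"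
  shows "((\<lambda>e. (cmod (cinner x e))\<^sup>2) has_sum (norm x)\<^sup>2) B"
proof -
  have "((\<lambda>e. complex_of_real ((cmod (cinner x e))\<^sup>2)) has_sum of_real ((norm x)\<^sup>2)) B"
    using parseval_cinner [OF assms, of x x] unfolding complex_norm_square cinner_self
    by (subst (asm) cinner_commute) (simp add: mult.commute)
  then show ?thesis
    by (simp only: has_sum_of_real_iff)
qed

section \<open>Adjoints\<close>

text \<open>The representing vector must have the coefficients \<open>cnj (f e)\<close>. Their
  square summability follows by testing \<open>f\<close> on its own finite section \<open>v\<close>,
  where \<open>f v\<close> equals the squared norm of \<open>v\<close>, so that
  \<open>norm v\<close> is at most the bound of \<open>f\<close>.\<close>

lemma riesz:
  assumes f: "bounded_linear (f :: 'a::chilbert_space \<Rightarrow> complex)"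
    and fC: "\<And>c x. f (c *\<^sub>C x) = c * f x"
  obtains z where "\<And>x. f x = cinner x z"
proof -
  note onb = is_onb_some_onb and B = is_onb_orthonormal [OF is_onb_some_onb]
  let ?B = "some_onb :: 'a set"
  interpret f: bounded_linear f by fact
  obtain K where K: "\<And>x. cmod (f x) \<le> norm x * K" "K \<ge> 0"
    using f.nonneg_bounded by auto
  have "(\<Sum>e\<in>F. (cmod (f e))\<^sup>2) \<le> K\<^sup>2" if F: "finite F" "F \<subseteq> ?B" for F
  proof -
    define S where "S = (\<Sum>e\<in>F. (cmod (f e))\<^sup>2)"
    define v where "v = (\<Sum>e\<in>F. cnj (f e) *\<^sub>C e)"
    have "f v = (\<Sum>e\<in>F. f e * cnj (f e))"
      by (simp add: v_def f.sum fC mult.commute)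
    also have "\<dots> = of_real S"
      unfolding S_def of_real_sum complex_norm_square ..
    finally have "S \<le> norm v * K"
      using K(1) [of v] by (metis abs_ge_self norm_of_real order_trans)
    moreover have "(norm v)\<^sup>2 = S"
      unfolding v_def S_def by (subst orthonormal_norm_sum [OF B F]) simp
    ultimately have "(norm v)\<^sup>2 \<le> norm v * K" by simp
    then have "norm v \<le> K"
      using K(2) by (cases "norm v = 0") (auto simp: power2_eq_square)
    then have "(norm v)\<^sup>2 \<le> K\<^sup>2"
      by (simp add: power_mono)
    then show ?thesis
      using \<open>(norm v)\<^sup>2 = S\<close> S_def by simp
  qed
  then have "(\<lambda>e. (cmod (cnj (f e)))\<^sup>2) summable_on ?B"
    by (intro nonneg_bdd_above_summable_on) (auto intro!: bdd_aboveI2 [where M = "K\<^sup>2"])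
  then have "(\<lambda>e. cnj (f e) *\<^sub>C e) summable_on ?B"
    by (rule orthonormal_summable [OF B])
  then obtain z where z: "((\<lambda>e. cnj (f e) *\<^sub>C e) has_sum z) ?B"
    by (auto simp: summable_on_def)
  have "f x = cinner x z" for x
  proof -
    have "((\<lambda>e. f (cinner x e *\<^sub>C e)) has_sum f x) ?B"
      using has_sum_bounded_linear [OF f onb_expansion [OF onb, of x]] by (simp add: o_def)
    moreover have "((\<lambda>e. cinner x (cnj (f e) *\<^sub>C e)) has_sum cinner x z) ?B"
      using has_sum_bounded_linear [OF cinner.bounded_linear_right z, of x] by (simp add: o_def)
    ultimately show ?thesis
      by (simp add: fC cinner_scaleC_right mult.commute has_sum_unique)
  qed
  then show ?thesis by (rule that)
qed

text \<open>\<open>adj\<close> is a definite description and carries no information before existence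
  is known. Riesz gives the adjoint pointwise; linearity and the bound follow from the defining
  identity.\<close>

lemma adj_exists:
  assumes T: "clinear T"
  obtains S where "\<And>x y. cinner (blinfun_apply T x) y = cinner x (blinfun_apply S y)"
proof -
  have "\<exists>z. \<forall>x. cinner (blinfun_apply T x) y = cinner x z" for y
  proof -
    have 1: "bounded_linear (\<lambda>x. cinner (blinfun_apply T x) y)"
      by (rule bounded_linear_compose [OF cinner.bounded_linear_left blinfun.bounded_linear_right])
    have 2: "cinner (blinfun_apply T (c *\<^sub>C x)) y = c * cinner (blinfun_apply T x) y" for c x
      using T by (simp add: clinear_def cinner_scaleC_left)
    show ?thesis
      by (rule riesz [OF 1 2]) blast
  qed
  then obtain g where g: "\<And>x y. cinner (blinfun_apply T x) y = cinner x (g y)"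
    by metis
  have "bounded_linear g"
  proof (rule bounded_linear_intro [where K = "norm T"])
    show "g (x + y) = g x + g y" for x y
      by (rule cinner_eqI_right) (simp add: cinner_add_right flip: g)
    show "g (r *\<^sub>R x) = r *\<^sub>R g x" for r x
      by (rule cinner_eqI_right) (simp add: cinner_scaleR_right flip: g)
    show "norm (g x) \<le> norm x * norm T" for x
    proof (cases "norm (g x) = 0")
      case False
      have "(norm (g x))\<^sup>2 = cmod (cinner (g x) (g x))"
        by (simp add: cinner_self norm_power)
      also have "\<dots> = cmod (cinner (blinfun_apply T (g x)) x)"
        by (simp add: g)
      also have "\<dots> \<le> norm (blinfun_apply T (g x)) * norm x"
        by (rule cmod_cinner_le)
      also have "\<dots> \<le> (norm T * norm (g x)) * norm x"
        by (intro mult_right_mono norm_blinfun) auto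
      finally have "norm (g x) * norm (g x) \<le> norm (g x) * (norm x * norm T)"
        by (simp add: power2_eq_square mult_ac)
      then show ?thesis
        using False by simp
    qed simp
  qed
  then have "blinfun_apply (Blinfun g) = g"
    by (rule bounded_linear_Blinfun_apply)
  then show ?thesis
    using g that [of "Blinfun g"] by simp
qed

lemma adj_eqI:
  assumes "\<And>x y. cinner (blinfun_apply T x) y = cinner x (blinfun_apply S y)"
  shows "adj T = S"
  unfolding adj_def
proof (rule the_equality)
  fix S' assume "\<forall>x y. cinner (blinfun_apply T x) y = cinner x (blinfun_apply S' y)"
  then have "cinner x (blinfun_apply S' y) = cinner x (blinfun_apply S y)" for x y
    using assms by simp
  then show "S' = S"
    by (intro blinfun_eqI) (rule cinner_eqI_right)
qed (simp add: assms)

lemma cinner_adj_right: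
  assumes "clinear T"
  shows "cinner x (blinfun_apply (adj T) y) = cinner (blinfun_apply T x) y"
proof -
  obtain S where S: "\<And>x y. cinner (blinfun_apply T x) y = cinner x (blinfun_apply S y)"
    by (rule adj_exists [OF assms]) blast
  show ?thesis
    unfolding adj_eqI [OF S] by (simp add: S)
qed

lemma cinner_adj_left:
  assumes "clinear T"
  shows "cinner (blinfun_apply (adj T) x) y = cinner x (blinfun_apply T y)"
  by (subst (1 2) cinner_commute) (simp add: cinner_adj_right assms)

lemma scaleC_op_apply [simp]: "blinfun_apply (scaleC_op c T) x = c *\<^sub>C blinfun_apply T x"
  by (simp add: scaleC_op.rep_eq)

lemma clinear_id [simp]: "clinear id_blinfun"
  and clinear_0 [simp]: "clinear 0"
  and clinear_add [simp]: "clinear S \<Longrightarrow> clinear T \<Longrightarrow> clinear (S + T)"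
  and clinear_diff [simp]: "clinear S \<Longrightarrow> clinear T \<Longrightarrow> clinear (S - T)"
  and clinear_uminus [simp]: "clinear S \<Longrightarrow> clinear (- S)"
  and clinear_compose [simp]: "clinear S \<Longrightarrow> clinear T \<Longrightarrow> clinear (S o\<^sub>L T)"
  and clinear_scaleC_op [simp]: "clinear S \<Longrightarrow> clinear (scaleC_op c S)"
  and clinear_scaleR [simp]: "clinear S \<Longrightarrow> clinear (r *\<^sub>R S)"
  by (auto simp: clinear_def scaleC.zero_right blinfun.add_left blinfun.diff_left blinfun.minus_left scaleC.add_right
      scaleC.diff_right scaleC.minus_right scaleC_scaleC mult.commute blinfun.scaleR_left scaleR_scaleC)

lemma clinear_sum [simp]: "(\<And>i. i \<in> I \<Longrightarrow> clinear (f i)) \<Longrightarrow> clinear (sum f I)"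
  by (induction I rule: infinite_finite_induct) auto

lemma clinear_adj [simp]: "clinear T \<Longrightarrow> clinear (adj T)"
  unfolding clinear_def [of "adj T"]
  by (intro allI, rule cinner_eqI_right) (simp add: cinner_adj_right cinner_scaleC_right)

lemma adj_adj [simp]: "clinear T \<Longrightarrow> adj (adj T) = T"
  by (rule adj_eqI) (simp add: cinner_adj_left)

lemma adj_id [simp]: "adj id_blinfun = id_blinfun"
  and adj_0 [simp]: "adj 0 = 0"
  and adj_add: "clinear S \<Longrightarrow> clinear T \<Longrightarrow> adj (S + T) = adj S + adj T"
  and adj_diff: "clinear S \<Longrightarrow> clinear T \<Longrightarrow> adj (S - T) = adj S - adj T"
  and adj_compose: "clinear S \<Longrightarrow> clinear T \<Longrightarrow> adj (S o\<^sub>L T) = adj T o\<^sub>L adj S"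
  and adj_scaleC_op: "clinear S \<Longrightarrow> adj (scaleC_op c S) = scaleC_op (cnj c) (adj S)"
  by (rule adj_eqI; simp add: cinner_adj_right blinfun.add_left blinfun.diff_left cinner.add_left
      cinner.add_right cinner.diff_left cinner.diff_right cinner.zero_left cinner.zero_right
      cinner_scaleC_left cinner_scaleC_right)+

lemma norm_adj_le: "clinear T \<Longrightarrow> norm (adj T) \<le> norm T"
proof (rule norm_blinfun_bound)
  fix x assume T: "clinear T"
  show "norm (blinfun_apply (adj T) x) \<le> norm T * norm x"
  proof (cases "blinfun_apply (adj T) x = 0")
    case False
    let ?y = "blinfun_apply (adj T) x"
    have "norm ?y * norm ?y = cmod (cinner ?y ?y)"
      by (simp add: cinner_self norm_mult power2_eq_square)
    also have "\<dots> = cmod (cinner (blinfun_apply T ?y) x)"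
      by (simp add: cinner_adj_right T)
    also have "\<dots> \<le> norm (blinfun_apply T ?y) * norm x"
      by (rule cmod_cinner_le)
    also have "\<dots> \<le> (norm T * norm ?y) * norm x"
      by (intro mult_right_mono norm_blinfun) auto
    finally have "norm ?y * norm ?y \<le> norm ?y * (norm T * norm x)"
      by (simp add: mult_ac)
    then show ?thesis
      using False by simp
  qed (simp)
qed simp

lemma norm_adj [simp]: "clinear T \<Longrightarrow> norm (adj T) = norm T"
  by (metis adj_adj clinear_adj norm_adj_le order_antisym)

section \<open>Hilbert-Schmidt operators\<close>

text \<open>The inner product \<open>Tr (adj T o\<^sub>L S)\<close> of the Hilbert space of
  Hilbert-Schmidt operators, linear in the first argument.\<close>

definition hsi :: "('a::chilbert_space \<Rightarrow>\<^sub>L 'a) \<Rightarrow> ('a \<Rightarrow>\<^sub>L 'a) \<Rightarrow> complex" where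
  "hsi S T = (\<Sum>\<^sub>\<infinity>e\<in>some_onb. cinner (blinfun_apply S e) (blinfun_apply T e))"

lemma hilbert_schmidt_clinear [simp]: "hilbert_schmidt T \<Longrightarrow> clinear T"
  by (simp add: hilbert_schmidt_def)

lemma hilbert_schmidt_summable:
  "hilbert_schmidt T \<Longrightarrow> (\<lambda>e. (norm (blinfun_apply T e))\<^sup>2) summable_on some_onb"
  by (simp add: hilbert_schmidt_def)

lemma hs_norm_nonneg [simp]: "0 \<le> hs_norm T"
  by (simp add: hs_norm_def infsum_nonneg)

lemma hs_norm_power2: "(hs_norm T)\<^sup>2 = (\<Sum>\<^sub>\<infinity>e\<in>some_onb. (norm (blinfun_apply T e))\<^sup>2)"
  by (simp add: hs_norm_def infsum_nonneg)

lemma hsi_has_sum: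
  assumes "hilbert_schmidt S" "hilbert_schmidt T"
  shows "((\<lambda>e. cinner (blinfun_apply S e) (blinfun_apply T e)) has_sum hsi S T) some_onb"
proof -
  have "(\<lambda>e. (norm (blinfun_apply S e))\<^sup>2 + (norm (blinfun_apply T e))\<^sup>2) summable_on some_onb"
    using assms by (intro summable_on_add hilbert_schmidt_summable)
  then have "(\<lambda>e. norm (cinner (blinfun_apply S e) (blinfun_apply T e))) summable_on some_onb"
  proof (rule Infinite_Sum.abs_summable_on_comparison_test')
    fix e :: 'a
    have "cmod (cinner (blinfun_apply S e) (blinfun_apply T e))
        \<le> norm (blinfun_apply S e) * norm (blinfun_apply T e)"
      by (rule cmod_cinner_le)
    also have "\<dots> \<le> (norm (blinfun_apply S e))\<^sup>2 + (norm (blinfun_apply T e))\<^sup>2"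
      using sum_squares_bound [of "norm (blinfun_apply S e)" "norm (blinfun_apply T e)"]
        mult_nonneg_nonneg [OF norm_ge_zero [of "blinfun_apply S e"] norm_ge_zero [of "blinfun_apply T e"]]
      by linarith
    finally show "cmod (cinner (blinfun_apply S e) (blinfun_apply T e))
      \<le> (norm (blinfun_apply S e))\<^sup>2 + (norm (blinfun_apply T e))\<^sup>2" .
  qed
  then show ?thesis
    unfolding hsi_def by (rule has_sum_infsum [OF abs_summable_summable])
qed

lemma hilbert_schmidt_compose_left:
  assumes "clinear W" "hilbert_schmidt T"
  shows "hilbert_schmidt (W o\<^sub>L T)" and "hs_norm (W o\<^sub>L T) \<le> norm W * hs_norm T"
proof -
  have le: "(norm (blinfun_apply W (blinfun_apply T e)))\<^sup>2 \<le> (norm W)\<^sup>2 * (norm (blinfun_apply T e))\<^sup>2" for e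
    unfolding power_mult_distrib [symmetric] by (intro power_mono norm_blinfun) simp
  have s: "(\<lambda>e. (norm W)\<^sup>2 * (norm (blinfun_apply T e))\<^sup>2) summable_on some_onb"
    using assms by (intro summable_on_cmult_right hilbert_schmidt_summable)
  then have s': "(\<lambda>e. (norm (blinfun_apply W (blinfun_apply T e)))\<^sup>2) summable_on some_onb"
    by (rule summable_on_comparison_test) (use le in auto)
  then show "hilbert_schmidt (W o\<^sub>L T)"
    using assms by (simp add: hilbert_schmidt_def)
  have "(hs_norm (W o\<^sub>L T))\<^sup>2 \<le> (norm W)\<^sup>2 * (hs_norm T)\<^sup>2"
    unfolding hs_norm_power2 infsum_cmult_right' [symmetric]
    by (rule infsum_mono) (use s s' le in auto)
  then show "hs_norm (W o\<^sub>L T) \<le> norm W * hs_norm T"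
    unfolding power_mult_distrib [symmetric] by (rule power2_le_imp_le) simp
qed

lemma hilbert_schmidt_scaleC: "hilbert_schmidt T \<Longrightarrow> hilbert_schmidt (scaleC_op c T)"
proof -
  assume T: "hilbert_schmidt T"
  have "scaleC_op c T = scaleC_op c id_blinfun o\<^sub>L T"
    by (rule blinfun_eqI) simp
  then show ?thesis
    using hilbert_schmidt_compose_left (1) [OF _ T] by simp
qed

lemma hilbert_schmidt_0 [simp]: "hilbert_schmidt 0"
  by (simp add: hilbert_schmidt_def)

lemma hilbert_schmidt_add:
  assumes "hilbert_schmidt S" "hilbert_schmidt T"
  shows "hilbert_schmidt (S + T)"
proof -
  have "(\<lambda>e. 2 * (norm (blinfun_apply S e))\<^sup>2 + 2 * (norm (blinfun_apply T e))\<^sup>2) summable_on some_onb"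
    using assms by (intro summable_on_add summable_on_cmult_right hilbert_schmidt_summable)
  then have "(\<lambda>e. (norm (blinfun_apply S e + blinfun_apply T e))\<^sup>2) summable_on some_onb"
  proof (rule summable_on_comparison_test)
    fix e :: 'a
    have "(norm (blinfun_apply S e + blinfun_apply T e))\<^sup>2
        \<le> (norm (blinfun_apply S e) + norm (blinfun_apply T e))\<^sup>2"
      by (intro power_mono norm_triangle_ineq) simp
    also have "\<dots> \<le> 2 * (norm (blinfun_apply S e))\<^sup>2 + 2 * (norm (blinfun_apply T e))\<^sup>2"
      using sum_squares_bound [of "norm (blinfun_apply S e)" "norm (blinfun_apply T e)"]
      by (simp add: power2_sum)
    finally show "(norm (blinfun_apply S e + blinfun_apply T e))\<^sup>2
        \<le> 2 * (norm (blinfun_apply S e))\<^sup>2 + 2 * (norm (blinfun_apply T e))\<^sup>2" .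
  qed auto
  then show ?thesis
    using assms by (simp add: hilbert_schmidt_def blinfun.add_left)
qed

lemma hilbert_schmidt_uminus: "hilbert_schmidt T \<Longrightarrow> hilbert_schmidt (- T)"
  by (simp add: hilbert_schmidt_def blinfun.minus_left)

lemma hilbert_schmidt_diff: "hilbert_schmidt S \<Longrightarrow> hilbert_schmidt T \<Longrightarrow> hilbert_schmidt (S - T)"
  using hilbert_schmidt_add [of S "- T"] by (simp add: hilbert_schmidt_uminus)

lemma hilbert_schmidt_sum: "(\<And>i. i \<in> I \<Longrightarrow> hilbert_schmidt (f i)) \<Longrightarrow> hilbert_schmidt (sum f I)"
  by (induction I rule: infinite_finite_induct) (auto intro: hilbert_schmidt_add)

lemma hsi_self: "hilbert_schmidt T \<Longrightarrow> hsi T T = of_real ((hs_norm T)\<^sup>2)"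
  unfolding hs_norm_power2 hsi_def cinner_self
  by (rule infsumI [OF has_sum_of_real [OF has_sum_infsum [OF hilbert_schmidt_summable]]])

lemma hsi_add_left:
  assumes "hilbert_schmidt S" "hilbert_schmidt S'" "hilbert_schmidt T"
  shows "hsi (S + S') T = hsi S T + hsi S' T"
  using has_sum_add [OF hsi_has_sum [OF assms(1,3)] hsi_has_sum [OF assms(2,3)]]
    hsi_has_sum [OF hilbert_schmidt_add [OF assms(1,2)] assms(3)]
  by (simp add: blinfun.add_left cinner.add_left has_sum_unique)

lemma hsi_scaleC_left: "hsi (scaleC_op c S) T = c * hsi S T"
  unfolding hsi_def by (simp add: cinner_scaleC_left infsum_cmult_right')

lemma hsi_commute: "hsi S T = cnj (hsi T S)"
  unfolding hsi_def infsum_cnj [symmetric] by (intro infsum_cong) (rule cinner_commute)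

lemma hsi_add_right:
  assumes "hilbert_schmidt S" "hilbert_schmidt S'" "hilbert_schmidt T"
  shows "hsi T (S + S') = hsi T S + hsi T S'"
  by (subst (1 2 3) hsi_commute) (simp add: hsi_add_left assms)

lemma hsi_scaleC_right: "hsi S (scaleC_op c T) = cnj c * hsi S T"
  by (subst (1 2) hsi_commute) (simp add: hsi_scaleC_left)

lemma hsi_sum_left:
  assumes "\<And>i. i \<in> I \<Longrightarrow> hilbert_schmidt (f i)" "hilbert_schmidt T"
  shows "hsi (sum f I) T = (\<Sum>i\<in>I. hsi (f i) T)"
  using assms
  by (induction I rule: infinite_finite_induct) (auto simp: hsi_add_left hilbert_schmidt_sum, simp_all add: hsi_def cinner.zero_left)

lemma hsi_sum_right:
  assumes "\<And>i. i \<in> I \<Longrightarrow> hilbert_schmidt (f i)" "hilbert_schmidt T"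
  shows "hsi T (sum f I) = (\<Sum>i\<in>I. hsi T (f i))"
  by (subst (1 2) hsi_commute) (simp add: hsi_sum_left assms)

lemma scaleC_op_minus1: "scaleC_op (- 1) T = - T"
  by (rule blinfun_eqI) (simp add: scaleC.minus_left blinfun.minus_left)

lemma hsi_diff_left:
  assumes "hilbert_schmidt S" "hilbert_schmidt S'" "hilbert_schmidt T"
  shows "hsi (S - S') T = hsi S T - hsi S' T"
  using hsi_add_left [OF assms(1) hilbert_schmidt_uminus [OF assms(2)] assms(3)]
    hsi_scaleC_left [of "- 1" S' T] by (simp add: scaleC_op_minus1)

lemma hsi_diff_right:
  assumes "hilbert_schmidt S" "hilbert_schmidt S'" "hilbert_schmidt T"
  shows "hsi T (S - S') = hsi T S - hsi T S'"
  by (subst (1 2 3) hsi_commute) (simp add: hsi_diff_left assms)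

lemma hs_norm_scaleC: "hs_norm (scaleC_op c T) = cmod c * hs_norm T"
proof -
  have "(hs_norm (scaleC_op c T))\<^sup>2 = (cmod c * hs_norm T)\<^sup>2"
    unfolding power_mult_distrib hs_norm_power2 infsum_cmult_right' [symmetric]
    by (simp add: norm_scaleC power_mult_distrib)
  then show ?thesis
    by (simp add: power2_eq_iff_nonneg)
qed

lemma hsi_cauchy_schwarz:
  assumes S: "hilbert_schmidt S" and T: "hilbert_schmidt T"
  shows "cmod (hsi S T) \<le> hs_norm S * hs_norm T"
proof -
  have "norm (\<Sum>e\<in>F. cinner (blinfun_apply S e) (blinfun_apply T e)) \<le> hs_norm S * hs_norm T"
    if F: "finite F" "F \<subseteq> some_onb" for F
  proof -
    have "norm (\<Sum>e\<in>F. cinner (blinfun_apply S e) (blinfun_apply T e))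
        \<le> (\<Sum>e\<in>F. norm (blinfun_apply S e) * norm (blinfun_apply T e))"
      by (rule sum_norm_le) (rule cmod_cinner_le)
    also have "\<dots> \<le> L2_set (\<lambda>e. norm (blinfun_apply S e)) F * L2_set (\<lambda>e. norm (blinfun_apply T e)) F"
      using L2_set_mult_ineq [of "\<lambda>e. norm (blinfun_apply S e)" "\<lambda>e. norm (blinfun_apply T e)" F] by simp
    also have "\<dots> \<le> hs_norm S * hs_norm T"
      unfolding L2_set_def hs_norm_def using F
      by (intro mult_mono real_sqrt_le_mono finite_sum_le_infsum hilbert_schmidt_summable S T)
        (auto simp: sum_nonneg infsum_nonneg)
    finally show ?thesis .
  qed
  then have "eventually (\<lambda>F. norm (\<Sum>e\<in>F. cinner (blinfun_apply S e) (blinfun_apply T e))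
      \<le> hs_norm S * hs_norm T) (finite_subsets_at_top some_onb)"
    by (rule eventually_finite_subsets_at_top_weakI)
  then show ?thesis
    by (rule tendsto_upperbound [OF tendsto_norm [OF hsi_has_sum [OF S T, unfolded has_sum_def]]]) simp
qed

lemma hs_norm_add_sq:
  assumes S: "hilbert_schmidt S" and T: "hilbert_schmidt T"
  shows "(hs_norm (S + T))\<^sup>2 = (hs_norm S)\<^sup>2 + (hs_norm T)\<^sup>2 + 2 * Re (hsi S T)"
proof -
  have "hsi (S + T) (S + T) = hsi S S + hsi T T + (hsi S T + cnj (hsi S T))"
    using S T by (simp add: hsi_add_left hsi_add_right hilbert_schmidt_add hsi_commute [of T S])
  then have "Re (hsi (S + T) (S + T)) = Re (hsi S S) + Re (hsi T T) + 2 * Re (hsi S T)"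
    by simp
  then show ?thesis
    using S T by (simp only: hsi_self hilbert_schmidt_add Re_complex_of_real)
qed

lemma hs_norm_triangle:
  assumes S: "hilbert_schmidt S" and T: "hilbert_schmidt T"
  shows "hs_norm (S + T) \<le> hs_norm S + hs_norm T"
proof (rule power2_le_imp_le)
  have "Re (hsi S T) \<le> hs_norm S * hs_norm T"
    using hsi_cauchy_schwarz [OF S T] complex_Re_le_cmod order_trans by blast
  then show "(hs_norm (S + T))\<^sup>2 \<le> (hs_norm S + hs_norm T)\<^sup>2"
    using hs_norm_add_sq [OF S T] by (simp add: power2_sum)
qed simp

lemma hs_norm_uminus [simp]: "hs_norm (- T) = hs_norm T"
  by (simp add: hs_norm_def blinfun.minus_left)

lemma hs_norm_0 [simp]: "hs_norm 0 = 0"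
  by (simp add: hs_norm_def)

lemma hs_norm_diff_le:
  "hilbert_schmidt S \<Longrightarrow> hilbert_schmidt T \<Longrightarrow> hs_norm (S - T) \<le> hs_norm S + hs_norm T"
  using hs_norm_triangle [of S "- T"] by (simp add: hilbert_schmidt_uminus)

lemma hs_norm_sum_le:
  "(\<And>i. i \<in> I \<Longrightarrow> hilbert_schmidt (f i)) \<Longrightarrow> hs_norm (sum f I) \<le> (\<Sum>i\<in>I. hs_norm (f i))"
proof (induction I rule: infinite_finite_induct)
  case (insert i I)
  then show ?case
    using hs_norm_triangle [of "f i" "sum f I"] hilbert_schmidt_sum [of I f] by auto
qed auto

text \<open>Both norms are the double sum of the squared moduli of the matrix entries, summed over
  rows or over columns; nonnegativity permits the exchange.\<close>

lemma
  assumes T: "hilbert_schmidt T"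
  shows hilbert_schmidt_adj: "hilbert_schmidt (adj T)" and hs_norm_adj: "hs_norm (adj T) = hs_norm T"
proof -
  let ?B = "some_onb :: 'a set"
  define g where "g = (\<lambda>e f. (cmod (cinner (blinfun_apply T e) f))\<^sup>2)"
  have 1: "((\<lambda>f. g e f) has_sum (norm (blinfun_apply T e))\<^sup>2) ?B" for e
    unfolding g_def by (rule parseval [OF is_onb_some_onb])
  have "g e f = (cmod (cinner (blinfun_apply (adj T) f) e))\<^sup>2" for e f
    unfolding g_def using T by (subst cinner_commute) (simp add: cinner_adj_left)
  then have 2: "((\<lambda>e. g e f) has_sum (norm (blinfun_apply (adj T) f))\<^sup>2) ?B" for f
    using parseval [OF is_onb_some_onb] by simp
  have s: "(\<lambda>(e, f). g e f) summable_on ?B \<times> ?B"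
    by (rule summable_on_SigmaI [OF _ hilbert_schmidt_summable [OF T]]) (use 1 in \<open>auto simp: g_def\<close>)
  then have s': "(\<lambda>(f, e). g e f) summable_on ?B \<times> ?B"
    by (subst summable_on_swap) (simp add: case_prod_unfold)
  have "(\<lambda>f. infsum (\<lambda>e. g e f) ?B) summable_on ?B"
    using summable_on_Sigma_banach [OF s'] by simp
  moreover have "infsum (\<lambda>e. g e f) ?B = (norm (blinfun_apply (adj T) f))\<^sup>2" for f
    using 2 by (rule infsumI)
  ultimately show *: "hilbert_schmidt (adj T)"
    using T by (simp add: hilbert_schmidt_def)
  have "infsum (\<lambda>e. infsum (g e) ?B) ?B = infsum (\<lambda>f. infsum (\<lambda>e. g e f) ?B) ?B"
    using infsum_swap_banach [OF s] .
  then have "(hs_norm T)\<^sup>2 = (hs_norm (adj T))\<^sup>2"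
    unfolding hs_norm_power2 infsumI [OF 1] infsumI [OF 2] .
  then show "hs_norm (adj T) = hs_norm T"
    by (simp add: power2_eq_iff_nonneg)
qed

text \<open>Polarization: the real part of \<open>hsi\<close> is determined by norms, which adjoints
  preserve, and replacing \<open>S\<close> by \<open>\<i> S\<close> reaches the imaginary part.
  Cyclicity of the trace and invariance under right multiplication both rest on this
  identity.\<close>

lemma hsi_adj:
  assumes S: "hilbert_schmidt S" and T: "hilbert_schmidt T"
  shows "hsi (adj T) (adj S) = hsi S T"
proof -
  have Re: "Re (hsi (adj T) (adj S)) = Re (hsi S T)" if S: "hilbert_schmidt S" for S
  proof -
    have "hs_norm (adj T + adj S) = hs_norm (S + T)"
      using hs_norm_adj [OF hilbert_schmidt_add [OF S T]] S T by (simp add: adj_add add.commute)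
    then show ?thesis
      using hs_norm_add_sq [OF S T] hs_norm_add_sq [of "adj T" "adj S"] S T
      by (simp add: hilbert_schmidt_adj hs_norm_adj)
  qed
  have "Im (hsi (adj T) (adj S)) = Im (hsi S T)"
    using Re [of "scaleC_op \<i> S"] S T
    by (simp add: hilbert_schmidt_scaleC adj_scaleC_op hsi_scaleC_left hsi_scaleC_right)
  with Re [OF S] show ?thesis
    by (simp add: complex_eq_iff)
qed

text \<open>The defining sum over the basis only sees multiplication from the left; the right factor
  is brought there by taking adjoints.\<close>

lemma hilbert_schmidt_compose_right:
  assumes W: "clinear W" and T: "hilbert_schmidt T"
  shows "hilbert_schmidt (T o\<^sub>L W)" and "hs_norm (T o\<^sub>L W) \<le> norm W * hs_norm T"
proof -
  have eq: "T o\<^sub>L W = adj (adj W o\<^sub>L adj T)"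
    using W T by (simp add: adj_compose)
  have *: "hilbert_schmidt (adj W o\<^sub>L adj T)"
    using W T by (intro hilbert_schmidt_compose_left hilbert_schmidt_adj) auto
  show "hilbert_schmidt (T o\<^sub>L W)"
    unfolding eq by (rule hilbert_schmidt_adj [OF *])
  show "hs_norm (T o\<^sub>L W) \<le> norm W * hs_norm T"
    unfolding eq hs_norm_adj [OF *]
    using hilbert_schmidt_compose_left(2) [of "adj W" "adj T"] W T
    by (simp add: hilbert_schmidt_adj hs_norm_adj)
qed

lemma hsi_isometry_left:
  assumes "clinear U" "adj U o\<^sub>L U = id_blinfun"
  shows "hsi (U o\<^sub>L S) (U o\<^sub>L T) = hsi S T"
proof -
  have "cinner (blinfun_apply U x) (blinfun_apply U y) = cinner x y" for x y
    using cinner_adj_right [OF assms(1), of x "blinfun_apply U y"] assms(2)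
    by (metis blinfun_apply_blinfun_compose blinfun_apply_id_blinfun id_apply)
  then show ?thesis
    by (simp add: hsi_def)
qed

lemma hsi_coisometry_right:
  assumes V: "clinear V" "V o\<^sub>L adj V = id_blinfun" and S: "hilbert_schmidt S" and T: "hilbert_schmidt T"
  shows "hsi (S o\<^sub>L V) (T o\<^sub>L V) = hsi S T"
proof -
  have "hsi (S o\<^sub>L V) (T o\<^sub>L V) = hsi (adj (T o\<^sub>L V)) (adj (S o\<^sub>L V))"
    using S T V by (intro hsi_adj [symmetric] hilbert_schmidt_compose_right)
  also have "\<dots> = hsi (adj T) (adj S)"
    using V S T by (simp add: adj_compose hsi_isometry_left)
  finally show ?thesis
    by (simp add: hsi_adj S T)
qed

lemma trace_op_compose: "clinear S \<Longrightarrow> trace_op (S o\<^sub>L T) = hsi T (adj S)"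
  by (simp add: trace_op_def hsi_def cinner_adj_right)

text \<open>With the trace of a product written as \<open>hsi\<close> against an adjoint, exchanging
  the factors is exactly invariance of \<open>hsi\<close> under adjoints.\<close>

lemma trace_op_commute:
  assumes S: "hilbert_schmidt S" and T: "hilbert_schmidt T"
  shows "trace_op (S o\<^sub>L T) = trace_op (T o\<^sub>L S)"
  using hsi_adj [of S "adj T"] S T by (simp add: trace_op_compose hilbert_schmidt_adj)

section \<open>Positive operators and the trace class\<close>

lemma positive_op_clinear [simp]: "positive_op P \<Longrightarrow> clinear P"
  by (simp add: positive_op_def)

lemma positive_op_inner_nonneg: "positive_op P \<Longrightarrow> 0 \<le> inner (blinfun_apply P x) x"
  by (simp add: positive_op_def inner_eq_Re_cinner)

text \<open>Polarization again: reality of the quadratic form at \<open>x + y\<close> and at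
  \<open>x + \<i> y\<close> forces the two mixed terms to be conjugate to each other.\<close>

lemma positive_op_symmetric:
  assumes P: "positive_op P"
  shows "cinner (blinfun_apply P x) y = cinner x (blinfun_apply P y)"
proof -
  let ?q = "\<lambda>x. cinner (blinfun_apply P x) x"
  have real: "cnj (?q z) = ?q z" for z
    using P by (simp add: positive_op_def complex_eq_iff)
  have lin: "blinfun_apply P (\<i> *\<^sub>C z) = \<i> *\<^sub>C blinfun_apply P z" for z
    using P by (simp add: positive_op_def clinear_def)
  define a where "a = cinner (blinfun_apply P x) y"
  define b where "b = cinner (blinfun_apply P y) x"
  have "?q (x + y) = ?q x + ?q y + (a + b)"
    by (simp add: a_def b_def blinfun.add_right cinner.add_left cinner.add_right)
  then have 1: "cnj (a + b) = a + b"
    using real [of "x + y"] real [of x] real [of y] by (metis add_left_cancel complex_cnj_add)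
  have "?q (x + \<i> *\<^sub>C y) = ?q x + ?q y + (\<i> * b - \<i> * a)"
    by (simp add: a_def b_def blinfun.add_right cinner.add_left cinner.add_right lin
        cinner_scaleC_left cinner_scaleC_right algebra_simps)
  then have 2: "cnj (\<i> * b - \<i> * a) = \<i> * b - \<i> * a"
    using real [of "x + \<i> *\<^sub>C y"] real [of x] real [of y] by (metis add_left_cancel complex_cnj_add)
  have "a = cnj b"
    using 1 2 by (auto simp: complex_eq_iff)
  then show ?thesis
    unfolding a_def b_def by (subst (asm) (2) cinner_commute) simp
qed

lemma positive_op_inner_symmetric:
  "positive_op P \<Longrightarrow> inner (blinfun_apply P x) y = inner x (blinfun_apply P y)"
  unfolding inner_eq_Re_cinner by (simp only: positive_op_symmetric)

lemma positive_opI: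
  assumes "clinear P" "\<And>x y. cinner (blinfun_apply P x) y = cinner x (blinfun_apply P y)"
    and "\<And>x. 0 \<le> inner (blinfun_apply P x) x"
  shows "positive_op P"
proof -
  have "Im (cinner (blinfun_apply P x) x) = 0" for x
    using assms(2) [of x x] cinner_commute [of x "blinfun_apply P x"] by (simp add: complex_eq_iff)
  then show ?thesis
    using assms by (simp add: positive_op_def inner_eq_Re_cinner)
qed

text \<open>The form is nonnegative on \<open>x + t y\<close> for every real \<open>t\<close>.
  Evaluating at the minimizer \<open>- c / b\<close> gives the inequality; if \<open>b = 0\<close>
  and \<open>c\<close> were nonzero, the chosen \<open>t\<close> would give the value
  \<open>-1\<close>.\<close>

lemma positive_op_cauchy_schwarz:
  assumes P: "positive_op P"
  shows "(inner (blinfun_apply P x) y)\<^sup>2 \<le> inner (blinfun_apply P x) x * inner (blinfun_apply P y) y"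
proof -
  define a b c where "a = inner (blinfun_apply P x) x" and "b = inner (blinfun_apply P y) y"
    and "c = inner (blinfun_apply P x) y"
  have c': "inner (blinfun_apply P y) x = c"
    using positive_op_inner_symmetric [OF P, of y x] by (simp add: c_def inner_commute)
  have ab: "0 \<le> a" "0 \<le> b"
    using P by (simp_all add: a_def b_def positive_op_inner_nonneg)
  have *: "0 \<le> a + 2 * t * c + t\<^sup>2 * b" for t
    using positive_op_inner_nonneg [OF P, of "x + t *\<^sub>R y"] c'
    by (simp add: a_def b_def c_def blinfun.add_right blinfun.scaleR_right inner_add_left
        inner_add_right power2_eq_square algebra_simps)
  show ?thesis
  proof (cases "b = 0")
    case True
    have "c = 0"
    proof (rule ccontr)
      assume "c \<noteq> 0"
      then show False
        using * [of "- (a + 1) / (2 * c)"] True ab by (simp add: field_simps)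
    qed
    then show ?thesis
      using ab by (simp flip: a_def b_def c_def)
  next
    case False
    then have "b > 0" using ab by simp
    then have "c\<^sup>2 \<le> a * b"
      using * [of "- c / b"] by (simp add: field_simps power2_eq_square)
    then show ?thesis
      by (simp add: a_def b_def c_def)
  qed
qed

lemma positive_op_apply_eq_0:
  assumes P: "positive_op P" and x: "inner (blinfun_apply P x) x = 0"
  shows "blinfun_apply P x = 0"
  using positive_op_cauchy_schwarz [OF P, of x "blinfun_apply P x"] x by simp

text \<open>Cauchy-Schwarz for the form of \<open>P\<close>, applied to \<open>x\<close> and
  \<open>P x\<close>, upgrades a bound on the quadratic form to one on the operator norm without
  spectral theory.\<close>

lemma positive_op_norm_le:
  assumes P: "positive_op P" and c: "\<And>x. inner (blinfun_apply P x) x \<le> c * (norm x)\<^sup>2" "c \<ge> 0"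
  shows "norm P \<le> c"
proof (rule norm_blinfun_bound [OF c(2)])
  fix x
  let ?y = "blinfun_apply P x"
  show "norm ?y \<le> c * norm x"
  proof (cases "norm ?y = 0")
    case False
    have "(inner ?y ?y)\<^sup>2 \<le> inner ?y x * inner (blinfun_apply P ?y) ?y"
      by (rule positive_op_cauchy_schwarz [OF P])
    also have "\<dots> \<le> (c * (norm x)\<^sup>2) * (c * (norm ?y)\<^sup>2)"
      by (intro mult_mono c mult_nonneg_nonneg positive_op_inner_nonneg [OF P]) auto
    finally have "(norm ?y)\<^sup>2 * (norm ?y)\<^sup>2 \<le> (norm ?y)\<^sup>2 * (c * norm x)\<^sup>2"
      by (simp add: power2_norm_eq_inner [symmetric] power2_eq_square mult_ac)
    then have "(norm ?y)\<^sup>2 \<le> (c * norm x)\<^sup>2"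
      by (rule mult_left_le_imp_le) (use False in simp)
    then show ?thesis
      by (rule power2_le_imp_le) (simp add: c(2))
  qed (use c in auto)
qed

text \<open>
  The square root of \<open>1 - X\<close>, for a contraction \<open>X\<close>, is \<open>1 - Y\<close> for the fixed point of
  \<open>Y \<mapsto> (X + Y\<^sup>2) / 2\<close>. The iterates starting at \<open>0\<close> are polynomials in \<open>X\<close> with nonnegative
  coefficients, so their increments are majorized by those of the scalar iteration at \<open>X = 1\<close>.
\<close>

fun sqrt_iter :: "('a::real_normed_vector \<Rightarrow>\<^sub>L 'a) \<Rightarrow> nat \<Rightarrow> 'a \<Rightarrow>\<^sub>L 'a" where
  "sqrt_iter X 0 = 0"
| "sqrt_iter X (Suc n) = (1/2) *\<^sub>R (X + (sqrt_iter X n o\<^sub>L sqrt_iter X n))"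

fun sqrt_iter_real :: "nat \<Rightarrow> real" where
  "sqrt_iter_real 0 = 0"
| "sqrt_iter_real (Suc n) = (1 + sqrt_iter_real n * sqrt_iter_real n) / 2"

lemma blinfun_compose_simps:
  "(S + S') o\<^sub>L T = (S o\<^sub>L T) + (S' o\<^sub>L T)" "S o\<^sub>L (T + T') = (S o\<^sub>L T) + (S o\<^sub>L T')"
  "(S - S') o\<^sub>L T = (S o\<^sub>L T) - (S' o\<^sub>L T)" "S o\<^sub>L (T - T') = (S o\<^sub>L T) - (S o\<^sub>L T')"
  "(r *\<^sub>R S) o\<^sub>L T = r *\<^sub>R (S o\<^sub>L T)" "S o\<^sub>L (r *\<^sub>R T) = r *\<^sub>R (S o\<^sub>L T)"
  "(- S) o\<^sub>L T = - (S o\<^sub>L T)" "S o\<^sub>L (- T) = - (S o\<^sub>L T)"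
  "id_blinfun o\<^sub>L T = T" "S o\<^sub>L id_blinfun = S" "0 o\<^sub>L T = 0" "S o\<^sub>L 0 = 0"
  by (auto intro!: blinfun_eqI simp: blinfun.bilinear_simps)

lemma blinfun_compose_assoc: "(R o\<^sub>L S) o\<^sub>L T = R o\<^sub>L (S o\<^sub>L T)"
  by (rule blinfun_eqI) simp

text \<open>Each iterate is a polynomial in \<open>X\<close>. With \<open>Q\<close> an iterate
  itself this makes all iterates commute; with general \<open>Q\<close> it yields the commutation
  clause for the square root.\<close>

lemma sqrt_iter_commute:
  assumes "Q o\<^sub>L X = X o\<^sub>L Q"
  shows "Q o\<^sub>L sqrt_iter X n = sqrt_iter X n o\<^sub>L Q"
  by (induction n) (simp_all add: blinfun_compose_simps assms, metis blinfun_compose_assoc)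

lemma sqrt_iter_real_mono: "0 \<le> sqrt_iter_real n \<and> sqrt_iter_real n \<le> sqrt_iter_real (Suc n) \<and> sqrt_iter_real n \<le> 1"
proof (induction n)
  case (Suc n)
  then have "sqrt_iter_real n * sqrt_iter_real n \<le> sqrt_iter_real (Suc n) * sqrt_iter_real (Suc n)"
    by (intro mult_mono) auto
  moreover have "sqrt_iter_real n * sqrt_iter_real n \<le> 1"
    using Suc by (simp add: mult_le_one)
  ultimately show ?case
    using Suc by simp
qed simp

lemma norm_sqrt_iter:
  assumes X: "norm X \<le> 1"
  shows "norm (sqrt_iter X n) \<le> sqrt_iter_real n \<and>
    norm (sqrt_iter X (Suc n) - sqrt_iter X n) \<le> sqrt_iter_real (Suc n) - sqrt_iter_real n"
proof (induction n)
  case 0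
  then show ?case using X by (simp)
next
  case (Suc n)
  let ?Y = "sqrt_iter X" and ?y = sqrt_iter_real
  have "norm (?Y (Suc n)) \<le> norm (?Y n) + norm (?Y (Suc n) - ?Y n)"
    by (metis add.commute diff_add_cancel norm_triangle_ineq)
  then have 1: "norm (?Y (Suc n)) \<le> ?y (Suc n)"
    using Suc by linarith
  \<comment> \<open>Commutation lets the difference of two squares factor as difference times sum,
    which matches the scalar recursion term by term.\<close>
  have comm: "?Y n o\<^sub>L ?Y (Suc n) = ?Y (Suc n) o\<^sub>L ?Y n"
    by (rule sqrt_iter_commute) (rule sqrt_iter_commute [symmetric], rule refl)
  have "?Y (Suc (Suc n)) - ?Y (Suc n) = (1/2) *\<^sub>R ((?Y (Suc n) o\<^sub>L ?Y (Suc n)) - (?Y n o\<^sub>L ?Y n))"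
    by (subst (1 2) sqrt_iter.simps(2)) (simp only: scaleR_diff_right [symmetric] add_diff_cancel_left)
  also have "(?Y (Suc n) o\<^sub>L ?Y (Suc n)) - (?Y n o\<^sub>L ?Y n) = (?Y (Suc n) - ?Y n) o\<^sub>L (?Y (Suc n) + ?Y n)"
    unfolding blinfun_compose_simps(1-4) comm by simp
  finally have "norm (?Y (Suc (Suc n)) - ?Y (Suc n))
      = norm ((?Y (Suc n) - ?Y n) o\<^sub>L (?Y (Suc n) + ?Y n)) / 2"
    by simp
  also have "\<dots> \<le> norm (?Y (Suc n) - ?Y n) * norm (?Y (Suc n) + ?Y n) / 2"
    by (intro divide_right_mono norm_blinfun_compose) simp
  also have "\<dots> \<le> (?y (Suc n) - ?y n) * (?y (Suc n) + ?y n) / 2"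
    using Suc 1 norm_triangle_ineq [of "?Y (Suc n)" "?Y n"] sqrt_iter_real_mono [of n]
    by (intro divide_right_mono mult_mono) (auto simp del: sqrt_iter.simps sqrt_iter_real.simps)
  also have "\<dots> = ?y (Suc (Suc n)) - ?y (Suc n)"
  proof -
    define a b where "a = ?y n" and "b = ?y (Suc n)"
    have "b = (1 + a * a) / 2" "?y (Suc (Suc n)) = (1 + b * b) / 2"
      unfolding a_def b_def by (rule sqrt_iter_real.simps(2))+
    moreover have "(b - a) * (b + a) / 2 = (1 + b * b) / 2 - (1 + a * a) / 2"
      by (simp add: field_simps)
    ultimately show ?thesis
      unfolding a_def [symmetric] b_def [symmetric] by linarith
  qed
  finally show ?case
    using 1 by blast
qed

text \<open>The scalar iterates increase and are bounded by one, so their increments are summable,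
  and these dominate the norms of the operator increments.\<close>

lemma sqrt_iter_converges:
  assumes X: "norm (X :: 'a::{real_normed_vector,banach} \<Rightarrow>\<^sub>L 'a) \<le> 1"
  shows "\<exists>Y. sqrt_iter X \<longlonglongrightarrow> Y \<and> norm Y \<le> 1 \<and> Y = (1/2) *\<^sub>R (X + (Y o\<^sub>L Y))"
proof -
  have inc: "incseq sqrt_iter_real"
    using sqrt_iter_real_mono by (intro incseq_SucI) auto
  then obtain l where l: "sqrt_iter_real \<longlonglongrightarrow> l"
    by (rule incseq_convergent [of _ 1]) (use sqrt_iter_real_mono in auto)
  have "summable (\<lambda>n. sqrt_iter_real (Suc n) - sqrt_iter_real n)"
    using telescope_summable [OF l] .
  then have "summable (\<lambda>n. sqrt_iter X (Suc n) - sqrt_iter X n)"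
    by (rule summable_comparison_test' [where N = 0]) (use norm_sqrt_iter [OF X] in blast)
  then obtain Y where "(\<lambda>n. \<Sum>i<n. sqrt_iter X (Suc i) - sqrt_iter X i) \<longlonglongrightarrow> Y"
    using summable_LIMSEQ by blast
  then have Y: "sqrt_iter X \<longlonglongrightarrow> Y"
    unfolding sum_lessThan_telescope by simp
  have "norm (sqrt_iter X n) \<le> 1" for n
    using norm_sqrt_iter [OF X, of n] sqrt_iter_real_mono [of n] by linarith
  then have "norm Y \<le> 1"
    by (intro tendsto_upperbound [OF tendsto_norm [OF Y]]) auto
  moreover have "(\<lambda>n. (1/2) *\<^sub>R (X + (sqrt_iter X n o\<^sub>L sqrt_iter X n))) \<longlonglongrightarrow> (1/2) *\<^sub>R (X + (Y o\<^sub>L Y))"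
    by (intro tendsto_intros Y bounded_bilinear.tendsto [OF bounded_bilinear_blinfun_compose])
  then have "(\<lambda>n. sqrt_iter X (Suc n)) \<longlonglongrightarrow> (1/2) *\<^sub>R (X + (Y o\<^sub>L Y))"
    by simp
  then have "Y = (1/2) *\<^sub>R (X + (Y o\<^sub>L Y))"
    using LIMSEQ_Suc [OF Y] LIMSEQ_unique by blast
  ultimately show ?thesis
    using Y by blast
qed

lemma blinfun_apply_tendsto: "(f \<longlongrightarrow> T) F \<Longrightarrow> ((\<lambda>n. blinfun_apply (f n) x) \<longlongrightarrow> blinfun_apply T x) F"
  by (rule bounded_linear.tendsto [OF bounded_linear_apply_blinfun])

lemma clinear_tendsto:
  assumes "\<And>n. clinear (f n)" "f \<longlonglongrightarrow> T"
  shows "clinear T"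
  unfolding clinear_def
proof (intro allI)
  fix c x
  have "(\<lambda>n. blinfun_apply (f n) (c *\<^sub>C x)) \<longlonglongrightarrow> c *\<^sub>C blinfun_apply T x"
    using bounded_linear.tendsto [OF bounded_linear_scaleC blinfun_apply_tendsto [OF assms(2)], of c x]
      assms(1) by (simp add: clinear_def)
  then show "blinfun_apply T (c *\<^sub>C x) = c *\<^sub>C blinfun_apply T x"
    using blinfun_apply_tendsto [OF assms(2)] LIMSEQ_unique by blast
qed

lemma cinner_symmetric_tendsto:
  assumes "\<And>n x y. cinner (blinfun_apply (f n) x) y = cinner x (blinfun_apply (f n) y)" "f \<longlonglongrightarrow> T"
  shows "cinner (blinfun_apply T x) y = cinner x (blinfun_apply T y)"
proof -
  have "(\<lambda>n. cinner (blinfun_apply (f n) x) y) \<longlonglongrightarrow> cinner (blinfun_apply T x) y"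
    "(\<lambda>n. cinner x (blinfun_apply (f n) y)) \<longlonglongrightarrow> cinner x (blinfun_apply T y)"
    by (intro cinner.tendsto blinfun_apply_tendsto assms tendsto_const)+
  then show ?thesis
    using assms(1) LIMSEQ_unique by simp
qed

text \<open>The commutation clause is part of the claim because uniqueness of the square root is
  available only among commuting candidates.\<close>

lemma positive_sqrt_exists:
  assumes S: "positive_op S"
  shows "\<exists>P. positive_op P \<and> P o\<^sub>L P = S \<and> (\<forall>Q. Q o\<^sub>L S = S o\<^sub>L Q \<longrightarrow> Q o\<^sub>L P = P o\<^sub>L Q)"
proof -
  \<comment> \<open>The summand one keeps \<open>c\<close> positive when \<open>S = 0\<close>; with
    this scaling both \<open>X\<close> and \<open>1 - X\<close> are positive, so \<open>X\<close> is
    a contraction.\<close>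
  define c where "c = norm S + 1"
  have c: "c > 0" by (simp add: c_def add_nonneg_pos)
  define X where "X = id_blinfun - (1 / c) *\<^sub>R S"
  have Xap: "blinfun_apply X x = x - (1 / c) *\<^sub>R blinfun_apply S x" for x
    by (simp add: X_def blinfun.bilinear_simps)
  have Sle: "inner (blinfun_apply S x) x \<le> c * (norm x)\<^sup>2" for x
  proof -
    have "inner (blinfun_apply S x) x \<le> norm (blinfun_apply S x) * norm x"
      by (rule norm_cauchy_schwarz)
    also have "\<dots> \<le> (norm S * norm x) * norm x"
      by (intro mult_right_mono norm_blinfun) simp
    also have "\<dots> \<le> c * (norm x)\<^sup>2"
      by (simp add: c_def power2_eq_square algebra_simps)
    finally show ?thesis .
  qed
  have Xsym: "cinner (blinfun_apply X x) y = cinner x (blinfun_apply X y)" for x y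
    by (simp add: Xap cinner.diff_left cinner.diff_right cinner_scaleR_left cinner_scaleR_right
        positive_op_symmetric [OF S])
  have X: "positive_op X"
  proof (rule positive_opI [OF _ Xsym])
    show "clinear X" using S by (simp add: X_def)
    show "0 \<le> inner (blinfun_apply X x) x" for x
      using Sle [of x] c by (simp add: Xap inner_diff_left power2_norm_eq_inner field_simps)
  qed
  have "norm X \<le> 1"
  proof (rule positive_op_norm_le [OF X])
    show "inner (blinfun_apply X x) x \<le> 1 * (norm x)\<^sup>2" for x
      using positive_op_inner_nonneg [OF S, of x] c
      by (simp add: Xap inner_diff_left power2_norm_eq_inner field_simps)
  qed simp
  then obtain Y where Y: "sqrt_iter X \<longlonglongrightarrow> Y" "norm Y \<le> 1" "Y = (1/2) *\<^sub>R (X + (Y o\<^sub>L Y))"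
    using sqrt_iter_converges by blast
  \<comment> \<open>The fixed point equation for \<open>Y\<close> is the same as
    \<open>(1 - Y)^2 = 1 - X\<close>, and \<open>1 - X\<close> is \<open>S / c\<close>.\<close>
  define P where "P = sqrt c *\<^sub>R (id_blinfun - Y)"
  have clX: "clinear (sqrt_iter X n)" for n
    using X by (induction n) auto
  have symX: "cinner (blinfun_apply (sqrt_iter X n) x) y = cinner x (blinfun_apply (sqrt_iter X n) y)" for n x y
    by (induction n arbitrary: x y)
      (simp_all add: cinner.zero_left cinner.zero_right cinner.add_left cinner.add_right Xsym
        cinner_scaleR_left cinner_scaleR_right blinfun.bilinear_simps)
  note Ysym = cinner_symmetric_tendsto [OF symX Y(1)]
  have "positive_op P"
  proof (rule positive_opI)
    show "clinear P"
      using clinear_tendsto [OF clX Y(1)] by (simp add: P_def)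
    show "cinner (blinfun_apply P x) y = cinner x (blinfun_apply P y)" for x y
      by (simp add: P_def blinfun.bilinear_simps cinner.diff_left cinner.diff_right
          cinner_scaleR_left cinner_scaleR_right Ysym)
    show "0 \<le> inner (blinfun_apply P x) x" for x
    proof -
      have "inner (blinfun_apply Y x) x \<le> norm (blinfun_apply Y x) * norm x"
        by (rule norm_cauchy_schwarz)
      also have "\<dots> \<le> (norm Y * norm x) * norm x"
        by (intro mult_right_mono norm_blinfun) simp
      also have "\<dots> \<le> (1 * norm x) * norm x"
        by (intro mult_right_mono Y(2)) auto
      finally show ?thesis
        using c by (simp add: P_def blinfun.bilinear_simps inner_diff_left dot_square_norm power2_eq_square)
    qed
  qed
  moreover have "P o\<^sub>L P = S"
  proof -
    have "Y o\<^sub>L Y = 2 *\<^sub>R Y - X"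
      by (subst (3) Y(3)) simp
    then have YY: "Y - (Y o\<^sub>L Y) = X - Y"
      by (simp add: scaleR_2)
    have "P o\<^sub>L P = sqrt c *\<^sub>R (sqrt c *\<^sub>R (id_blinfun - Y - (Y - (Y o\<^sub>L Y))))"
      by (simp add: P_def blinfun_compose_simps scaleR_diff_right)
    also have "\<dots> = c *\<^sub>R (id_blinfun - Y - (Y - (Y o\<^sub>L Y)))"
      using c by (simp only: scaleR_scaleR real_sqrt_mult_self) simp
    also have "\<dots> = c *\<^sub>R (id_blinfun - X)"
      unfolding YY by simp
    also have "\<dots> = S"
      using c by (simp add: X_def)
    finally show ?thesis .
  qed
  moreover have "Q o\<^sub>L P = P o\<^sub>L Q" if "Q o\<^sub>L S = S o\<^sub>L Q" for Q
  proof -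
    have "Q o\<^sub>L X = X o\<^sub>L Q"
      by (simp add: X_def blinfun_compose_simps that)
    then have "(\<lambda>n. Q o\<^sub>L sqrt_iter X n) = (\<lambda>n. sqrt_iter X n o\<^sub>L Q)"
      using sqrt_iter_commute by blast
    moreover have "(\<lambda>n. Q o\<^sub>L sqrt_iter X n) \<longlonglongrightarrow> (Q o\<^sub>L Y)" "(\<lambda>n. sqrt_iter X n o\<^sub>L Q) \<longlonglongrightarrow> (Y o\<^sub>L Q)"
      by (intro bounded_bilinear.tendsto [OF bounded_bilinear_blinfun_compose] tendsto_const Y(1))+
    ultimately have "Q o\<^sub>L Y = Y o\<^sub>L Q"
      using LIMSEQ_unique by metis
    then show ?thesis
      by (simp add: P_def blinfun_compose_simps)
  qed
  ultimately show ?thesis by blast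
qed

text \<open>Since the squares agree and the roots commute, \<open>P + Q\<close> kills
  \<open>y = P x - Q x\<close>. By positivity each of \<open>P\<close> and \<open>Q\<close> kills
  \<open>y\<close>, and then \<open>y\<close> is orthogonal to itself.\<close>

lemma positive_sqrt_unique:
  assumes P: "positive_op P" and Q: "positive_op Q" and eq: "P o\<^sub>L P = Q o\<^sub>L Q" and comm: "Q o\<^sub>L P = P o\<^sub>L Q"
  shows "P = Q"
proof (rule blinfun_eqI)
  fix x
  define y where "y = blinfun_apply P x - blinfun_apply Q x"
  have *: "blinfun_apply P (blinfun_apply P v) = blinfun_apply Q (blinfun_apply Q v)"
    "blinfun_apply Q (blinfun_apply P v) = blinfun_apply P (blinfun_apply Q v)" for v
    using eq comm by (metis blinfun_apply_blinfun_compose)+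
  have "blinfun_apply P y + blinfun_apply Q y = 0"
    by (simp add: y_def blinfun.diff_right *)
  then have "inner (blinfun_apply P y) y + inner (blinfun_apply Q y) y = 0"
    by (metis inner_add_left inner_zero_left)
  then have "inner (blinfun_apply P y) y = 0" "inner (blinfun_apply Q y) y = 0"
    using positive_op_inner_nonneg [OF P, of y] positive_op_inner_nonneg [OF Q, of y] by linarith+
  then have "blinfun_apply P y = 0" "blinfun_apply Q y = 0"
    using positive_op_apply_eq_0 P Q by blast+
  moreover have "inner y y = inner (blinfun_apply P y) x - inner (blinfun_apply Q y) x"
    by (subst (2) y_def)
      (simp add: inner_diff_right positive_op_inner_symmetric [OF P] positive_op_inner_symmetric [OF Q])
  ultimately show "blinfun_apply P x = blinfun_apply Q x"
    by (simp add: y_def)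
qed

text \<open>Any root \<open>Q\<close> of \<open>adj T o\<^sub>L T\<close> commutes with its own
  square, hence with the constructed root \<open>P\<close>. So the description in
  \<open>abs_op\<close> has exactly one witness.\<close>

lemma abs_op_works:
  assumes T: "clinear T"
  shows "positive_op (abs_op T) \<and> abs_op T o\<^sub>L abs_op T = adj T o\<^sub>L T"
proof -
  have S: "positive_op (adj T o\<^sub>L T)"
  proof (rule positive_opI)
    show "0 \<le> inner (blinfun_apply (adj T o\<^sub>L T) x) x" for x
      unfolding inner_eq_Re_cinner using T by (simp add: cinner_adj_left cinner_self)
  qed (use T in \<open>simp_all add: cinner_adj_left cinner_adj_right\<close>)
  then obtain P where P: "positive_op P" "P o\<^sub>L P = adj T o\<^sub>L T"
    and comm: "\<And>Q. Q o\<^sub>L (adj T o\<^sub>L T) = (adj T o\<^sub>L T) o\<^sub>L Q \<Longrightarrow> Q o\<^sub>L P = P o\<^sub>L Q"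
    using positive_sqrt_exists by blast
  have uniq: "Q = P" if Q: "positive_op Q \<and> Q o\<^sub>L Q = adj T o\<^sub>L T" for Q
  proof -
    have "Q o\<^sub>L (adj T o\<^sub>L T) = (adj T o\<^sub>L T) o\<^sub>L Q"
      using Q by (metis blinfun_compose_assoc)
    then have "Q o\<^sub>L P = P o\<^sub>L Q"
      by (rule comm)
    then show ?thesis
      by (rule positive_sqrt_unique [OF P(1) conjunct1 [OF Q] trans [OF P(2) conjunct2 [OF Q, symmetric]], symmetric])
  qed
  have "abs_op T = P"
    unfolding abs_op_def
  proof (rule the_equality)
    show "positive_op P \<and> P o\<^sub>L P = adj T o\<^sub>L T"
      by (rule conjI [OF P])
  qed (rule uniq)
  then show ?thesis
    using P by blast
qed

text \<open>\<open>trace_bound T c\<close>: the operator \<open>T\<close> is a finite sum of products of Hilbert-Schmidt operators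
  which shows that its trace norm is at most \<open>c\<close>.\<close>

inductive trace_bound :: "('a::chilbert_space \<Rightarrow>\<^sub>L 'a) \<Rightarrow> real \<Rightarrow> bool" where
  compose: "hilbert_schmidt S \<Longrightarrow> hilbert_schmidt T \<Longrightarrow> hs_norm S * hs_norm T \<le> c \<Longrightarrow> trace_bound (S o\<^sub>L T) c"
| add: "trace_bound S c \<Longrightarrow> trace_bound T d \<Longrightarrow> trace_bound (S + T) (c + d)"

lemma trace_bound_clinear: "trace_bound T c \<Longrightarrow> clinear T"
  by (induction rule: trace_bound.induct) auto

lemma trace_bound_nonneg: "trace_bound T c \<Longrightarrow> 0 \<le> c"
proof (induction rule: trace_bound.induct)
  case (compose S T c)
  then show ?case
    using mult_nonneg_nonneg [OF hs_norm_nonneg [of S] hs_norm_nonneg [of T]] by linarith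
qed simp

lemma trace_bound_0: "trace_bound 0 0"
  using trace_bound.compose [of 0 0 0] by simp

lemma trace_bound_sum: "(\<And>i. i \<in> I \<Longrightarrow> trace_bound (f i) (c i)) \<Longrightarrow> trace_bound (sum f I) (sum c I)"
  by (induction I rule: infinite_finite_induct) (auto intro: trace_bound_0 trace_bound.add)

lemma trace_bound_compose_left:
  assumes "trace_bound T c" "clinear W"
  shows "trace_bound (W o\<^sub>L T) (norm W * c)"
  using assms
proof (induction rule: trace_bound.induct)
  case (compose S T c)
  have "hs_norm (W o\<^sub>L S) * hs_norm T \<le> (norm W * hs_norm S) * hs_norm T"
    using compose by (intro mult_right_mono hilbert_schmidt_compose_left) auto
  also have "\<dots> \<le> norm W * c"
    using compose by (simp add: mult.assoc mult_left_mono)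
  finally show ?case
    using compose by (auto simp flip: blinfun_compose_assoc intro!: trace_bound.compose hilbert_schmidt_compose_left)
qed (auto simp: blinfun_compose_simps distrib_left intro: trace_bound.add)

lemma trace_bound_compose_right:
  assumes "trace_bound T c" "clinear W"
  shows "trace_bound (T o\<^sub>L W) (norm W * c)"
  using assms
proof (induction rule: trace_bound.induct)
  case (compose S T c)
  have "hs_norm S * hs_norm (T o\<^sub>L W) \<le> hs_norm S * (norm W * hs_norm T)"
    using compose by (intro mult_left_mono hilbert_schmidt_compose_right) auto
  also have "\<dots> \<le> norm W * c"
    using mult_left_mono [OF compose(3) norm_ge_zero [of W]] by (simp add: mult_ac)
  finally show ?case
    using compose by (auto simp: blinfun_compose_assoc intro!: trace_bound.compose hilbert_schmidt_compose_right)
qed (auto simp: blinfun_compose_simps distrib_left intro: trace_bound.add)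

lemma trace_bound_scaleC:
  assumes "trace_bound T c"
  shows "trace_bound (scaleC_op a T) (cmod a * c)"
  using assms
proof (induction rule: trace_bound.induct)
  case (compose S T c)
  have "scaleC_op a (S o\<^sub>L T) = scaleC_op a S o\<^sub>L T"
    by (rule blinfun_eqI) simp
  then show ?case
    using compose
    by (auto intro!: trace_bound.compose hilbert_schmidt_scaleC simp: hs_norm_scaleC mult.assoc mult_left_mono)
next
  case (add S c T d)
  have "scaleC_op a (S + T) = scaleC_op a S + scaleC_op a T"
    by (rule blinfun_eqI) (simp add: blinfun.add_left scaleC.add_right)
  then show ?case
    using add by (auto simp: distrib_left intro: trace_bound.add)
qed

text \<open>For a product the diagonal entry is \<open>cinner (T e) (adj S e)\<close>, and
  Cauchy-Schwarz over \<open>F\<close> yields the product of the two Hilbert-Schmidt norms.\<close>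

lemma trace_bound_abs_sum:
  assumes "trace_bound T c" "finite F" "F \<subseteq> some_onb"
  shows "(\<Sum>e\<in>F. cmod (cinner (blinfun_apply T e) e)) \<le> c"
  using assms
proof (induction rule: trace_bound.induct)
  case (compose S T c)
  have "(\<Sum>e\<in>F. cmod (cinner (blinfun_apply (S o\<^sub>L T) e) e))
      \<le> (\<Sum>e\<in>F. norm (blinfun_apply T e) * norm (blinfun_apply (adj S) e))"
  proof (rule sum_mono)
    show "cmod (cinner (blinfun_apply (S o\<^sub>L T) e) e)
        \<le> norm (blinfun_apply T e) * norm (blinfun_apply (adj S) e)" for e
      using cmod_cinner_le [of "blinfun_apply T e" "blinfun_apply (adj S) e"] compose
      by (simp add: cinner_adj_right)
  qed
  also have "\<dots> \<le> L2_set (\<lambda>e. norm (blinfun_apply T e)) F * L2_set (\<lambda>e. norm (blinfun_apply (adj S) e)) F"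
    using L2_set_mult_ineq [of "\<lambda>e. norm (blinfun_apply T e)" "\<lambda>e. norm (blinfun_apply (adj S) e)" F] by simp
  also have "\<dots> \<le> hs_norm T * hs_norm (adj S)"
    unfolding L2_set_def hs_norm_def using compose
    by (intro mult_mono real_sqrt_le_mono finite_sum_le_infsum hilbert_schmidt_summable hilbert_schmidt_adj)
      (auto simp: sum_nonneg infsum_nonneg)
  also have "\<dots> \<le> c"
    using compose by (simp add: hs_norm_adj mult.commute)
  finally show ?case .
next
  case (add S c T d)
  have "(\<Sum>e\<in>F. cmod (cinner (blinfun_apply (S + T) e) e))
      \<le> (\<Sum>e\<in>F. cmod (cinner (blinfun_apply S e) e) + cmod (cinner (blinfun_apply T e) e))"
    by (intro sum_mono) (simp add: blinfun.add_left cinner.add_left norm_triangle_ineq)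
  then show ?case
    using add by (simp add: sum.distrib)
qed

lemma trace_bound_has_sum:
  assumes "trace_bound T c"
  shows "((\<lambda>e. cinner (blinfun_apply T e) e) has_sum trace_op T) some_onb"
proof -
  have "(\<lambda>e. norm (cinner (blinfun_apply T e) e)) summable_on some_onb"
    by (rule nonneg_bdd_above_summable_on)
      (use trace_bound_abs_sum [OF assms] in \<open>auto intro!: bdd_aboveI2 [where M = c]\<close>)
  then show ?thesis
    unfolding trace_op_def by (rule has_sum_infsum [OF abs_summable_summable])
qed

lemma trace_op_add:
  assumes "trace_bound S c" "trace_bound T d"
  shows "trace_op (S + T) = trace_op S + trace_op T"
  using has_sum_add [OF trace_bound_has_sum [OF assms(1)] trace_bound_has_sum [OF assms(2)]]
    trace_bound_has_sum [OF trace_bound.add [OF assms]]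
  by (simp add: blinfun.add_left cinner.add_left has_sum_unique)

lemma trace_op_0 [simp]: "trace_op 0 = 0"
  by (simp add: trace_op_def cinner.zero_left)

lemma trace_op_scaleC: "trace_op (scaleC_op a T) = a * trace_op T"
  by (simp add: trace_op_def cinner_scaleC_left infsum_cmult_right')

lemma trace_bound_uminus: "trace_bound T c \<Longrightarrow> trace_bound (- T) c"
  using trace_bound_scaleC [of T c "- 1"] by (simp add: scaleC_op_minus1)

lemma trace_op_uminus: "trace_op (- T) = - trace_op T"
  using trace_op_scaleC [of "- 1" T] by (simp add: scaleC_op_minus1)

lemma trace_op_diff:
  assumes "trace_bound S c" "trace_bound T d"
  shows "trace_op (S - T) = trace_op S - trace_op T"
  using trace_op_add [OF assms(1) trace_bound_uminus [OF assms(2)]] by (simp add: trace_op_uminus)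

lemma trace_bound_diff: "trace_bound S c \<Longrightarrow> trace_bound T d \<Longrightarrow> trace_bound (S - T) (c + d)"
  using trace_bound.add [OF _ trace_bound_uminus] by fastforce

lemma trace_op_sum:
  assumes "\<And>i. i \<in> I \<Longrightarrow> trace_bound (f i) (c i)"
  shows "trace_op (sum f I) = (\<Sum>i\<in>I. trace_op (f i))"
  using assms
proof (induction I rule: infinite_finite_induct)
  case (insert i I)
  then show ?case
    using trace_op_add [of "f i" "c i" "sum f I" "sum c I"] trace_bound_sum [of I f c] by auto
qed auto

lemma trace_op_bound:
  assumes "trace_bound T c"
  shows "cmod (trace_op T) \<le> c"
proof -
  have "cmod (\<Sum>e\<in>F. cinner (blinfun_apply T e) e) \<le> c" if "finite F" "F \<subseteq> some_onb" for F
    by (rule order_trans [OF norm_sum trace_bound_abs_sum [OF assms that]])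
  then have "eventually (\<lambda>F. cmod (\<Sum>e\<in>F. cinner (blinfun_apply T e) e) \<le> c) (finite_subsets_at_top some_onb)"
    by (rule eventually_finite_subsets_at_top_weakI)
  then show ?thesis
    by (rule tendsto_upperbound [OF tendsto_norm [OF trace_bound_has_sum [OF assms, unfolded has_sum_def]]]) simp
qed

section \<open>Trace bounds imply membership in the trace class defined by the absolute
  value\<close>

lemma norm_op_power: "norm (op_power T n) \<le> norm T ^ n"
proof (induction n)
  case 0
  show ?case by (simp add: norm_blinfun_id_le)
next
  case (Suc n)
  have "norm (op_power T (Suc n)) \<le> norm T * norm (op_power T n)"
    by (simp add: norm_blinfun_compose)
  also have "\<dots> \<le> norm T * norm T ^ n"
    by (intro mult_left_mono Suc) simp
  finally show ?case by simp
qed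

lemma clinear_op_power [simp]: "clinear T \<Longrightarrow> clinear (op_power T n)"
  by (induction n) auto

lemma op_power_geometric:
  "(id_blinfun - T) o\<^sub>L (\<Sum>k<n. op_power T k) = id_blinfun - op_power T n"
  by (induction n) (simp_all add: blinfun_compose_simps)

text \<open>
  A partial sum of the Neumann series of \<open>(P + \<epsilon>)\<^sup>-\<^sup>1\<close> gives an operator \<open>G\<close> with \<open>P G \<approx> 1\<close>
  on the range of \<open>P\<close>. Applied to \<open>P = \<bar>T\<bar>\<close>, the operator \<open>T G\<close> replaces the partial isometry
  of the polar decomposition.
\<close>

lemma positive_op_approx_inverse:
  assumes P: "positive_op P" and \<epsilon>: "\<epsilon> > 0"
  obtains G where "clinear G" "\<And>x. norm (blinfun_apply P (blinfun_apply G x)) \<le> 2 * norm x"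
    "\<And>x. cmod (cinner (blinfun_apply P x) (x - blinfun_apply P (blinfun_apply G x))) \<le> 3 * \<epsilon> * (norm x)\<^sup>2"
proof -
  define c where "c = norm P + \<epsilon>"
  have c: "c > 0" using \<epsilon> by (simp add: c_def add_nonneg_pos)
  \<comment> \<open>Chosen so that \<open>1 - Y = (P + \<epsilon>) / c\<close>, while positivity of
    \<open>norm P - P\<close> keeps the norm of \<open>Y\<close> at most \<open>norm P / c\<close>,
    which is below one.\<close>
  define Y where "Y = (1 / c) *\<^sub>R (norm P *\<^sub>R id_blinfun - P)"
  have Pnn: "0 \<le> inner (blinfun_apply P x) x" for x
    by (rule positive_op_inner_nonneg [OF P])
  have Ple: "inner (blinfun_apply P x) x \<le> norm P * (norm x)\<^sup>2" for x
  proof -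
    have "inner (blinfun_apply P x) x \<le> norm (blinfun_apply P x) * norm x"
      by (rule norm_cauchy_schwarz)
    also have "\<dots> \<le> (norm P * norm x) * norm x"
      by (intro mult_right_mono norm_blinfun) simp
    finally show ?thesis by (simp add: power2_eq_square mult.assoc)
  qed
  have "positive_op (norm P *\<^sub>R id_blinfun - P)"
  proof (rule positive_opI)
    show "0 \<le> inner (blinfun_apply (norm P *\<^sub>R id_blinfun - P) x) x" for x
      using Ple [of x] by (simp add: blinfun.bilinear_simps inner_diff_left power2_norm_eq_inner)
  qed (use P in \<open>simp_all add: blinfun.bilinear_simps cinner.diff_left cinner.diff_right
      cinner_scaleR_left cinner_scaleR_right positive_op_symmetric\<close>)
  then have "norm (norm P *\<^sub>R id_blinfun - P) \<le> norm P"
    by (rule positive_op_norm_le)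
      (use Pnn in \<open>auto simp: blinfun.bilinear_simps inner_diff_left power2_norm_eq_inner\<close>)
  then have "norm Y \<le> norm P / c"
    using c by (simp add: Y_def divide_right_mono)
  then have Y1: "norm Y < 1"
    using c \<epsilon> by (smt (verit) c_def divide_less_eq_1_pos)
  then have "(\<lambda>n. norm Y ^ n * norm P) \<longlonglongrightarrow> 0 * norm P"
    by (intro tendsto_mult LIMSEQ_realpow_zero tendsto_const) auto
  then have "eventually (\<lambda>n. norm Y ^ n * norm P < \<epsilon>) sequentially"
    using \<epsilon> by (simp add: order_tendsto_iff)
  then obtain n where n: "norm Y ^ n * norm P < \<epsilon>"
    by (auto simp: eventually_sequentially)
  \<comment> \<open>The error of the truncated Neumann series. It was made small relative to
    \<open>norm P\<close> because it will be paired with \<open>P x\<close>.\<close>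
  define R where "R = op_power Y n"
  define G where "G = (1 / c) *\<^sub>R (\<Sum>k<n. op_power Y k)"
  have "clinear Y" using P by (simp add: Y_def)
  then have G: "clinear G" by (simp add: G_def)
  have "id_blinfun - Y = (1 / c) *\<^sub>R (P + \<epsilon> *\<^sub>R id_blinfun)"
  proof -
    have "(1 - norm P / c) = \<epsilon> / c"
      using c by (simp add: c_def field_simps)
    then have "(id_blinfun :: 'a \<Rightarrow>\<^sub>L 'a) - (norm P / c) *\<^sub>R id_blinfun = (\<epsilon> / c) *\<^sub>R id_blinfun"
      by (metis scaleR_left_diff_distrib scaleR_one)
    then show ?thesis
      by (simp add: Y_def scaleR_add_right scaleR_diff_right)
  qed
  then have "(P + \<epsilon> *\<^sub>R id_blinfun) o\<^sub>L G = id_blinfun - R"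
    using op_power_geometric [of Y n] by (simp add: R_def G_def blinfun_compose_simps)
  then have PG: "blinfun_apply P (blinfun_apply G x) + \<epsilon> *\<^sub>R blinfun_apply G x = x - blinfun_apply R x" for x
    by (metis blinfun.add_left blinfun.diff_left blinfun.scaleR_left blinfun_apply_blinfun_compose
        blinfun_apply_id_blinfun id_apply)
  have R: "norm R \<le> norm Y ^ n"
    unfolding R_def by (rule norm_op_power)
  have Rx: "norm (blinfun_apply R x) \<le> norm Y ^ n * norm x" for x
    using norm_blinfun [of R x] R by (meson mult_right_mono norm_ge_zero order_trans)
  have PG2: "norm (blinfun_apply P (blinfun_apply G x)) \<le> 2 * norm x" for x
  proof -
    let ?z = "blinfun_apply G x"
    \<comment> \<open>The cross term \<open>2 \<epsilon> (P z, z)\<close> is nonnegative, so adding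
      \<open>\<epsilon> z\<close> cannot shorten \<open>P z\<close>.\<close>
    have "(norm (blinfun_apply P ?z))\<^sup>2 \<le> (norm (blinfun_apply P ?z + \<epsilon> *\<^sub>R ?z))\<^sup>2"
      using Pnn [of ?z] \<epsilon>
      by (simp add: power2_norm_eq_inner inner_add_left inner_add_right inner_commute)
    then have "norm (blinfun_apply P ?z) \<le> norm (blinfun_apply P ?z + \<epsilon> *\<^sub>R ?z)"
      by (rule power2_le_imp_le) simp
    also have "\<dots> \<le> norm x + norm (blinfun_apply R x)"
      unfolding PG by (rule norm_triangle_ineq4)
    also have "\<dots> \<le> norm x + norm Y ^ n * norm x"
      by (intro add_left_mono Rx)
    also have "\<dots> \<le> norm x + 1 * norm x"
      using Y1 by (intro add_left_mono mult_right_mono power_le_one) auto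
    finally show ?thesis by simp
  qed
  have "cmod (cinner (blinfun_apply P x) (x - blinfun_apply P (blinfun_apply G x))) \<le> 3 * \<epsilon> * (norm x)\<^sup>2" for x
  proof -
    let ?z = "blinfun_apply G x"
    \<comment> \<open>\<open>G x\<close> may be as large as \<open>norm x / \<epsilon>\<close>, so
      \<open>\<epsilon> G x\<close> is not small by itself. Paired with \<open>P x\<close>, symmetry
      turns it into \<open>\<epsilon> P G x\<close> against \<open>x\<close>, and
      \<open>P G x\<close> has norm at most \<open>2 norm x\<close>.\<close>
    have "x - blinfun_apply P ?z = blinfun_apply R x + \<epsilon> *\<^sub>R ?z"
      using PG [of x] by (simp add: algebra_simps)
    then have "cinner (blinfun_apply P x) (x - blinfun_apply P ?z)
        = cinner (blinfun_apply P x) (blinfun_apply R x) + \<epsilon> *\<^sub>R cinner x (blinfun_apply P ?z)"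
      by (simp add: cinner.add_right cinner_scaleR_right positive_op_symmetric [OF P])
    also have "cmod \<dots> \<le> norm (blinfun_apply P x) * norm (blinfun_apply R x) + \<epsilon> * (norm x * norm (blinfun_apply P ?z))"
      using \<epsilon> by (intro norm_triangle_le add_mono) (auto simp: cmod_cinner_le)
    also have "\<dots> \<le> (norm P * norm x) * (norm Y ^ n * norm x) + \<epsilon> * (norm x * (2 * norm x))"
      using \<epsilon> by (intro add_mono mult_mono norm_blinfun Rx PG2) auto
    also have "\<dots> = (norm Y ^ n * norm P) * (norm x)\<^sup>2 + 2 * \<epsilon> * (norm x)\<^sup>2"
      by (simp add: power2_eq_square algebra_simps)
    also have "\<dots> \<le> \<epsilon> * (norm x)\<^sup>2 + 2 * \<epsilon> * (norm x)\<^sup>2"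
      using n by (intro add_right_mono mult_right_mono) auto
    finally show ?thesis by simp
  qed
  with G PG2 show ?thesis by (rule that)
qed

text \<open>\<open>trace_class\<close> speaks of the diagonal of \<open>P = abs_op T\<close>, while
  a trace bound controls the diagonals of \<open>W T\<close> for bounded \<open>W\<close>. As
  \<open>T\<close> and \<open>P\<close> induce the same form, \<open>(P e, P G e)\<close> is the
  diagonal entry of \<open>adj (T G) T\<close>, and \<open>T G\<close> has norm at most two.\<close>

lemma trace_bound_trace_class:
  assumes T: "trace_bound T c"
  shows "trace_class T"
proof -
  have cl: "clinear T" by (rule trace_bound_clinear [OF T])
  define P where "P = abs_op T"
  have P: "positive_op P" "P o\<^sub>L P = adj T o\<^sub>L T"
    using abs_op_works [OF cl] by (auto simp: P_def)
  have TP: "cinner (blinfun_apply T x) (blinfun_apply T y) = cinner (blinfun_apply P x) (blinfun_apply P y)" for x y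
  proof -
    have "cinner (blinfun_apply T x) (blinfun_apply T y) = cinner (blinfun_apply (adj T o\<^sub>L T) x) y"
      using cl by (simp add: cinner_adj_left)
    also have "\<dots> = cinner (blinfun_apply P x) (blinfun_apply P y)"
      by (simp add: P(2) [symmetric] positive_op_symmetric [OF P(1)])
    finally show ?thesis .
  qed
  have nTP: "norm (blinfun_apply T x) = norm (blinfun_apply P x)" for x
    using TP [of x x] unfolding cinner_self of_real_eq_iff by (simp add: power2_eq_iff_nonneg)
  have bound: "(\<Sum>e\<in>F. cmod (cinner (blinfun_apply P e) e)) \<le> 2 * c"
    if F: "finite F" "F \<subseteq> some_onb" for F
  proof (rule field_le_epsilon)
    fix \<delta> :: real assume \<delta>: "\<delta> > 0"
    \<comment> \<open>Each of the \<open>card F\<close> basis vectors contributes an error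
      \<open>3 \<epsilon>\<close>; the added one covers empty \<open>F\<close>.\<close>
    define \<epsilon> where "\<epsilon> = \<delta> / (3 * (real (card F) + 1))"
    have \<epsilon>: "\<epsilon> > 0" using \<delta> by (simp add: \<epsilon>_def)
    obtain G where G: "clinear G" "\<And>x. norm (blinfun_apply P (blinfun_apply G x)) \<le> 2 * norm x"
      "\<And>x. cmod (cinner (blinfun_apply P x) (x - blinfun_apply P (blinfun_apply G x))) \<le> 3 * \<epsilon> * (norm x)\<^sup>2"
      by (rule positive_op_approx_inverse [OF P(1) \<epsilon>]) blast
    have W: "clinear (adj (T o\<^sub>L G))" "norm (adj (T o\<^sub>L G)) \<le> 2"
      using cl G by (auto intro!: norm_blinfun_bound simp: nTP)
    have tb: "(\<Sum>e\<in>F. cmod (cinner (blinfun_apply (adj (T o\<^sub>L G) o\<^sub>L T) e) e)) \<le> norm (adj (T o\<^sub>L G)) * c"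
      by (rule trace_bound_abs_sum [OF trace_bound_compose_left [OF T W(1)] F])
    have "cmod (cinner (blinfun_apply P e) e)
        \<le> cmod (cinner (blinfun_apply (adj (T o\<^sub>L G) o\<^sub>L T) e) e) + 3 * \<epsilon>" if "e \<in> F" for e
    proof -
      have e: "norm e = 1"
        using F that is_onb_some_onb by (auto simp: is_onb_def)
      have "cinner (blinfun_apply P e) e = cinner (blinfun_apply (adj (T o\<^sub>L G) o\<^sub>L T) e) e
          + cinner (blinfun_apply P e) (e - blinfun_apply P (blinfun_apply G e))"
        using cl G(1) by (simp add: cinner_adj_left TP cinner.diff_right)
      then show ?thesis
        using G(3) [of e] e
          norm_triangle_ineq [of "cinner (blinfun_apply (adj (T o\<^sub>L G) o\<^sub>L T) e) e"
            "cinner (blinfun_apply P e) (e - blinfun_apply P (blinfun_apply G e))"]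
        by simp
    qed
    then have "(\<Sum>e\<in>F. cmod (cinner (blinfun_apply P e) e))
        \<le> (\<Sum>e\<in>F. cmod (cinner (blinfun_apply (adj (T o\<^sub>L G) o\<^sub>L T) e) e) + 3 * \<epsilon>)"
      by (rule sum_mono)
    also have "\<dots> \<le> 2 * c + real (card F) * (3 * \<epsilon>)"
      using tb mult_right_mono [OF W(2) trace_bound_nonneg [OF T]] by (simp add: sum.distrib)
    also have "real (card F) * (3 * \<epsilon>) \<le> \<delta>"
      using \<delta> by (simp add: \<epsilon>_def field_simps)
    finally show "(\<Sum>e\<in>F. cmod (cinner (blinfun_apply P e) e)) \<le> 2 * c + \<delta>" by simp
  qed
  have "(\<lambda>e. norm (cinner (blinfun_apply P e) e)) summable_on some_onb"
    by (rule nonneg_bdd_above_summable_on)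
      (use bound in \<open>auto intro!: bdd_aboveI2 [where M = "2 * c"]\<close>)
  then have "(\<lambda>e. cinner (blinfun_apply P e) e) summable_on some_onb"
    by (rule abs_summable_summable)
  then show ?thesis
    using cl by (simp add: trace_class_def P_def)
qed

section \<open>One-parameter groups\<close>

lemma op_power_commute: "op_power X n o\<^sub>L X = X o\<^sub>L op_power X n"
  by (induction n) (simp_all add: blinfun_compose_simps blinfun_compose_assoc)

lemma op_power_scaleR: "op_power (r *\<^sub>R X) n = r ^ n *\<^sub>R op_power X n"
  by (induction n) (simp_all add: blinfun_compose_simps)

lemma summable_op_exp: "summable (\<lambda>n. norm ((s ^ n / fact n) *\<^sub>R op_power X n))"
proof (rule summable_comparison_test' [OF summable_exp [of "\<bar>s\<bar> * norm X"], of 0])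
  fix n
  show "norm (norm ((s ^ n / fact n) *\<^sub>R op_power X n)) \<le> inverse (fact n) * (\<bar>s\<bar> * norm X) ^ n"
    using norm_op_power [of X n]
    by (simp add: power_mult_distrib power_abs field_simps mult_left_mono)
qed

lemma exp_path_sums:
  "(\<lambda>n. (s ^ n / fact n) *\<^sub>R op_power X n) sums exp_op (s *\<^sub>R (X :: 'a::chilbert_space \<Rightarrow>\<^sub>L 'a))"
proof -
  have "(\<lambda>n. (s ^ n / fact n) *\<^sub>R op_power X n) sums (\<Sum>n. (s ^ n / fact n) *\<^sub>R op_power X n)"
    by (intro summable_sums summable_norm_cancel [OF summable_op_exp])
  then show ?thesis
    by (simp add: exp_op_def op_power_scaleR divide_inverse mult.commute)
qed

lemma exp_path_0 [simp]: "exp_op (0 :: 'a::chilbert_space \<Rightarrow>\<^sub>L 'a) = id_blinfun"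
proof -
  have "(\<lambda>n. (0 ^ n / fact n) *\<^sub>R op_power (0 :: 'a \<Rightarrow>\<^sub>L 'a) n) sums id_blinfun"
    using sums_If_finite_set [of "{0}" "\<lambda>n. (0 ^ n / fact n) *\<^sub>R op_power (0 :: 'a \<Rightarrow>\<^sub>L 'a) n"]
    by (rule_tac sums_cong [THEN iffD1]) (auto simp: power_0_left)
  then show ?thesis
    using exp_path_sums [of 0 "0 :: 'a \<Rightarrow>\<^sub>L 'a"] sums_unique2 by fastforce
qed

text \<open>Termwise differentiation on a ball around \<open>s\<close>, where the exponential series
  converges uniformly: the derived series is \<open>X\<close> times the same series shifted by one
  index.\<close>

lemma exp_path_has_vector_derivative:
  fixes X :: "'a::chilbert_space \<Rightarrow>\<^sub>L 'a"
  shows "((\<lambda>s. exp_op (s *\<^sub>R X)) has_vector_derivative (X o\<^sub>L exp_op (s *\<^sub>R X))) (at s)"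
proof -
  define r where "r = \<bar>s\<bar> + 1"
  define S where "S = ball (0::real) r"
  define f where "f = (\<lambda>n s. (s ^ n / fact n) *\<^sub>R op_power X n)"
  define d where "d = (\<lambda>n s. case n of 0 \<Rightarrow> 0 | Suc m \<Rightarrow> X o\<^sub>L f m s)"
  have sS: "s \<in> S" by (simp add: S_def r_def)
  have der: "(f n has_derivative (\<lambda>h. h *\<^sub>R d n t)) (at t within S)" for n t
  proof (cases n)
    case 0
    then show ?thesis by (simp add: f_def d_def)
  next
    case (Suc m)
    have "((\<lambda>s. s ^ Suc m / fact (Suc m)) has_real_derivative (t ^ m / fact m)) (at t within S)"
    proof -
      have "real (Suc m) * t ^ m / fact (Suc m) = t ^ m / fact m"
        by (simp add: fact_Suc del: of_nat_Suc)
      then show ?thesis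
        using DERIV_cdivide [OF DERIV_pow [of "Suc m" t S], of "fact (Suc m)"] by simp
    qed
    then have "(f n has_vector_derivative (t ^ m / fact m) *\<^sub>R op_power X n) (at t within S)"
      unfolding f_def Suc
      by (intro has_vector_derivative_scaleR [THEN has_vector_derivative_eq_rhs, OF _ has_vector_derivative_const]) auto
    then show ?thesis
      by (simp add: has_vector_derivative_def Suc f_def d_def blinfun_compose_simps)
  qed
  have "uniform_limit S (\<lambda>n x. \<Sum>i<n. f i x) (\<lambda>x. suminf (\<lambda>i. f i x)) sequentially"
  proof (rule Weierstrass_m_test [where M = "\<lambda>n. inverse (fact n) * (r * norm X) ^ n"])
    fix n t assume "t \<in> S"
    then have "\<bar>t\<bar> \<le> r" by (simp add: S_def)
    then have "\<bar>t\<bar> ^ n * norm (op_power X n) \<le> r ^ n * norm X ^ n"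
      by (intro mult_mono power_mono norm_op_power) (auto simp: r_def)
    then show "norm (f n t) \<le> inverse (fact n) * (r * norm X) ^ n"
      by (simp add: f_def power_abs power_mult_distrib field_simps)
  qed (rule summable_exp)
  then have ul: "uniform_limit S (\<lambda>n x. \<Sum>i<n. f i x) (\<lambda>x. exp_op (x *\<^sub>R X)) sequentially"
    unfolding f_def sums_unique [OF exp_path_sums, symmetric] .
  have "\<exists>g. \<forall>x\<in>S. (\<lambda>n. f n x) sums (g x) \<and>
      (g has_derivative (\<lambda>h. h *\<^sub>R (X o\<^sub>L exp_op (x *\<^sub>R X)))) (at x within S)"
  proof (rule has_derivative_series [OF _ der _ sS])
    show "convex S" by (simp add: S_def)
    show "(\<lambda>n. f n s) sums exp_op (s *\<^sub>R X)"
      unfolding f_def by (rule exp_path_sums)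
    fix e :: real assume e: "e > 0"
    \<comment> \<open>The derived partial sums differ from the limit by \<open>X\<close> applied to
      the original error, which costs a factor \<open>norm X\<close>; the added one avoids division
      by zero.\<close>
    define e' where "e' = e / (norm X + 1)"
    have "e' > 0" using e by (simp add: e'_def add_nonneg_pos)
    then have "eventually (\<lambda>n. \<forall>x\<in>S. norm ((\<Sum>i<n. f i x) - exp_op (x *\<^sub>R X)) < e') sequentially"
      using ul unfolding uniform_limit_iff dist_norm by blast
    \<comment> \<open>The derivative of the constant term vanishes, so \<open>n\<close> derived
      terms correspond to \<open>n - 1\<close> original ones.\<close>
    then have "eventually (\<lambda>n. \<forall>x\<in>S. norm ((\<Sum>i<n - 1. f i x) - exp_op (x *\<^sub>R X)) < e') sequentially"
      by (rule eventually_compose_filterlim [OF _ filterlim_minus_const_nat_at_top])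
    then show "eventually (\<lambda>n. \<forall>x\<in>S. \<forall>h. norm ((\<Sum>i<n. h *\<^sub>R d i x) - h *\<^sub>R (X o\<^sub>L exp_op (x *\<^sub>R X))) \<le> e * norm h) sequentially"
      using eventually_gt_at_top [of 0]
    proof eventually_elim
      case (elim n)
      have "norm ((\<Sum>i<n. h *\<^sub>R d i x) - h *\<^sub>R (X o\<^sub>L exp_op (x *\<^sub>R X))) \<le> e * norm h" if x: "x \<in> S" for x h
      proof -
        obtain m where m: "n = Suc m" using elim by (cases n) auto
        have "(\<Sum>i<n. d i x) = (X o\<^sub>L (\<Sum>i<m. f i x))"
          unfolding m sum.lessThan_Suc_shift
          by (simp add: d_def bounded_bilinear.sum_right [OF bounded_bilinear_blinfun_compose])
        then have "(\<Sum>i<n. h *\<^sub>R d i x) - h *\<^sub>R (X o\<^sub>L exp_op (x *\<^sub>R X))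
            = h *\<^sub>R (X o\<^sub>L ((\<Sum>i<m. f i x) - exp_op (x *\<^sub>R X)))"
          by (simp add: scaleR_sum_right [symmetric] scaleR_diff_right blinfun_compose_simps)
        then have "norm ((\<Sum>i<n. h *\<^sub>R d i x) - h *\<^sub>R (X o\<^sub>L exp_op (x *\<^sub>R X)))
            \<le> \<bar>h\<bar> * (norm X * norm ((\<Sum>i<m. f i x) - exp_op (x *\<^sub>R X)))"
          by (simp add: norm_blinfun_compose mult_left_mono)
        also have "\<dots> \<le> \<bar>h\<bar> * ((norm X + 1) * e')"
          using elim x m by (intro mult_left_mono mult_mono) (auto simp: less_imp_le)
        also have "\<dots> = e * norm h"
          by (simp add: e'_def add_nonneg_eq_0_iff)
        finally show ?thesis .
      qed
      then show ?case by blast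
    qed
  qed
  then obtain g where g: "\<And>x. x \<in> S \<Longrightarrow> (\<lambda>n. f n x) sums (g x)"
    "\<And>x. x \<in> S \<Longrightarrow> (g has_vector_derivative (X o\<^sub>L exp_op (x *\<^sub>R X))) (at x within S)"
    unfolding has_vector_derivative_def by blast
  have "g x = exp_op (x *\<^sub>R X)" if "x \<in> S" for x
    using g(1) [OF that] exp_path_sums [of x X] sums_unique2 unfolding f_def by blast
  then have "((\<lambda>s. exp_op (s *\<^sub>R X)) has_vector_derivative (X o\<^sub>L exp_op (s *\<^sub>R X))) (at s within S)"
    by (intro has_vector_derivative_transform [OF sS _ g(2) [OF sS]]) simp
  then show ?thesis
    using at_within_open [OF sS] by (simp add: S_def)
qed

lemma exp_path_commute: "X o\<^sub>L exp_op (s *\<^sub>R X) = exp_op (s *\<^sub>R X) o\<^sub>L (X :: 'a::chilbert_space \<Rightarrow>\<^sub>L 'a)"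
proof -
  have "(\<lambda>n. X o\<^sub>L (s ^ n / fact n) *\<^sub>R op_power X n) sums (X o\<^sub>L exp_op (s *\<^sub>R X))"
    by (rule bounded_linear.sums [OF bounded_bilinear.bounded_linear_right [OF bounded_bilinear_blinfun_compose] exp_path_sums])
  moreover have "(\<lambda>n. (s ^ n / fact n) *\<^sub>R op_power X n o\<^sub>L X) sums (exp_op (s *\<^sub>R X) o\<^sub>L X)"
    by (rule bounded_linear.sums [OF bounded_bilinear.bounded_linear_left [OF bounded_bilinear_blinfun_compose] exp_path_sums])
  ultimately show ?thesis
    by (simp add: blinfun_compose_simps op_power_commute sums_unique2)
qed

text \<open>The product \<open>exp (u X) exp ((s + t - u) X)\<close> has derivative zero in
  \<open>u\<close>; comparing \<open>u = s + t\<close> with \<open>u = s\<close> gives the group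
  law.\<close>

lemma exp_path_add:
  fixes X :: "'a::chilbert_space \<Rightarrow>\<^sub>L 'a"
  shows "exp_op ((s + t) *\<^sub>R X) = exp_op (s *\<^sub>R X) o\<^sub>L exp_op (t *\<^sub>R X)"
proof -
  define g where "g = (\<lambda>u. exp_op (u *\<^sub>R X) o\<^sub>L exp_op ((s + t - u) *\<^sub>R X))"
  have "(g has_vector_derivative 0) (at u within UNIV)" for u
  proof -
    have "((\<lambda>u. s + t - u) has_vector_derivative (- 1)) (at u)"
      by (auto intro!: derivative_eq_intros)
    from vector_diff_chain_at [OF this exp_path_has_vector_derivative [of X "s + t - u"]]
    have "((\<lambda>u. exp_op ((s + t - u) *\<^sub>R X)) has_vector_derivative - (X o\<^sub>L exp_op ((s + t - u) *\<^sub>R X))) (at u)"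
      by (simp add: o_def)
    from bounded_bilinear.has_vector_derivative [OF bounded_bilinear_blinfun_compose
        exp_path_has_vector_derivative [of X u] this]
    show ?thesis
      unfolding g_def
      by (rule has_vector_derivative_eq_rhs)
        (simp add: blinfun_compose_simps exp_path_commute [of X u] blinfun_compose_assoc)
  qed
  then obtain c where "\<And>u. g u = c"
    using has_derivative_zero_constant [of UNIV g] unfolding has_vector_derivative_def by auto
  then have "g (s + t) = g s" by simp
  then show ?thesis
    by (simp add: g_def blinfun_compose_simps)
qed

lemma exp_path_inverse: "exp_op (s *\<^sub>R X) o\<^sub>L exp_op (- s *\<^sub>R X) = id_blinfun"
  for X :: "'a::chilbert_space \<Rightarrow>\<^sub>L 'a"
  using exp_path_add [of s "- s" X] by simp

lemma clinear_exp_path [simp]: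
  assumes "clinear X"
  shows "clinear (exp_op (s *\<^sub>R X))"
  using exp_path_sums [of s X] unfolding sums_def
  by (rule clinear_tendsto [rotated]) (use assms in simp)

text \<open>Generators are carried as \<open>X = \<i> A\<close>. Then the path is
  \<open>exp (s X)\<close> with a real parameter, and the real vector space structure of the
  operators suffices for its calculus.\<close>

definition skew_op :: "('a::chilbert_space \<Rightarrow>\<^sub>L 'a) \<Rightarrow> bool" where
  "skew_op X \<longleftrightarrow> clinear X \<and> adj X = - X"

lemma skew_op_clinear [simp]: "skew_op X \<Longrightarrow> clinear X"
  by (simp add: skew_op_def)

lemma adj_exp_path:
  assumes X: "skew_op X"
  shows "adj (exp_op (s *\<^sub>R X)) = exp_op (- s *\<^sub>R X)"
proof (rule adj_eqI)
  fix x y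
  have Xs: "cinner (blinfun_apply X x) y = - cinner x (blinfun_apply X y)" for x y
    using X cinner_adj_right [of X x y] by (simp add: skew_op_def blinfun.minus_left cinner.minus_right)
  have pw: "cinner (blinfun_apply (op_power X n) x) y = (- 1) ^ n * cinner x (blinfun_apply (op_power X n) y)" for n x y
  proof (induction n arbitrary: x y)
    case (Suc n)
    have "cinner (blinfun_apply (op_power X (Suc n)) x) y = (- 1) ^ Suc n * cinner x (blinfun_apply (op_power X n o\<^sub>L X) y)"
      using Suc by (simp add: Xs)
    then show ?case by (simp add: op_power_commute)
  qed simp
  have "(\<lambda>n. cinner (blinfun_apply ((s ^ n / fact n) *\<^sub>R op_power X n) x) y) sums cinner (blinfun_apply (exp_op (s *\<^sub>R X)) x) y"
    by (intro bounded_linear.sums [OF cinner.bounded_linear_left] bounded_linear.sums [OF bounded_linear_apply_blinfun] exp_path_sums)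
  moreover have "(\<lambda>n. cinner x (blinfun_apply (((- s) ^ n / fact n) *\<^sub>R op_power X n) y)) sums cinner x (blinfun_apply (exp_op (- s *\<^sub>R X)) y)"
    by (intro bounded_linear.sums [OF cinner.bounded_linear_right] bounded_linear.sums [OF bounded_linear_apply_blinfun] exp_path_sums)
  moreover have "cinner (blinfun_apply ((s ^ n / fact n) *\<^sub>R op_power X n) x) y
      = cinner x (blinfun_apply (((- s) ^ n / fact n) *\<^sub>R op_power X n) y)" for n
    by (simp add: blinfun.scaleR_left cinner_scaleR_left cinner_scaleR_right pw power_minus [of s])
       (simp add: scaleR_conv_of_real)
  ultimately show "cinner (blinfun_apply (exp_op (s *\<^sub>R X)) x) y = cinner x (blinfun_apply (exp_op (- s *\<^sub>R X)) y)"
    by (simp add: sums_unique2)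
qed

lemma unitary_exp_path: "skew_op X \<Longrightarrow> unitary_op (exp_op (s *\<^sub>R X))"
  using exp_path_inverse [of s X] exp_path_inverse [of "- s" X] by (simp add: unitary_op_def adj_exp_path)

lemma unitary_op_clinear [simp]: "unitary_op U \<Longrightarrow> clinear U"
  by (simp add: unitary_op_def)

lemma unitary_op_norm_apply:
  assumes "unitary_op U"
  shows "norm (blinfun_apply U x) = norm x"
proof -
  have "cinner (blinfun_apply U x) (blinfun_apply U x) = cinner x (blinfun_apply (adj U o\<^sub>L U) x)"
    using assms by (simp add: cinner_adj_right)
  moreover have "blinfun_apply (adj U o\<^sub>L U) x = x"
    using assms by (simp only: unitary_op_def blinfun_apply_id_blinfun id_apply)
  ultimately have "cinner (blinfun_apply U x) (blinfun_apply U x) = cinner x x"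
    by simp
  then show ?thesis
    unfolding cinner_self of_real_eq_iff by (simp add: power2_eq_iff_nonneg)
qed

lemma unitary_op_norm_le: "unitary_op U \<Longrightarrow> norm U \<le> 1"
  by (rule norm_blinfun_bound) (auto simp: unitary_op_norm_apply)

lemma unitary_op_compose: "unitary_op U \<Longrightarrow> unitary_op V \<Longrightarrow> unitary_op (U o\<^sub>L V)"
  unfolding unitary_op_def
  by (auto simp: adj_compose) (metis blinfun_compose_assoc blinfun_compose_simps(9))+

lemma unitary_op_adj: "unitary_op U \<Longrightarrow> unitary_op (adj U)"
  by (simp add: unitary_op_def)

lemma unitary_op_id: "unitary_op id_blinfun"
  by (simp add: unitary_op_def blinfun_compose_simps)

text \<open>The remainder is written with a factor \<open>X\<close> on both sides. For
  Hilbert-Schmidt \<open>X\<close> this exhibits it as a product of two Hilbert-Schmidt operators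
  with the gain \<open>h^2\<close>.\<close>

lemma exp_path_taylor:
  fixes X :: "'a::chilbert_space \<Rightarrow>\<^sub>L 'a"
  assumes X: "clinear X"
  obtains G where "clinear G" "norm G \<le> exp (\<bar>h\<bar> * norm X)"
    "exp_op (h *\<^sub>R X) - id_blinfun - h *\<^sub>R X = h\<^sup>2 *\<^sub>R (X o\<^sub>L (G o\<^sub>L X))"
proof -
  define g where "g = (\<lambda>n. (h ^ n / fact (n + 2)) *\<^sub>R op_power X n)"
  have le: "norm (g n) \<le> (\<bar>h\<bar> * norm X) ^ n /\<^sub>R fact n" for n
  proof -
    have "norm (g n) = \<bar>h\<bar> ^ n * norm (op_power X n) * (1 / fact (n + 2))"
      by (simp add: g_def power_abs)
    also have "\<dots> \<le> \<bar>h\<bar> ^ n * norm X ^ n * (1 / fact n)"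
      by (intro mult_mono norm_op_power frac_le fact_mono) auto
    finally show ?thesis
      by (simp add: power_mult_distrib field_simps)
  qed
  have exps: "(\<lambda>n. (\<bar>h\<bar> * norm X) ^ n /\<^sub>R fact n) sums exp (\<bar>h\<bar> * norm X)"
    by (rule exp_converges)
  have sn: "summable (\<lambda>n. norm (g n))"
    by (rule summable_comparison_test' [OF sums_summable [OF exps], of 0]) (use le in auto)
  then have s: "summable g" by (rule summable_norm_cancel)
  define G where "G = suminf g"
  have "norm G \<le> (\<Sum>n. norm (g n))"
    unfolding G_def by (rule summable_norm [OF sn])
  also have "\<dots> \<le> exp (\<bar>h\<bar> * norm X)"
    using suminf_le [OF le sn sums_summable [OF exps]] sums_unique [OF exps] by simp
  finally have nG: "norm G \<le> exp (\<bar>h\<bar> * norm X)" .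
  have cG: "clinear G"
    using summable_LIMSEQ [OF s] unfolding G_def
    by (rule clinear_tendsto [rotated]) (use X in \<open>simp add: g_def\<close>)
  have "(\<lambda>n. h\<^sup>2 *\<^sub>R (X o\<^sub>L (g n o\<^sub>L X))) sums (h\<^sup>2 *\<^sub>R (X o\<^sub>L (G o\<^sub>L X)))"
    unfolding G_def
    by (intro bounded_linear.sums [OF bounded_linear_scaleR_right]
        bounded_linear.sums [OF bounded_bilinear.bounded_linear_right [OF bounded_bilinear_blinfun_compose]]
        bounded_linear.sums [OF bounded_bilinear.bounded_linear_left [OF bounded_bilinear_blinfun_compose]]
        summable_sums s)
  moreover have "h\<^sup>2 *\<^sub>R (X o\<^sub>L (g n o\<^sub>L X)) = (h ^ (n + 2) / fact (n + 2)) *\<^sub>R op_power X (n + 2)" for n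
    by (simp add: g_def blinfun_compose_simps op_power_commute power2_eq_square mult_ac)
  ultimately have "(\<lambda>n. (h ^ (n + 2) / fact (n + 2)) *\<^sub>R op_power X (n + 2)) sums (h\<^sup>2 *\<^sub>R (X o\<^sub>L (G o\<^sub>L X)))"
    by simp
  then have "(\<lambda>n. (h ^ n / fact n) *\<^sub>R op_power X n) sums
      (h\<^sup>2 *\<^sub>R (X o\<^sub>L (G o\<^sub>L X)) + (\<Sum>i<2. (h ^ i / fact i) *\<^sub>R op_power X i))"
    by (subst (asm) sums_iff_shift)
  then have "exp_op (h *\<^sub>R X) = h\<^sup>2 *\<^sub>R (X o\<^sub>L (G o\<^sub>L X)) + (id_blinfun + h *\<^sub>R X)"
    using exp_path_sums [of h X] sums_unique2 by (force simp: numeral_2_eq_2 blinfun_compose_simps)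
  then show ?thesis
    using that [OF cG nG] by simp
qed

lemma scaleR_eq_scaleC_op: "r *\<^sub>R T = scaleC_op (of_real r) T" for T :: "'a::chilbert_space \<Rightarrow>\<^sub>L 'a"
  by (rule blinfun_eqI) (simp add: blinfun.scaleR_left scaleR_scaleC [where 'a = 'a])

lemma hilbert_schmidt_scaleR: "hilbert_schmidt T \<Longrightarrow> hilbert_schmidt (r *\<^sub>R T)"
  by (simp add: scaleR_eq_scaleC_op hilbert_schmidt_scaleC)

lemma hs_norm_scaleR: "hs_norm (r *\<^sub>R T) = \<bar>r\<bar> * hs_norm T"
  by (simp add: scaleR_eq_scaleC_op hs_norm_scaleC)

lemma trace_bound_scaleR: "trace_bound T c \<Longrightarrow> trace_bound (r *\<^sub>R T) (\<bar>r\<bar> * c)"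
  using trace_bound_scaleC [of T c "of_real r"] by (simp add: scaleR_eq_scaleC_op)

lemma exp_path_taylor_hs:
  assumes X: "hilbert_schmidt X"
  shows "hilbert_schmidt (exp_op (h *\<^sub>R X) - id_blinfun - h *\<^sub>R X)"
    and "hs_norm (exp_op (h *\<^sub>R X) - id_blinfun - h *\<^sub>R X) \<le> h\<^sup>2 * (norm X * (exp (\<bar>h\<bar> * norm X) * hs_norm X))"
    and "trace_bound (exp_op (h *\<^sub>R X) - id_blinfun - h *\<^sub>R X) (h\<^sup>2 * (exp (\<bar>h\<bar> * norm X) * (hs_norm X)\<^sup>2))"
proof -
  obtain G where G: "clinear G" "norm G \<le> exp (\<bar>h\<bar> * norm X)"
    "exp_op (h *\<^sub>R X) - id_blinfun - h *\<^sub>R X = h\<^sup>2 *\<^sub>R (X o\<^sub>L (G o\<^sub>L X))"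
    by (rule exp_path_taylor [OF hilbert_schmidt_clinear [OF X]]) blast
  have GX: "hilbert_schmidt (G o\<^sub>L X)" "hs_norm (G o\<^sub>L X) \<le> exp (\<bar>h\<bar> * norm X) * hs_norm X"
    using hilbert_schmidt_compose_left [OF G(1) X] mult_right_mono [OF G(2) hs_norm_nonneg [of X]] by auto
  have XGX: "hilbert_schmidt (X o\<^sub>L (G o\<^sub>L X))" "hs_norm (X o\<^sub>L (G o\<^sub>L X)) \<le> norm X * (exp (\<bar>h\<bar> * norm X) * hs_norm X)"
    using hilbert_schmidt_compose_left [OF hilbert_schmidt_clinear [OF X] GX(1)]
      mult_left_mono [OF GX(2) norm_ge_zero [of X]] by auto
  show "hilbert_schmidt (exp_op (h *\<^sub>R X) - id_blinfun - h *\<^sub>R X)"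
    unfolding G(3) by (rule hilbert_schmidt_scaleR [OF XGX(1)])
  show "hs_norm (exp_op (h *\<^sub>R X) - id_blinfun - h *\<^sub>R X) \<le> h\<^sup>2 * (norm X * (exp (\<bar>h\<bar> * norm X) * hs_norm X))"
    unfolding G(3) hs_norm_scaleR using XGX(2) by (simp add: mult_left_mono)
  have "hs_norm X * hs_norm (G o\<^sub>L X) \<le> exp (\<bar>h\<bar> * norm X) * (hs_norm X)\<^sup>2"
    using mult_left_mono [OF GX(2) hs_norm_nonneg [of X]] by (simp add: power2_eq_square mult_ac)
  then have "trace_bound (X o\<^sub>L (G o\<^sub>L X)) (exp (\<bar>h\<bar> * norm X) * (hs_norm X)\<^sup>2)"
    by (rule trace_bound.compose [OF X GX(1)])
  from trace_bound_scaleR [OF this, of "h\<^sup>2"]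
  show "trace_bound (exp_op (h *\<^sub>R X) - id_blinfun - h *\<^sub>R X) (h\<^sup>2 * (exp (\<bar>h\<bar> * norm X) * (hs_norm X)\<^sup>2))"
    unfolding G(3) by simp
qed

text \<open>The group law splits off one step at a time, and the unitary factors do not increase
  Hilbert-Schmidt norms, so the errors merely add.\<close>

lemma exp_path_diff_multiple:
  assumes X: "skew_op X" and Y: "skew_op Y"
    and hs: "hilbert_schmidt (exp_op (t *\<^sub>R X) - exp_op (t *\<^sub>R Y))"
  shows "hilbert_schmidt (exp_op ((real n * t) *\<^sub>R X) - exp_op ((real n * t) *\<^sub>R Y)) \<and>
    hs_norm (exp_op ((real n * t) *\<^sub>R X) - exp_op ((real n * t) *\<^sub>R Y))
      \<le> real n * hs_norm (exp_op (t *\<^sub>R X) - exp_op (t *\<^sub>R Y))"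
proof (induction n)
  case (Suc n)
  let ?D = "exp_op (t *\<^sub>R X) - exp_op (t *\<^sub>R Y)"
  let ?E = "exp_op ((real n * t) *\<^sub>R X) - exp_op ((real n * t) *\<^sub>R Y)"
  note UX = unitary_exp_path [OF X] and UY = unitary_exp_path [OF Y]
  have split: "exp_op ((real (Suc n) * t) *\<^sub>R Z) = exp_op ((real n * t) *\<^sub>R Z) o\<^sub>L exp_op (t *\<^sub>R Z)"
    for Z :: "'a \<Rightarrow>\<^sub>L 'a"
    using exp_path_add [of "real n * t" t Z] by (simp add: distrib_right add.commute)
  have eq: "exp_op ((real (Suc n) * t) *\<^sub>R X) - exp_op ((real (Suc n) * t) *\<^sub>R Y)
      = (exp_op ((real n * t) *\<^sub>R X) o\<^sub>L ?D) + (?E o\<^sub>L exp_op (t *\<^sub>R Y))"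
    unfolding split blinfun_compose_simps by simp
  have 1: "hilbert_schmidt (exp_op ((real n * t) *\<^sub>R X) o\<^sub>L ?D)" "hs_norm (exp_op ((real n * t) *\<^sub>R X) o\<^sub>L ?D) \<le> hs_norm ?D"
    using hilbert_schmidt_compose_left [OF unitary_op_clinear [OF UX] hs, of "real n * t"]
      mult_right_mono [OF unitary_op_norm_le [OF UX] hs_norm_nonneg, of "real n * t" ?D] by auto
  have 2: "hilbert_schmidt (?E o\<^sub>L exp_op (t *\<^sub>R Y))" "hs_norm (?E o\<^sub>L exp_op (t *\<^sub>R Y)) \<le> hs_norm ?E"
    using hilbert_schmidt_compose_right [OF unitary_op_clinear [OF UY] conjunct1 [OF Suc], of t]
      mult_right_mono [OF unitary_op_norm_le [OF UY] hs_norm_nonneg, of t ?E] by auto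
  show ?case
    unfolding eq using hilbert_schmidt_add [OF 1(1) 2(1)] hs_norm_triangle [OF 1(1) 2(1)] 1(2) 2(2) Suc
    by (simp add: distrib_right)
qed simp

text \<open>A direct series estimate would leave an exponential factor. Cutting \<open>s\<close>
  into many steps makes the quadratic errors negligible and leaves the constant one, on which the
  final constant depends.\<close>

lemma exp_path_diff_hs:
  assumes X: "skew_op X" "hilbert_schmidt X" and Y: "skew_op Y" "hilbert_schmidt Y"
  shows "hilbert_schmidt (exp_op (s *\<^sub>R X) - exp_op (s *\<^sub>R Y))"
    and "hs_norm (exp_op (s *\<^sub>R X) - exp_op (s *\<^sub>R Y)) \<le> \<bar>s\<bar> * hs_norm (X - Y)"
proof -
  define C where "C = norm X * (exp (\<bar>s\<bar> * norm X) * hs_norm X) + norm Y * (exp (\<bar>s\<bar> * norm Y) * hs_norm Y)"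
  have step: "hilbert_schmidt (exp_op (t *\<^sub>R X) - exp_op (t *\<^sub>R Y)) \<and>
      hs_norm (exp_op (t *\<^sub>R X) - exp_op (t *\<^sub>R Y)) \<le> \<bar>t\<bar> * hs_norm (X - Y) + t\<^sup>2 * C" if t: "\<bar>t\<bar> \<le> \<bar>s\<bar>" for t
  proof -
    let ?RX = "exp_op (t *\<^sub>R X) - id_blinfun - t *\<^sub>R X" and ?RY = "exp_op (t *\<^sub>R Y) - id_blinfun - t *\<^sub>R Y"
    have eq: "exp_op (t *\<^sub>R X) - exp_op (t *\<^sub>R Y) = t *\<^sub>R (X - Y) + (?RX - ?RY)"
      by (simp add: scaleR_diff_right)
    note hX = exp_path_taylor_hs(1,2) [OF X(2), of t] and hY = exp_path_taylor_hs(1,2) [OF Y(2), of t]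
    have XY: "hilbert_schmidt (t *\<^sub>R (X - Y))"
      by (intro hilbert_schmidt_scaleR hilbert_schmidt_diff X Y)
    have mono: "t\<^sup>2 * (norm Z * (exp (\<bar>t\<bar> * norm Z) * hs_norm Z)) \<le> t\<^sup>2 * (norm Z * (exp (\<bar>s\<bar> * norm Z) * hs_norm Z))"
      for Z :: "'a \<Rightarrow>\<^sub>L 'a"
      using t by (intro mult_left_mono mult_right_mono) (auto intro: mult_right_mono)
    have "hs_norm (?RX - ?RY) \<le> t\<^sup>2 * C"
      using hs_norm_diff_le [OF hX(1) hY(1)] hX(2) hY(2) mono [of X] mono [of Y]
      by (simp add: C_def distrib_left)
    then show ?thesis
      unfolding eq
      using hilbert_schmidt_add [OF XY hilbert_schmidt_diff [OF hX(1) hY(1)]]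
        hs_norm_triangle [OF XY hilbert_schmidt_diff [OF hX(1) hY(1)]]
      by (simp add: hs_norm_scaleR)
  qed
  show "hilbert_schmidt (exp_op (s *\<^sub>R X) - exp_op (s *\<^sub>R Y))"
    using step [of s] by simp
  have "hs_norm (exp_op (s *\<^sub>R X) - exp_op (s *\<^sub>R Y)) \<le> \<bar>s\<bar> * hs_norm (X - Y) + s\<^sup>2 * C * inverse (real (Suc n))" for n
  proof -
    \<comment> \<open>There are \<open>Suc n\<close> steps, each with error \<open>t^2 C\<close>, so
      the total error is \<open>s^2 C / Suc n\<close>.\<close>
    define t where "t = s / real (Suc n)"
    have ts: "real (Suc n) * t = s" by (simp add: t_def)
    have "\<bar>t\<bar> \<le> \<bar>s\<bar>"
      by (simp add: t_def divide_le_eq mult_le_cancel_left1)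
    note st = step [OF this]
    have "hs_norm (exp_op (s *\<^sub>R X) - exp_op (s *\<^sub>R Y)) \<le> real (Suc n) * hs_norm (exp_op (t *\<^sub>R X) - exp_op (t *\<^sub>R Y))"
      using exp_path_diff_multiple [OF X(1) Y(1) conjunct1 [OF st], of "Suc n"] unfolding ts by blast
    also have "\<dots> \<le> real (Suc n) * (\<bar>t\<bar> * hs_norm (X - Y) + t\<^sup>2 * C)"
      using st by (intro mult_left_mono) auto
    also have "\<dots> = \<bar>s\<bar> * hs_norm (X - Y) + s\<^sup>2 * C * inverse (real (Suc n))"
      unfolding ts [symmetric] by (simp add: abs_mult power2_eq_square field_simps del: of_nat_Suc)
    finally show ?thesis .
  qed
  moreover have "(\<lambda>n. \<bar>s\<bar> * hs_norm (X - Y) + s\<^sup>2 * C * inverse (real (Suc n))) \<longlonglongrightarrow> \<bar>s\<bar> * hs_norm (X - Y) + s\<^sup>2 * C * 0"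
    by (intro tendsto_intros LIMSEQ_inverse_real_of_nat)
  ultimately show "hs_norm (exp_op (s *\<^sub>R X) - exp_op (s *\<^sub>R Y)) \<le> \<bar>s\<bar> * hs_norm (X - Y)"
    using LIMSEQ_le_const [of _ "\<bar>s\<bar> * hs_norm (X - Y)"] by fastforce
qed

section \<open>Integer powers of unitary operators\<close>

lemma inv_op_unitary:
  assumes "unitary_op V"
  shows "inv_op V = adj V"
  unfolding inv_op_def
proof (rule the_equality)
  show "adj V o\<^sub>L V = id_blinfun \<and> V o\<^sub>L adj V = id_blinfun"
    using assms by (simp add: unitary_op_def)
  fix S assume S: "S o\<^sub>L V = id_blinfun \<and> V o\<^sub>L S = id_blinfun"
  have "S = S o\<^sub>L (V o\<^sub>L adj V)"
    using assms by (simp add: unitary_op_def blinfun_compose_simps)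
  also have "\<dots> = (S o\<^sub>L V) o\<^sub>L adj V"
    by (simp add: blinfun_compose_assoc)
  finally show "S = adj V"
    using S by (simp add: blinfun_compose_simps)
qed

lemma op_powi_0 [simp]: "op_powi V 0 = id_blinfun"
  by (simp add: op_powi_def)

lemma unitary_cancel:
  assumes "unitary_op V"
  shows "(T o\<^sub>L V) o\<^sub>L adj V = T" "(T o\<^sub>L adj V) o\<^sub>L V = T"
  using assms by (simp_all add: blinfun_compose_assoc unitary_op_def blinfun_compose_simps)

lemma op_powi_succ:
  assumes V: "unitary_op V"
  shows "op_powi V (r + 1) = op_powi V r o\<^sub>L V"
proof (cases "r \<ge> 0")
  case True
  then have "nat (r + 1) = Suc (nat r)" by simp
  then show ?thesis
    using True by (simp add: op_powi_def op_power_commute)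
next
  case False
  then obtain k where k: "r = - int (Suc k)"
    by (metis int_cases not_le of_nat_less_0_iff)
  have "op_powi V (r + 1) = op_power (adj V) k"
    by (cases k) (auto simp: op_powi_def k inv_op_unitary [OF V] nat_add_distrib)
  moreover have "op_powi V r = op_power (adj V) k o\<^sub>L adj V"
    using k by (simp add: op_powi_def inv_op_unitary [OF V] op_power_commute nat_add_distrib)
  ultimately show ?thesis
    by (simp add: unitary_cancel V)
qed

lemma op_powi_pred: "unitary_op V \<Longrightarrow> op_powi V (r - 1) = op_powi V r o\<^sub>L adj V"
  using op_powi_succ [of V "r - 1"] by (simp add: unitary_cancel)

lemma op_powi_1: "unitary_op V \<Longrightarrow> op_powi V 1 = V"
  using op_powi_succ [of V 0] by (simp add: blinfun_compose_simps)

lemma op_powi_add: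
  assumes V: "unitary_op V"
  shows "op_powi V (m + n) = op_powi V m o\<^sub>L op_powi V n"
proof (induction n rule: int_induct [of _ 0])
  case base
  show ?case by (simp add: blinfun_compose_simps)
next
  case (step1 i)
  then show ?case
    using op_powi_succ [OF V, of "m + i"] op_powi_succ [OF V, of i]
    by (simp add: blinfun_compose_assoc add.assoc)
next
  case (step2 i)
  then show ?case
    using op_powi_pred [OF V, of "m + i"] op_powi_pred [OF V, of i]
    by (simp add: blinfun_compose_assoc diff_add_eq add_diff_eq)
qed

lemma unitary_op_powi:
  assumes V: "unitary_op V"
  shows "unitary_op (op_powi V n)"
proof (induction n rule: int_induct [of _ 0])
  case base
  show ?case by (simp add: unitary_op_id)
next
  case (step1 i)
  then show ?case
    by (simp add: op_powi_succ V unitary_op_compose)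
next
  case (step2 i)
  then show ?case
    by (simp add: op_powi_pred V unitary_op_compose unitary_op_adj)
qed

text \<open>The sum over \<open>0 \<le> j < n\<close>, continued to negative \<open>n\<close> so that it still telescopes.\<close>

definition isum :: "int \<Rightarrow> (int \<Rightarrow> 'b::ab_group_add) \<Rightarrow> 'b" where
  "isum n g = sum g {0..<n} - sum g {n..<0}"

lemma isum_0 [simp]: "isum 0 g = 0"
  by (simp add: isum_def)

lemma isum_succ: "isum (n + 1) g = isum n g + g n"
proof (cases "n \<ge> 0")
  case True
  then have "{0..<n + 1} = insert n {0..<n}" by auto
  then show ?thesis using True by (simp add: isum_def)
next
  case False
  then have "{n..<0} = insert n {n + 1..<0}" by auto
  then show ?thesis using False by (simp add: isum_def)
qed

lemma isum_pred: "isum (n - 1) g = isum n g - g (n - 1)"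
  using isum_succ [of "n - 1" g] by simp

lemma isum_telescope: "isum n (\<lambda>j. G (j + 1) - G j) = G n - G 0"
  by (induction n rule: int_induct [of _ 0]) (simp_all add: isum_succ isum_pred)

lemma isum_const: "isum n (\<lambda>_. c) = of_int n * (c :: complex)"
  by (induction n rule: int_induct [of _ 0]) (simp_all add: isum_succ isum_pred algebra_simps)

lemma isum_diff: "isum n (\<lambda>j. f j - g j) = isum n f - isum n g"
  by (simp add: isum_def sum_subtractf)

lemma isum_scaleR: "isum n (\<lambda>j. r *\<^sub>R f j) = r *\<^sub>R isum n (f :: int \<Rightarrow> 'b::real_vector)"
  unfolding isum_def scaleR_diff_right scaleR_sum_right ..

lemma isum_compose_right: "isum n (\<lambda>j. f j o\<^sub>L T) = isum n f o\<^sub>L T"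
  by (simp add: isum_def blinfun_compose_simps bounded_bilinear.sum_left [OF bounded_bilinear_blinfun_compose])

text \<open>Telescopes \<open>op_powi U j o\<^sub>L op_powi V (n - j)\<close> in \<open>j\<close>.
  Besides giving Hilbert-Schmidt bounds, the terms have the form \<open>U^a D V^b\<close> on which
  the multiplier bound acts.\<close>

lemma powi_diff_isum:
  assumes U: "unitary_op U" and V: "unitary_op V"
  shows "op_powi U n - op_powi V n = isum n (\<lambda>j. op_powi U j o\<^sub>L ((U - V) o\<^sub>L op_powi V (n - 1 - j)))"
proof -
  define G where "G = (\<lambda>j. op_powi U j o\<^sub>L op_powi V (n - j))"
  have "G (j + 1) - G j = op_powi U j o\<^sub>L ((U - V) o\<^sub>L op_powi V (n - 1 - j))" for j
  proof -
    have "op_powi V (n - j) = V o\<^sub>L op_powi V (n - 1 - j)"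
      using op_powi_add [OF V, of 1 "n - 1 - j"] by (simp add: op_powi_1 V)
    moreover have "n - (j + 1) = n - 1 - j" by simp
    ultimately show ?thesis
      unfolding G_def op_powi_succ [OF U] by (simp only: blinfun_compose_assoc blinfun_compose_simps)
  qed
  then have "isum n (\<lambda>j. op_powi U j o\<^sub>L ((U - V) o\<^sub>L op_powi V (n - 1 - j))) = G n - G 0"
    using isum_telescope [of n G] by simp
  then show ?thesis
    by (simp add: G_def blinfun_compose_simps)
qed

lemma powi_diff_hs:
  assumes U: "unitary_op U" and V: "unitary_op V" and hs: "hilbert_schmidt (U - V)"
  shows "hilbert_schmidt (op_powi U n - op_powi V n)"
    and "hs_norm (op_powi U n - op_powi V n) \<le> \<bar>real_of_int n\<bar> * hs_norm (U - V)"
proof -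
  let ?g = "\<lambda>j. op_powi U j o\<^sub>L ((U - V) o\<^sub>L op_powi V (n - 1 - j))"
  have V': "hilbert_schmidt ((U - V) o\<^sub>L op_powi V j)" "hs_norm ((U - V) o\<^sub>L op_powi V j) \<le> hs_norm (U - V)" for j
    using hilbert_schmidt_compose_right [OF unitary_op_clinear [OF unitary_op_powi [OF V]] hs, of j]
      mult_right_mono [OF unitary_op_norm_le [OF unitary_op_powi [OF V]] hs_norm_nonneg, of j "U - V"] by auto
  have g: "hilbert_schmidt (?g j)" "hs_norm (?g j) \<le> hs_norm (U - V)" for j
    using hilbert_schmidt_compose_left [OF unitary_op_clinear [OF unitary_op_powi [OF U]] V'(1), of j "n - 1 - j"]
      mult_right_mono [OF unitary_op_norm_le [OF unitary_op_powi [OF U]] hs_norm_nonneg, of j "(U - V) o\<^sub>L op_powi V (n - 1 - j)"]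
      V'(2) [of "n - 1 - j"] by auto
  show "hilbert_schmidt (op_powi U n - op_powi V n)"
    unfolding powi_diff_isum [OF U V] isum_def by (intro hilbert_schmidt_diff hilbert_schmidt_sum g)
  have s: "hs_norm (sum ?g I) \<le> real (card I) * hs_norm (U - V)" for I
    using hs_norm_sum_le [of I ?g] sum_mono [of I "\<lambda>j. hs_norm (?g j)" "\<lambda>_. hs_norm (U - V)"] g by fastforce
  have "hs_norm (op_powi U n - op_powi V n) \<le> hs_norm (sum ?g {0..<n}) + hs_norm (sum ?g {n..<0})"
    unfolding powi_diff_isum [OF U V] isum_def by (intro hs_norm_diff_le hilbert_schmidt_sum g)
  also have "\<dots> \<le> real (card {0..<n}) * hs_norm (U - V) + real (card {n..<0}) * hs_norm (U - V)"
    by (intro add_mono s)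
  also have "\<dots> = \<bar>real_of_int n\<bar> * hs_norm (U - V)"
    by (cases "n \<ge> 0") auto
  finally show "hs_norm (op_powi U n - op_powi V n) \<le> \<bar>real_of_int n\<bar> * hs_norm (U - V)" .
qed

text \<open>The product rule derivative at \<open>s = 0\<close> of the \<open>n\<close>-th power of
  \<open>exp (s X) V\<close>; \<open>isum\<close> lets one formula serve negative
  \<open>n\<close>.\<close>

definition dpow :: "('a::chilbert_space \<Rightarrow>\<^sub>L 'a) \<Rightarrow> ('a \<Rightarrow>\<^sub>L 'a) \<Rightarrow> int \<Rightarrow> 'a \<Rightarrow>\<^sub>L 'a" where
  "dpow X V n = isum n (\<lambda>j. op_powi V j o\<^sub>L (X o\<^sub>L op_powi V (n - j)))"

text \<open>Induction on \<open>n\<close> in both directions. Downwards the inverse factor is the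
  adjoint of the path, whose derivative comes from \<open>exp (- s X)\<close>.\<close>

lemma op_powi_path_has_vector_derivative:
  assumes X: "skew_op X" and V: "unitary_op V"
  shows "((\<lambda>s. op_powi (exp_op (s *\<^sub>R X) o\<^sub>L V) n) has_vector_derivative dpow X V n) (at 0)"
proof (induction n rule: int_induct [of _ 0])
  case base
  show ?case by (simp add: dpow_def)
next
  case (step1 i)
  have "((\<lambda>s. exp_op (s *\<^sub>R X) o\<^sub>L V) has_vector_derivative (X o\<^sub>L V)) (at 0)"
    using bounded_linear.has_vector_derivative [OF bounded_bilinear.bounded_linear_left
        [OF bounded_bilinear_blinfun_compose] exp_path_has_vector_derivative [of X 0], of V]
    by (simp add: blinfun_compose_simps)
  from bounded_bilinear.has_vector_derivative [OF bounded_bilinear_blinfun_compose step1(2) this]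
  have "((\<lambda>s. op_powi (exp_op (s *\<^sub>R X) o\<^sub>L V) i o\<^sub>L (exp_op (s *\<^sub>R X) o\<^sub>L V)) has_vector_derivative
      (op_powi V i o\<^sub>L (X o\<^sub>L V)) + (dpow X V i o\<^sub>L V)) (at 0)"
    by (simp add: blinfun_compose_simps)
  moreover have "(op_powi V i o\<^sub>L (X o\<^sub>L V)) + (dpow X V i o\<^sub>L V) = dpow X V (i + 1)"
  proof -
    have "op_powi V j o\<^sub>L (X o\<^sub>L op_powi V (i + 1 - j)) = (op_powi V j o\<^sub>L (X o\<^sub>L op_powi V (i - j))) o\<^sub>L V" for j
      using op_powi_succ [OF V, of "i - j"] by (simp add: blinfun_compose_assoc algebra_simps)
    then have 1: "isum i (\<lambda>j. op_powi V j o\<^sub>L (X o\<^sub>L op_powi V (i + 1 - j))) = dpow X V i o\<^sub>L V"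
      by (simp only: dpow_def isum_compose_right)
    have "dpow X V (i + 1) = (dpow X V i o\<^sub>L V) + (op_powi V i o\<^sub>L (X o\<^sub>L op_powi V (i + 1 - i)))"
      unfolding 1 [symmetric] by (simp only: dpow_def isum_succ)
    then show ?thesis
      by (simp add: op_powi_1 V)
  qed
  ultimately show ?case
    using X V by (simp add: op_powi_succ unitary_op_compose unitary_exp_path)
next
  case (step2 i)
  have "((\<lambda>s. - s) has_vector_derivative (- 1)) (at (0::real))"
    by (auto intro!: derivative_eq_intros)
  from vector_diff_chain_at [OF this exp_path_has_vector_derivative [of X "- 0"]]
  have "((\<lambda>s. exp_op (- s *\<^sub>R X)) has_vector_derivative (- X)) (at 0)"
    by (simp add: o_def blinfun_compose_simps)
  from bounded_linear.has_vector_derivative [OF bounded_bilinear.bounded_linear_right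
        [OF bounded_bilinear_blinfun_compose] this, of "adj V"]
  have "((\<lambda>s. adj (exp_op (s *\<^sub>R X) o\<^sub>L V)) has_vector_derivative (adj V o\<^sub>L (- X))) (at 0)"
    using X V by (simp add: adj_compose adj_exp_path)
  from bounded_bilinear.has_vector_derivative [OF bounded_bilinear_blinfun_compose step2(2) this]
  have "((\<lambda>s. op_powi (exp_op (s *\<^sub>R X) o\<^sub>L V) i o\<^sub>L adj (exp_op (s *\<^sub>R X) o\<^sub>L V)) has_vector_derivative
      (op_powi V i o\<^sub>L (adj V o\<^sub>L (- X))) + (dpow X V i o\<^sub>L adj V)) (at 0)"
    by (simp add: blinfun_compose_simps)
  moreover have "(op_powi V i o\<^sub>L (adj V o\<^sub>L (- X))) + (dpow X V i o\<^sub>L adj V) = dpow X V (i - 1)"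
  proof -
    have "op_powi V j o\<^sub>L (X o\<^sub>L op_powi V (i - 1 - j)) = (op_powi V j o\<^sub>L (X o\<^sub>L op_powi V (i - j))) o\<^sub>L adj V" for j
      using op_powi_pred [OF V, of "i - j"] by (simp add: blinfun_compose_assoc algebra_simps)
    then have 1: "isum i (\<lambda>j. op_powi V j o\<^sub>L (X o\<^sub>L op_powi V (i - 1 - j))) = dpow X V i o\<^sub>L adj V"
      by (simp only: dpow_def isum_compose_right)
    have "dpow X V (i - 1) = (dpow X V i o\<^sub>L adj V) - (op_powi V (i - 1) o\<^sub>L (X o\<^sub>L op_powi V (i - 1 - (i - 1))))"
      unfolding 1 [symmetric] by (simp only: dpow_def isum_pred)
    then show ?thesis
      by (simp add: op_powi_pred V blinfun_compose_simps blinfun_compose_assoc)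
  qed
  ultimately show ?case
    using X V by (simp add: op_powi_pred unitary_op_compose unitary_exp_path)
qed

section \<open>The Taylor remainder is of trace class\<close>

lemma trace_bound_isum:
  "(\<And>j. trace_bound (f j) (c j)) \<Longrightarrow> trace_bound (isum n f) (sum c {0..<n} + sum c {n..<0})"
  unfolding isum_def by (intro trace_bound_diff trace_bound_sum)

lemma trace_op_isum:
  assumes "\<And>j. trace_bound (f j) (c j)"
  shows "trace_op (isum n f) = isum n (\<lambda>j. trace_op (f j))"
  unfolding isum_def
  using trace_op_diff [OF trace_bound_sum trace_bound_sum, of "{0..<n}" f c "{n..<0}" f c] assms
  by (simp add: trace_op_sum [of _ f c])

text \<open>The rule \<open>compose\<close> allows slack, so the zero operator can carry the
  difference \<open>d - c\<close>.\<close>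

lemma trace_bound_mono: "trace_bound T c \<Longrightarrow> c \<le> d \<Longrightarrow> trace_bound T d"
  using trace_bound.add [of T c 0 "d - c"] trace_bound.compose [of 0 0 "d - c"] by simp

text \<open>The step \<open>h\<close> and the base point \<open>V\<close> are both free, because the
  trace on \<open>[0, s]\<close> is differentiated by restarting the path at the point reached at
  time \<open>s\<close>.\<close>

definition path_remainder :: "('a::chilbert_space \<Rightarrow>\<^sub>L 'a) \<Rightarrow> ('a \<Rightarrow>\<^sub>L 'a) \<Rightarrow> real \<Rightarrow> int \<Rightarrow> 'a \<Rightarrow>\<^sub>L 'a" where
  "path_remainder X V h n = op_powi (exp_op (h *\<^sub>R X) o\<^sub>L V) n - op_powi V n - h *\<^sub>R dpow X V n"

text \<open>The \<open>j\<close>-th telescoped term costs \<open>\<bar>j\<bar>\<close> for the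
  difference of \<open>j\<close>-th powers and one for the remainder of the exponential.\<close>

definition remainder_const :: "int \<Rightarrow> real" where
  "remainder_const n = (\<Sum>j\<in>{0..<n}. \<bar>real_of_int j\<bar> + 1) + (\<Sum>j\<in>{n..<0}. \<bar>real_of_int j\<bar> + 1)"

lemma exp_path_minus_id_hs:
  assumes X: "skew_op X" "hilbert_schmidt X"
  shows "hilbert_schmidt (exp_op (h *\<^sub>R X) - id_blinfun)"
    and "hs_norm (exp_op (h *\<^sub>R X) - id_blinfun) \<le> \<bar>h\<bar> * hs_norm X"
  using exp_path_diff_hs [OF X, of 0 h] by (simp_all add: skew_op_def)

lemma path_diff_hs:
  assumes X: "skew_op X" "hilbert_schmidt X" and V: "unitary_op V"
  shows "hilbert_schmidt ((exp_op (h *\<^sub>R X) o\<^sub>L V) - V)"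
    and "hs_norm ((exp_op (h *\<^sub>R X) o\<^sub>L V) - V) \<le> \<bar>h\<bar> * hs_norm X"
proof -
  have eq: "(exp_op (h *\<^sub>R X) o\<^sub>L V) - V = (exp_op (h *\<^sub>R X) - id_blinfun) o\<^sub>L V"
    by (simp add: blinfun_compose_simps)
  note E = exp_path_minus_id_hs [OF X, of h]
  show "hilbert_schmidt ((exp_op (h *\<^sub>R X) o\<^sub>L V) - V)"
    unfolding eq by (intro hilbert_schmidt_compose_right E) (simp add: V)
  have "hs_norm ((exp_op (h *\<^sub>R X) - id_blinfun) o\<^sub>L V) \<le> norm V * hs_norm (exp_op (h *\<^sub>R X) - id_blinfun)"
    by (intro hilbert_schmidt_compose_right E) (simp add: V)
  also have "\<dots> \<le> 1 * (\<bar>h\<bar> * hs_norm X)"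
    by (intro mult_mono unitary_op_norm_le V E) auto
  finally show "hs_norm ((exp_op (h *\<^sub>R X) o\<^sub>L V) - V) \<le> \<bar>h\<bar> * hs_norm X"
    unfolding eq by simp
qed

text \<open>Only differences of first order in \<open>h\<close> are available in Hilbert-Schmidt
  norm, so second order in trace norm has to come from pairing two of them, or from the second order
  remainder of the exponential.\<close>

lemma path_remainder_trace_bound:
  assumes X: "skew_op X" "hilbert_schmidt X" and V: "unitary_op V"
  shows "trace_bound (path_remainder X V h n)
    (h\<^sup>2 * (exp (\<bar>h\<bar> * norm X) * (hs_norm X)\<^sup>2) * remainder_const n)"
proof -
  define E where "E = exp_op (h *\<^sub>R X)"
  define U where "U = E o\<^sub>L V"
  have U: "unitary_op U"
    unfolding U_def E_def by (intro unitary_op_compose unitary_exp_path X V)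
  define b where "b = h\<^sup>2 * (exp (\<bar>h\<bar> * norm X) * (hs_norm X)\<^sup>2)"
  \<comment> \<open>Replacing \<open>U^j\<close> by \<open>V^j\<close> in the telescoped term leaves
    \<open>(U^j - V^j)(U - V)\<close>, a product of two small Hilbert-Schmidt factors; what remains
    after subtracting the derivative contains \<open>E - 1 - h X\<close>.\<close>
  define g where "g = (\<lambda>j. ((op_powi U j - op_powi V j) o\<^sub>L ((U - V) o\<^sub>L op_powi V (n - 1 - j))) +
      (op_powi V j o\<^sub>L ((E - id_blinfun - h *\<^sub>R X) o\<^sub>L op_powi V (n - j))))"
  have "path_remainder X V h n = isum n g"
  proof -
    have "(op_powi U j o\<^sub>L ((U - V) o\<^sub>L op_powi V (n - 1 - j))) - h *\<^sub>R (op_powi V j o\<^sub>L (X o\<^sub>L op_powi V (n - j))) = g j" for j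
    proof -
      have "op_powi V (n - j) = V o\<^sub>L op_powi V (n - 1 - j)"
        using op_powi_add [OF V, of 1 "n - 1 - j"] by (simp add: op_powi_1 V)
      then show ?thesis
        by (simp add: g_def U_def blinfun_compose_simps blinfun_compose_assoc)
    qed
    then show ?thesis
      unfolding path_remainder_def dpow_def U_def [unfolded E_def, symmetric] powi_diff_isum [OF U V]
      by (simp flip: isum_scaleR isum_diff)
  qed
  moreover have "trace_bound (g j) (b * (\<bar>real_of_int j\<bar> + 1))" for j
  proof -
    note D = path_diff_hs [OF X V, of h, folded E_def, folded U_def]
    have 1: "hilbert_schmidt ((U - V) o\<^sub>L op_powi V (n - 1 - j))"
      "hs_norm ((U - V) o\<^sub>L op_powi V (n - 1 - j)) \<le> 1 * hs_norm (U - V)"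
      using hilbert_schmidt_compose_right [OF unitary_op_clinear [OF unitary_op_powi [OF V]] D(1), of "n - 1 - j"]
        mult_right_mono [OF unitary_op_norm_le [OF unitary_op_powi [OF V]] hs_norm_nonneg, of "n - 1 - j" "U - V"] by auto
    have "hs_norm (op_powi U j - op_powi V j) * hs_norm ((U - V) o\<^sub>L op_powi V (n - 1 - j))
        \<le> (\<bar>real_of_int j\<bar> * hs_norm (U - V)) * (1 * hs_norm (U - V))"
      by (intro mult_mono powi_diff_hs U V D 1) auto
    also have "\<dots> \<le> (\<bar>real_of_int j\<bar> * (\<bar>h\<bar> * hs_norm X)) * (1 * (\<bar>h\<bar> * hs_norm X))"
      by (intro mult_mono mult_left_mono D) auto
    also have "\<dots> = \<bar>real_of_int j\<bar> * (h\<^sup>2 * (1 * (hs_norm X)\<^sup>2))"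
      by (simp add: power2_eq_square abs_mult_self_eq mult_ac)
    also have "\<dots> \<le> \<bar>real_of_int j\<bar> * b"
      unfolding b_def by (intro mult_left_mono mult_right_mono) auto
    finally have "trace_bound ((op_powi U j - op_powi V j) o\<^sub>L ((U - V) o\<^sub>L op_powi V (n - 1 - j))) (\<bar>real_of_int j\<bar> * b)"
      by (intro trace_bound.compose powi_diff_hs(1) U V D 1)
    moreover have "trace_bound (op_powi V j o\<^sub>L ((E - id_blinfun - h *\<^sub>R X) o\<^sub>L op_powi V (n - j))) b"
    proof (rule trace_bound_mono)
      show "trace_bound (op_powi V j o\<^sub>L ((E - id_blinfun - h *\<^sub>R X) o\<^sub>L op_powi V (n - j)))
          (norm (op_powi V j) * (norm (op_powi V (n - j)) * b))"
        unfolding b_def E_def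
        by (intro trace_bound_compose_left trace_bound_compose_right exp_path_taylor_hs(3) X unitary_op_clinear unitary_op_powi V)
      have "b \<ge> 0" by (simp add: b_def)
      then have "norm (op_powi V j) * (norm (op_powi V (n - j)) * b) \<le> 1 * (1 * b)"
        by (intro mult_mono unitary_op_norm_le unitary_op_powi V) auto
      then show "norm (op_powi V j) * (norm (op_powi V (n - j)) * b) \<le> b" by simp
    qed
    ultimately have "trace_bound (g j) (\<bar>real_of_int j\<bar> * b + b)"
      unfolding g_def by (rule trace_bound.add)
    then show ?thesis by (simp add: algebra_simps)
  qed
  then have "trace_bound (isum n g) (b * remainder_const n)"
    using trace_bound_isum [of g "\<lambda>j. b * (\<bar>real_of_int j\<bar> + 1)" n]
    by (simp only: remainder_const_def sum_distrib_left distrib_left)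
  ultimately show ?thesis
    by (simp add: b_def)
qed

text \<open>Cyclicity moves \<open>X\<close> to the front of every telescoped term, after which the
  term no longer depends on \<open>j\<close>; the signed count of terms is \<open>n\<close>.\<close>

lemma dpow_diff_trace:
  assumes U: "unitary_op U" and V: "unitary_op V" and hs: "hilbert_schmidt (U - V)"
    and X: "hilbert_schmidt X"
  shows "\<exists>c. trace_bound (dpow X U n - dpow X V n) c"
    and "trace_op (dpow X U n - dpow X V n) = of_int n * trace_op (X o\<^sub>L (op_powi U n - op_powi V n))"
proof -
  define g where "g = (\<lambda>j. (op_powi U j o\<^sub>L (X o\<^sub>L op_powi U (n - j))) - (op_powi V j o\<^sub>L (X o\<^sub>L op_powi V (n - j))))"
  note PU = unitary_op_powi [OF U] and PV = unitary_op_powi [OF V]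
  note cU = unitary_op_clinear [OF PU] and cV = unitary_op_clinear [OF PV]
  note D = powi_diff_hs(1) [OF U V hs]
  have "\<exists>c. trace_bound (g j) c \<and> trace_op (g j) = trace_op (X o\<^sub>L (op_powi U n - op_powi V n))" for j
  proof -
    define k where "k = n - j"
    have hXU: "hilbert_schmidt (X o\<^sub>L op_powi U k)" and hVX: "hilbert_schmidt (op_powi V j o\<^sub>L X)"
      and hDV: "hilbert_schmidt ((op_powi U k - op_powi V k) o\<^sub>L op_powi V j)"
      by (intro hilbert_schmidt_compose_right hilbert_schmidt_compose_left cU cV X D)+
    \<comment> \<open>\<open>U^j X U^k - V^j X V^k\<close> is split so that each part contains
      \<open>X\<close> and one difference of powers, hence two Hilbert-Schmidt factors that may be
      exchanged under the trace.\<close>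
    define T1 where "T1 = (op_powi U j - op_powi V j) o\<^sub>L (X o\<^sub>L op_powi U k)"
    define T2 where "T2 = (op_powi V j o\<^sub>L X) o\<^sub>L (op_powi U k - op_powi V k)"
    define c1 where "c1 = hs_norm (op_powi U j - op_powi V j) * hs_norm (X o\<^sub>L op_powi U k)"
    define c2 where "c2 = hs_norm (op_powi V j o\<^sub>L X) * hs_norm (op_powi U k - op_powi V k)"
    have t1: "trace_bound T1 c1" and t2: "trace_bound T2 c2"
      unfolding T1_def T2_def c1_def c2_def by (intro trace_bound.compose D hXU hVX order_refl)+
    have g: "g j = T1 + T2"
      by (simp add: g_def T1_def T2_def k_def blinfun_compose_simps blinfun_compose_assoc)
    have XD: "X o\<^sub>L (op_powi U n - op_powi V n)
      = ((X o\<^sub>L op_powi U k) o\<^sub>L (op_powi U j - op_powi V j)) + (X o\<^sub>L ((op_powi U k - op_powi V k) o\<^sub>L op_powi V j))"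
      using op_powi_add [OF U, of k j] op_powi_add [OF V, of k j]
      by (simp add: k_def blinfun_compose_simps blinfun_compose_assoc)
    have s1: "trace_bound ((X o\<^sub>L op_powi U k) o\<^sub>L (op_powi U j - op_powi V j)) (hs_norm (X o\<^sub>L op_powi U k) * hs_norm (op_powi U j - op_powi V j))"
      and s2: "trace_bound (X o\<^sub>L ((op_powi U k - op_powi V k) o\<^sub>L op_powi V j)) (hs_norm X * hs_norm ((op_powi U k - op_powi V k) o\<^sub>L op_powi V j))"
      by (intro trace_bound.compose D hXU hDV X order_refl)+
    have "trace_op T1 = trace_op ((X o\<^sub>L op_powi U k) o\<^sub>L (op_powi U j - op_powi V j))"
      unfolding T1_def by (rule trace_op_commute [OF D hXU])
    moreover have "trace_op T2 = trace_op (X o\<^sub>L ((op_powi U k - op_powi V k) o\<^sub>L op_powi V j))"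
      unfolding T2_def trace_op_commute [OF hVX D] trace_op_commute [OF X hDV]
      by (simp add: blinfun_compose_assoc)
    ultimately have "trace_op (g j) = trace_op (X o\<^sub>L (op_powi U n - op_powi V n))"
      unfolding g XD trace_op_add [OF t1 t2] trace_op_add [OF s1 s2] by simp
    then show ?thesis
      using trace_bound.add [OF t1 t2] g by auto
  qed
  then obtain c where c: "\<And>j. trace_bound (g j) (c j)"
    and tr: "\<And>j. trace_op (g j) = trace_op (X o\<^sub>L (op_powi U n - op_powi V n))"
    by metis
  have eq: "dpow X U n - dpow X V n = isum n g"
    unfolding g_def by (simp add: dpow_def isum_diff)
  show "\<exists>c. trace_bound (dpow X U n - dpow X V n) c"
    unfolding eq by (rule exI, rule trace_bound_isum [of g c n, OF c])
  show "trace_op (dpow X U n - dpow X V n) = of_int n * trace_op (X o\<^sub>L (op_powi U n - op_powi V n))"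
    unfolding eq trace_op_isum [OF c] tr isum_const ..
qed

lemma has_vector_derivativeI_quadratic:
  fixes f :: "real \<Rightarrow> 'b::real_normed_vector"
  assumes "\<And>h. \<bar>h\<bar> \<le> 1 \<Longrightarrow> norm (f (s + h) - f s - h *\<^sub>R d) \<le> h\<^sup>2 * K"
  shows "(f has_vector_derivative d) (at s)"
  unfolding has_vector_derivative_def has_derivative_at
proof (intro conjI bounded_linear_scaleR_left)
  have "eventually (\<lambda>h. norm (norm (f (s + h) - f s - h *\<^sub>R d) / norm h) \<le> \<bar>h\<bar> * K) (at 0)"
    unfolding eventually_at
  proof (intro exI [of _ 1] conjI ballI impI)
    fix h :: real assume h: "h \<noteq> 0 \<and> dist h 0 < 1"
    have "norm (f (s + h) - f s - h *\<^sub>R d) \<le> h\<^sup>2 * K"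
      using assms [of h] h by simp
    also have "h\<^sup>2 * K = \<bar>h\<bar> * K * \<bar>h\<bar>"
      by (cases "h \<ge> 0") (auto simp: power2_eq_square)
    finally show "norm (norm (f (s + h) - f s - h *\<^sub>R d) / norm h) \<le> \<bar>h\<bar> * K"
      using h by (simp add: divide_le_eq)
  qed simp
  moreover have "((\<lambda>h. \<bar>h\<bar> * K) \<longlongrightarrow> 0) (at (0::real))"
    by (auto intro!: tendsto_eq_intros)
  ultimately show "((\<lambda>h. norm (f (s + h) - f s - h *\<^sub>R d) / norm h) \<longlongrightarrow> 0) (at 0)"
    by (rule Lim_null_comparison)
qed

text \<open>Restarting at the point \<open>U\<close> of the path leaves a remainder of order
  \<open>h^2\<close> and one term linear in \<open>h\<close>, whose trace is given by
  cyclicity.\<close>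

lemma path_remainder_trace_derivative:
  assumes X: "skew_op X" "hilbert_schmidt X" and V: "unitary_op V"
  shows "((\<lambda>s. trace_op (path_remainder X V s n)) has_vector_derivative
    of_int n * trace_op (X o\<^sub>L (op_powi (exp_op (s *\<^sub>R X) o\<^sub>L V) n - op_powi V n))) (at s)"
proof (rule has_vector_derivativeI_quadratic)
  fix h :: real assume h: "\<bar>h\<bar> \<le> 1"
  define U where "U = exp_op (s *\<^sub>R X) o\<^sub>L V"
  have U: "unitary_op U"
    unfolding U_def by (intro unitary_op_compose unitary_exp_path X V)
  have hs: "hilbert_schmidt (U - V)"
    unfolding U_def by (rule path_diff_hs(1) [OF X V])
  have path: "exp_op ((s + h) *\<^sub>R X) o\<^sub>L V = exp_op (h *\<^sub>R X) o\<^sub>L U"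
    using exp_path_add [of h s X] by (simp add: U_def blinfun_compose_assoc add.commute)
  \<comment> \<open>The derivative at \<open>U\<close> is added and subtracted;
    \<open>dpow X U n\<close> and \<open>dpow X V n\<close> occur only through their difference,
    which has a trace bound.\<close>
  have split: "path_remainder X V (s + h) n = path_remainder X V s n +
      (path_remainder X U h n + h *\<^sub>R (dpow X U n - dpow X V n))"
    unfolding path_remainder_def path U_def [symmetric]
    by (simp add: scaleR_add_left scaleR_diff_right)
  obtain c where c: "trace_bound (dpow X U n - dpow X V n) c"
    using dpow_diff_trace(1) [OF U V hs X(2)] by blast
  note c' = trace_bound_scaleR [OF c, of h] and b1 = path_remainder_trace_bound [OF X V, of s n]
    and b2 = path_remainder_trace_bound [OF X U, of h n]
  have "trace_op (path_remainder X V (s + h) n) = trace_op (path_remainder X V s n) +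
      (trace_op (path_remainder X U h n) + of_real h * trace_op (dpow X U n - dpow X V n))"
    unfolding split trace_op_add [OF b1 trace_bound.add [OF b2 c']] trace_op_add [OF b2 c']
    by (simp only: scaleR_eq_scaleC_op trace_op_scaleC)
  then have "cmod (trace_op (path_remainder X V (s + h) n) - trace_op (path_remainder X V s n) -
        h *\<^sub>R (of_int n * trace_op (X o\<^sub>L (op_powi U n - op_powi V n))))
      = cmod (trace_op (path_remainder X U h n))"
    by (simp add: dpow_diff_trace(2) [OF U V hs X(2)] scaleR_conv_of_real)
  also have "\<dots> \<le> h\<^sup>2 * (exp (\<bar>h\<bar> * norm X) * (hs_norm X)\<^sup>2) * remainder_const n"
    by (rule trace_op_bound [OF b2])
  also have "\<dots> \<le> h\<^sup>2 * (exp (1 * norm X) * (hs_norm X)\<^sup>2) * remainder_const n"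
    using h by (intro mult_right_mono mult_left_mono)
      (auto simp: remainder_const_def mult_left_le_one_le intro!: add_nonneg_nonneg sum_nonneg)
  finally show "cmod (trace_op (path_remainder X V (s + h) n) - trace_op (path_remainder X V s n) -
        h *\<^sub>R (of_int n * trace_op (X o\<^sub>L (op_powi (exp_op (s *\<^sub>R X) o\<^sub>L V) n - op_powi V n))))
      \<le> h\<^sup>2 * (exp (1 * norm X) * (hs_norm X)\<^sup>2 * remainder_const n)"
    by (simp add: U_def mult.assoc)
qed

section \<open>A multiplier bound for pairs of unitary operators\<close>

definition dft :: "nat \<Rightarrow> nat \<Rightarrow> int \<Rightarrow> complex" where
  "dft M m a = cis (2 * pi * real m * real_of_int a / real M)"

lemma dft_add: "dft M m (a + b) = dft M m a * dft M m b"
  by (simp add: dft_def cis_mult [symmetric] distrib_left add_divide_distrib flip: cis_mult)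

lemma cnj_dft: "cnj (dft M m a) = dft M m (- a)"
  by (simp add: dft_def cis_cnj)

text \<open>A geometric sum over the roots of unity; the bound on \<open>a\<close> excludes nonzero
  multiples of \<open>M\<close>, for which the ratio would be one.\<close>

lemma dft_orthogonal:
  assumes "\<bar>a\<bar> < int M"
  shows "(\<Sum>m<M. dft M m a) = (if a = 0 then of_nat M else 0)"
proof (cases "a = 0")
  case False
  define x where "x = 2 * pi * real_of_int a / real M"
  have M: "M > 0" using assms by (cases M) auto
  have dft: "dft M m a = cis x ^ m" for m
    by (simp add: dft_def x_def Complex.DeMoivre mult_ac)
  have "cis x \<noteq> 1"
  proof
    assume "cis x = 1"
    then obtain n :: int where "x = of_int n * (2 * pi)"
      using cos_one_2pi_int [of x] by (auto simp: complex_eq_iff mult.assoc)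
    then have "real_of_int a = real_of_int (n * int M)"
      using M by (simp add: x_def field_simps)
    then have a: "a = n * int M" by linarith
    then have "n \<noteq> 0" using False by auto
    then have "int M \<le> \<bar>n\<bar> * int M"
      using M by (simp add: mult_le_cancel_right1)
    then show False
      using assms a by (simp add: abs_mult)
  qed
  moreover have "cis x ^ M = 1"
  proof -
    have "cis x ^ M = cis (2 * pi * of_int a)"
      using M by (simp add: x_def Complex.DeMoivre)
    then show ?thesis by (simp add: cis_multiple_2pi)
  qed
  ultimately show ?thesis
    using False by (simp add: dft sum_gp_strict)
qed (simp add: dft_def)

definition dft2 :: "nat \<Rightarrow> nat \<times> nat \<Rightarrow> int \<times> int \<Rightarrow> complex" where
  "dft2 M z a = dft M (fst z) (fst a) * dft M (snd z) (snd a)"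

lemma dft2_add: "dft2 M z (a + b) = dft2 M z a * dft2 M z b"
  by (simp add: dft2_def dft_add)

lemma cnj_dft2: "cnj (dft2 M z a) = dft2 M z (- a)"
  by (simp add: dft2_def cnj_dft)

lemma dft2_orthogonal:
  assumes "\<bar>fst a\<bar> < int M" "\<bar>snd a\<bar> < int M"
  shows "(\<Sum>z\<in>{..<M} \<times> {..<M}. dft2 M z a) = (if a = 0 then (of_nat M)\<^sup>2 else 0)"
proof -
  have "(\<Sum>z\<in>{..<M} \<times> {..<M}. dft2 M z a) = (\<Sum>m<M. dft M m (fst a)) * (\<Sum>n<M. dft M n (snd a))"
    by (simp add: dft2_def sum_product sum.cartesian_product case_prod_unfold)
  then show ?thesis
    using assms by (simp add: dft_orthogonal prod_eq_iff power2_eq_square)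
qed

text \<open>
  The waves below are discrete Fourier transforms over an \<open>N \<times> N\<close> box of the operators
  \<open>U\<^sup>a D V\<^sup>b\<close>. They replace the spectral measures of \<open>U\<close> and \<open>V\<close>: pairing the waves of \<open>D\<close> and
  \<open>T\<close> against a symbol returns its multiplier up to Fejer weights, which tend to one as
  \<open>N \<longrightarrow> \<infinity>\<close>.
\<close>

definition sandwich :: "('a::chilbert_space \<Rightarrow>\<^sub>L 'a) \<Rightarrow> ('a \<Rightarrow>\<^sub>L 'a) \<Rightarrow> ('a \<Rightarrow>\<^sub>L 'a) \<Rightarrow> int \<times> int \<Rightarrow> 'a \<Rightarrow>\<^sub>L 'a" where
  "sandwich U V D a = op_powi U (fst a) o\<^sub>L (D o\<^sub>L op_powi V (snd a))"

context
  fixes U V :: "'a::chilbert_space \<Rightarrow>\<^sub>L 'a"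
  assumes U: "unitary_op U" and V: "unitary_op V"
begin

lemma hilbert_schmidt_sandwich: "hilbert_schmidt D \<Longrightarrow> hilbert_schmidt (sandwich U V D a)"
  unfolding sandwich_def
  by (intro hilbert_schmidt_compose_left hilbert_schmidt_compose_right unitary_op_clinear unitary_op_powi U V)

text \<open>Left multiplication by powers of \<open>U\<close> and right multiplication by powers of
  \<open>V\<close> preserve \<open>hsi\<close>, so a common shift of both exponents cancels.\<close>

lemma hsi_sandwich:
  assumes D: "hilbert_schmidt D" and T: "hilbert_schmidt T"
  shows "hsi (sandwich U V D a) (sandwich U V T b) = hsi (sandwich U V D (a - b)) T"
proof -
  have shift: "sandwich U V S a = op_powi U (fst b) o\<^sub>L (sandwich U V S (a - b) o\<^sub>L op_powi V (snd b))" for S a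
    using op_powi_add [OF U, of "fst b" "fst a - fst b"] op_powi_add [OF V, of "snd a - snd b" "snd b"]
    by (simp add: sandwich_def blinfun_compose_assoc)
  have Ub: "clinear (op_powi U (fst b))" "adj (op_powi U (fst b)) o\<^sub>L op_powi U (fst b) = id_blinfun"
    and Vb: "clinear (op_powi V (snd b))" "op_powi V (snd b) o\<^sub>L adj (op_powi V (snd b)) = id_blinfun"
    using unitary_op_powi [OF U, of "fst b"] unitary_op_powi [OF V, of "snd b"] by (auto simp: unitary_op_def)
  have "hsi (sandwich U V D a) (sandwich U V T b) = hsi (sandwich U V D (a - b)) (sandwich U V T (b - b))"
    unfolding shift [of D a] shift [of T b] hsi_isometry_left [OF Ub]
    by (rule hsi_coisometry_right [OF Vb]) (intro hilbert_schmidt_sandwich D T)+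
  also have "sandwich U V T (b - b) = T"
    by (simp add: sandwich_def blinfun_compose_simps)
  finally show ?thesis .
qed

definition wave :: "nat \<Rightarrow> nat \<Rightarrow> ('a \<Rightarrow>\<^sub>L 'a) \<Rightarrow> nat \<times> nat \<Rightarrow> 'a \<Rightarrow>\<^sub>L 'a" where
  "wave N M D z = (\<Sum>a\<in>{0..<int N} \<times> {0..<int N}. scaleC_op (cnj (dft2 M z a)) (sandwich U V D a))"

lemma hilbert_schmidt_wave: "hilbert_schmidt D \<Longrightarrow> hilbert_schmidt (wave N M D z)"
  unfolding wave_def by (intro hilbert_schmidt_sum hilbert_schmidt_scaleC hilbert_schmidt_sandwich)

text \<open>Summation over the frequencies \<open>z\<close> keeps only pairs \<open>a\<close>,
  \<open>b\<close> in the box with \<open>a - b = c i\<close>. Their number is the unnormalized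
  Fejer weight.\<close>

lemma wave_sum:
  fixes g :: "'i \<Rightarrow> complex"
  assumes D: "hilbert_schmidt D" and T: "hilbert_schmidt T"
    and c: "\<And>i. i \<in> I \<Longrightarrow> \<bar>fst (c i)\<bar> \<le> int K \<and> \<bar>snd (c i)\<bar> \<le> int K" and M: "M = N + K"
  shows "(\<Sum>z\<in>{..<M} \<times> {..<M}. (\<Sum>i\<in>I. g i * dft2 M z (c i)) * hsi (wave N M D z) (wave N M T z))
    = (of_nat M)\<^sup>2 * (\<Sum>i\<in>I. g i * (of_nat (card {b \<in> {0..<int N} \<times> {0..<int N}. b + c i \<in> {0..<int N} \<times> {0..<int N}})
        * hsi (sandwich U V D (c i)) T))"
proof -
  let ?Z = "{..<M} \<times> {..<M}" and ?B = "{0..<int N} \<times> {0..<int N}"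
  define w where "w = (\<lambda>a. hsi (sandwich U V D a) T)"
  have hw: "hsi (wave N M D z) (wave N M T z) = (\<Sum>b\<in>?B. \<Sum>a\<in>?B. dft2 M z (b - a) * w (a - b))" for z
  proof -
    have "hsi (wave N M D z) (wave N M T z)
        = (\<Sum>b\<in>?B. \<Sum>a\<in>?B. cnj (cnj (dft2 M z b)) * (cnj (dft2 M z a) * hsi (sandwich U V D a) (sandwich U V T b)))"
      unfolding wave_def
      by (subst hsi_sum_right, intro hilbert_schmidt_scaleC hilbert_schmidt_sandwich T,
          intro hilbert_schmidt_sum hilbert_schmidt_scaleC hilbert_schmidt_sandwich D,
          intro sum.cong refl, subst hsi_sum_left, intro hilbert_schmidt_scaleC hilbert_schmidt_sandwich D,
          intro hilbert_schmidt_scaleC hilbert_schmidt_sandwich T)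
        (simp add: hsi_scaleC_left hsi_scaleC_right sum_distrib_left)
    also have "\<dots> = (\<Sum>b\<in>?B. \<Sum>a\<in>?B. dft2 M z (b - a) * w (a - b))"
      using dft2_add [of M z] by (simp add: hsi_sandwich D T w_def cnj_dft2 diff_conv_add_uminus mult.assoc del: add_uminus_conv_diff)
    finally show ?thesis .
  qed
  have inner: "(\<Sum>z\<in>?Z. dft2 M z (c i) * hsi (wave N M D z) (wave N M T z))
      = (of_nat M)\<^sup>2 * (of_nat (card {b \<in> ?B. b + c i \<in> ?B}) * w (c i))" if i: "i \<in> I" for i
  proof -
    have "(\<Sum>z\<in>?Z. dft2 M z (c i) * hsi (wave N M D z) (wave N M T z))
        = (\<Sum>z\<in>?Z. \<Sum>b\<in>?B. \<Sum>a\<in>?B. dft2 M z (c i + (b - a)) * w (a - b))"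
      unfolding hw by (simp add: sum_distrib_left dft2_add mult.assoc)
    also have "\<dots> = (\<Sum>b\<in>?B. \<Sum>a\<in>?B. (\<Sum>z\<in>?Z. dft2 M z (c i + (b - a))) * w (a - b))"
      unfolding sum_distrib_right by (subst sum.swap, intro sum.cong refl, rule sum.swap)
    also have "\<dots> = (\<Sum>b\<in>?B. \<Sum>a\<in>?B. if b + c i = a then (of_nat M)\<^sup>2 * w (c i) else 0)"
    proof (intro sum.cong refl)
      fix a b assume a: "a \<in> ?B" and b: "b \<in> ?B"
      have "c i + (b - a) = 0 \<longleftrightarrow> b + c i = a"
        by (metis add.commute add_diff_eq eq_iff_diff_eq_0)
      \<comment> \<open>Differences inside the box are at most \<open>N - 1\<close> in modulus, so
        period \<open>N + K\<close> prevents a nonzero exponent from being counted as zero modulo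
        \<open>M\<close>.\<close>
      moreover have "\<bar>fst (c i + (b - a))\<bar> < int M" "\<bar>snd (c i + (b - a))\<bar> < int M"
        using a b c [OF i] M by auto
      ultimately show "(\<Sum>z\<in>?Z. dft2 M z (c i + (b - a))) * w (a - b)
          = (if b + c i = a then (of_nat M)\<^sup>2 * w (c i) else 0)"
        by (auto simp: dft2_orthogonal)
    qed
    also have "\<dots> = (\<Sum>b\<in>?B. if b + c i \<in> ?B then (of_nat M)\<^sup>2 * w (c i) else 0)"
      by (intro sum.cong refl sum.delta') simp
    also have "\<dots> = (\<Sum>b\<in>{b \<in> ?B. b + c i \<in> ?B}. (of_nat M)\<^sup>2 * w (c i))"
      by (rule sum.inter_filter [symmetric]) simp
    finally show ?thesis by simp
  qed
  have "(\<Sum>z\<in>?Z. (\<Sum>i\<in>I. g i * dft2 M z (c i)) * hsi (wave N M D z) (wave N M T z))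
      = (\<Sum>i\<in>I. g i * (\<Sum>z\<in>?Z. dft2 M z (c i) * hsi (wave N M D z) (wave N M T z)))"
    unfolding sum_distrib_right sum_distrib_left by (subst sum.swap) (simp add: mult.assoc)
  also have "\<dots> = (\<Sum>i\<in>I. g i * ((of_nat M)\<^sup>2 * (of_nat (card {b \<in> ?B. b + c i \<in> ?B}) * w (c i))))"
    by (intro sum.cong refl arg_cong2 [where f = times] inner)
  also have "\<dots> = (of_nat M)\<^sup>2 * (\<Sum>i\<in>I. g i * (of_nat (card {b \<in> ?B. b + c i \<in> ?B}) * w (c i)))"
    by (simp add: sum_distrib_left mult.left_commute)
  finally show ?thesis
    by (simp add: w_def)
qed

text \<open>Parseval for the waves: the symbol is the constant one, with the single exponent zero,
  and the overlap is the whole box.\<close>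

lemma wave_norm_sum:
  assumes D: "hilbert_schmidt D" and M: "N \<le> M"
  shows "(\<Sum>z\<in>{..<M} \<times> {..<M}. (hs_norm (wave N M D z))\<^sup>2) = (real M * real N * hs_norm D)\<^sup>2"
proof -
  let ?B = "{0..<int N} \<times> {0..<int N}"
  have "(\<Sum>z\<in>{..<M} \<times> {..<M}. hsi (wave N M D z) (wave N M D z))
      = (of_nat M)\<^sup>2 * (of_nat (card ?B) * hsi (sandwich U V D 0) D)"
    using wave_sum [OF D D, of "{()}" "\<lambda>_. 0" "M - N" M N "\<lambda>_. 1"] M by (simp add: dft2_def dft_def)
  moreover have "sandwich U V D 0 = D"
    by (simp add: sandwich_def blinfun_compose_simps)
  ultimately have "complex_of_real (\<Sum>z\<in>{..<M} \<times> {..<M}. (hs_norm (wave N M D z))\<^sup>2)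
      = complex_of_real ((real M * real N * hs_norm D)\<^sup>2)"
    by (simp add: hsi_self D hilbert_schmidt_wave power_mult_distrib card_cartesian_product power2_eq_square)
  then show ?thesis
    by (simp only: of_real_eq_iff)
qed

text \<open>The symbol enters only through its values on the grid of angles
  \<open>2 \<pi> m / M\<close>, each at most \<open>L\<close>; Cauchy-Schwarz over the waves then
  reduces to their Parseval identity.\<close>

lemma hs_multiplier_bound_finite:
  fixes g :: "'i \<Rightarrow> complex"
  assumes D: "hilbert_schmidt D" and T: "hilbert_schmidt T"
    and c: "\<And>i. i \<in> I \<Longrightarrow> \<bar>fst (c i)\<bar> \<le> int K \<and> \<bar>snd (c i)\<bar> \<le> int K" and N: "N > 0"
    and L: "\<And>s t. cmod (\<Sum>i\<in>I. g i * (cis (of_int (fst (c i)) * s) * cis (of_int (snd (c i)) * t))) \<le> L"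
  shows "cmod (\<Sum>i\<in>I. g i * (of_nat (card {b \<in> {0..<int N} \<times> {0..<int N}. b + c i \<in> {0..<int N} \<times> {0..<int N}})
        / (of_nat N)\<^sup>2 * hsi (sandwich U V D (c i)) T)) \<le> L * (hs_norm D * hs_norm T)"
proof -
  define M where "M = N + K"
  let ?Z = "{..<M} \<times> {..<M}"
  let ?S = "\<Sum>i\<in>I. g i * (of_nat (card {b \<in> {0..<int N} \<times> {0..<int N}. b + c i \<in> {0..<int N} \<times> {0..<int N}})
        * hsi (sandwich U V D (c i)) T)"
  have M0: "M > 0" "N \<le> M" using N by (auto simp: M_def)
  have "0 \<le> L" using order_trans [OF norm_ge_zero L] .
  have L': "cmod (\<Sum>i\<in>I. g i * dft2 M z (c i)) \<le> L" for z
    using L [of "2 * pi * real (fst z) / real M" "2 * pi * real (snd z) / real M"]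
    by (simp add: dft2_def dft_def mult_ac)
  have "cmod ((of_nat M)\<^sup>2 * ?S) = cmod (\<Sum>z\<in>?Z. (\<Sum>i\<in>I. g i * dft2 M z (c i)) * hsi (wave N M D z) (wave N M T z))"
    by (subst wave_sum [OF D T c M_def]) simp_all
  also have "\<dots> \<le> (\<Sum>z\<in>?Z. L * (hs_norm (wave N M D z) * hs_norm (wave N M T z)))"
    by (intro sum_norm_le) (simp add: norm_mult mult_mono L' hsi_cauchy_schwarz hilbert_schmidt_wave D T \<open>0 \<le> L\<close>)
  also have "\<dots> \<le> L * (L2_set (\<lambda>z. hs_norm (wave N M D z)) ?Z * L2_set (\<lambda>z. hs_norm (wave N M T z)) ?Z)"
    unfolding sum_distrib_left [symmetric]
    using L2_set_mult_ineq [of "\<lambda>z. hs_norm (wave N M D z)" "\<lambda>z. hs_norm (wave N M T z)" ?Z] \<open>0 \<le> L\<close>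
    by (intro mult_left_mono) auto
  also have "\<dots> = (real M)\<^sup>2 * ((real N)\<^sup>2 * (L * (hs_norm D * hs_norm T)))"
    unfolding L2_set_def wave_norm_sum [OF D M0(2)] wave_norm_sum [OF T M0(2)]
    by (simp add: power2_eq_square)
  finally have "cmod ?S \<le> (real N)\<^sup>2 * (L * (hs_norm D * hs_norm T))"
    using M0 by (simp add: norm_mult norm_power)
  moreover have "(\<Sum>i\<in>I. g i * (of_nat (card {b \<in> {0..<int N} \<times> {0..<int N}. b + c i \<in> {0..<int N} \<times> {0..<int N}})
        / (of_nat N)\<^sup>2 * hsi (sandwich U V D (c i)) T)) = ?S / (of_nat N)\<^sup>2"
    by (simp add: sum_divide_distrib)
  ultimately show ?thesis
    using N by (simp add: norm_divide norm_power divide_le_eq mult_ac)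
qed

end

text \<open>Points at distance at least \<open>K\<close> from the boundary of the box stay inside
  after the shift, and the boundary layer is negligible.\<close>

lemma box_overlap_ratio:
  assumes "\<bar>fst (c :: int \<times> int)\<bar> \<le> int K" "\<bar>snd c\<bar> \<le> int K"
  shows "(\<lambda>N. real (card {b \<in> {0..<int N} \<times> {0..<int N}. b + c \<in> {0..<int N} \<times> {0..<int N}}) / (real N)\<^sup>2) \<longlonglongrightarrow> 1"
proof (rule tendsto_sandwich)
  let ?C = "\<lambda>N. {b \<in> {0..<int N} \<times> {0..<int N}. b + c \<in> {0..<int N} \<times> {0..<int N}}"
  show "eventually (\<lambda>N. (1 - 2 * real K / real N)\<^sup>2 \<le> real (card (?C N)) / (real N)\<^sup>2) sequentially"
    using eventually_gt_at_top [of "2 * K"]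
  proof eventually_elim
    case (elim N)
    have "{int K..<int N - int K} \<times> {int K..<int N - int K} \<subseteq> ?C N"
      using assms by (auto simp: mem_Times_iff)
    then have "card ({int K..<int N - int K} \<times> {int K..<int N - int K}) \<le> card (?C N)"
      by (intro card_mono) (auto intro: finite_subset [of _ "{0..<int N} \<times> {0..<int N}"])
    moreover have "nat (int N - int K - int K) = N - 2 * K" by simp
    ultimately have "(N - 2 * K) * (N - 2 * K) \<le> card (?C N)"
      by (simp add: card_cartesian_product)
    then have "real ((N - 2 * K) * (N - 2 * K)) \<le> real (card (?C N))"
      by (simp only: of_nat_le_iff)
    then have "(real N - 2 * real K)\<^sup>2 \<le> real (card (?C N))"
      using elim by (simp add: of_nat_diff power2_eq_square)
    moreover have "(1 - 2 * real K / real N)\<^sup>2 = (real N - 2 * real K)\<^sup>2 / (real N)\<^sup>2"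
      using elim by (simp add: power_divide [symmetric] diff_divide_distrib)
    ultimately show ?case
      by (simp add: divide_right_mono)
  qed
  show "eventually (\<lambda>N. real (card (?C N)) / (real N)\<^sup>2 \<le> 1) sequentially"
  proof (rule always_eventually, rule allI)
    fix N
    have "card (?C N) \<le> card ({0..<int N} \<times> {0..<int N})"
      by (intro card_mono) auto
    then show "real (card (?C N)) / (real N)\<^sup>2 \<le> 1"
      by (auto simp: card_cartesian_product power2_eq_square divide_le_eq_1 simp flip: of_nat_mult)
  qed
  have "(\<lambda>N. (1 - 2 * real K / real N)\<^sup>2) \<longlonglongrightarrow> (1 - 0)\<^sup>2"
    by (intro tendsto_intros lim_const_over_n)
  then show "(\<lambda>N. (1 - 2 * real K / real N)\<^sup>2) \<longlonglongrightarrow> 1" by simp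
qed simp

text \<open>The finite boxes give the bound with Fejer weights; for a fixed finite family of
  exponents the weights tend to one while the bound stays the same. The exponents \<open>c i\<close>
  may repeat, as they do for divided differences.\<close>

lemma hs_multiplier_bound:
  fixes g :: "'i \<Rightarrow> complex"
  assumes U: "unitary_op U" and V: "unitary_op V" and D: "hilbert_schmidt D" and T: "hilbert_schmidt T"
    and I: "finite I"
    and L: "\<And>s t. cmod (\<Sum>i\<in>I. g i * (cis (of_int (fst (c i)) * s) * cis (of_int (snd (c i)) * t))) \<le> L"
  shows "cmod (\<Sum>i\<in>I. g i * hsi (sandwich U V D (c i)) T) \<le> L * (hs_norm D * hs_norm T)"
proof -
  define K where "K = nat (\<Sum>i\<in>I. \<bar>fst (c i)\<bar> + \<bar>snd (c i)\<bar>)"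
  have cK: "\<bar>fst (c i)\<bar> \<le> int K \<and> \<bar>snd (c i)\<bar> \<le> int K" if "i \<in> I" for i
  proof -
    have "\<bar>fst (c i)\<bar> + \<bar>snd (c i)\<bar> \<le> (\<Sum>i\<in>I. \<bar>fst (c i)\<bar> + \<bar>snd (c i)\<bar>)"
      by (rule member_le_sum [OF that _ I]) simp
    moreover have "int K = (\<Sum>i\<in>I. \<bar>fst (c i)\<bar> + \<bar>snd (c i)\<bar>)"
      by (simp add: K_def sum_nonneg)
    ultimately show ?thesis by linarith
  qed
  define r where "r = (\<lambda>N i. real (card {b \<in> {0..<int N} \<times> {0..<int N}. b + c i \<in> {0..<int N} \<times> {0..<int N}}) / (real N)\<^sup>2)"
  have "(\<lambda>N. \<Sum>i\<in>I. g i * (of_real (r N i) * hsi (sandwich U V D (c i)) T)) \<longlonglongrightarrow>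
      (\<Sum>i\<in>I. g i * (of_real 1 * hsi (sandwich U V D (c i)) T))"
    unfolding r_def by (intro tendsto_intros box_overlap_ratio [where K = K]) (use cK in auto)
  moreover have "eventually (\<lambda>N. cmod (\<Sum>i\<in>I. g i * (of_real (r N i) * hsi (sandwich U V D (c i)) T))
      \<le> L * (hs_norm D * hs_norm T)) sequentially"
    using eventually_gt_at_top [of 0]
  proof eventually_elim
    case (elim N)
    show ?case
      using hs_multiplier_bound_finite [OF U V D T cK elim L] by (simp add: r_def)
  qed
  ultimately have "cmod (\<Sum>i\<in>I. g i * (of_real 1 * hsi (sandwich U V D (c i)) T)) \<le> L * (hs_norm D * hs_norm T)"
    by (intro tendsto_upperbound [OF tendsto_norm]) auto
  then show ?thesis by simp
qed

section \<open>Divided differences of trigonometric polynomials on the circle\<close>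

text \<open>Jordan's inequality: by concavity the sine lies above its chord on the quarter
  period.\<close>

lemma sin_ge_chord:
  assumes "0 \<le> x" "x \<le> pi / 2"
  shows "2 / pi * x \<le> sin x"
proof -
  have "concave_on {0..pi / 2} sin"
    by (rule f''_le0_imp_concave [where f' = cos and f'' = "\<lambda>x. - sin x"])
      (auto intro!: derivative_eq_intros sin_ge_zero)
  from concave_onD [OF this, of "2 / pi * x" 0 "pi / 2"] assms show ?thesis
    by (simp add: field_simps)
qed

lemma norm_cis_diff: "cmod (cis s - cis t) = 2 * \<bar>sin ((s - t) / 2)\<bar>"
proof -
  have "(cmod (cis s - cis t))\<^sup>2 = (cos s - cos t)\<^sup>2 + (sin s - sin t)\<^sup>2"
    by (simp add: cmod_power2)
  also have "\<dots> = 2 - 2 * cos (s - t)"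
    using sin_cos_squared_add [of s] sin_cos_squared_add [of t]
    by (simp add: cos_diff power2_diff algebra_simps)
  also have "\<dots> = (2 * \<bar>sin ((s - t) / 2)\<bar>)\<^sup>2"
  proof -
    have "2 * ((s - t) / 2) = s - t" by simp
    with cos_double_sin [of "(s - t) / 2"] have "cos (s - t) = 1 - 2 * (sin ((s - t) / 2))\<^sup>2"
      by (simp only:)
    then show ?thesis by (simp add: power_mult_distrib)
  qed
  finally show ?thesis
    by (rule power2_eq_imp_eq) simp_all
qed

text \<open>The source of the factor \<open>\<pi>/2\<close>; the ratio of arc to chord is largest
  for antipodal points.\<close>

lemma norm_cis_diff_ge:
  assumes "\<bar>s - t\<bar> \<le> pi"
  shows "\<bar>s - t\<bar> \<le> pi / 2 * cmod (cis s - cis t)"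
proof -
  have "2 / pi * (\<bar>s - t\<bar> / 2) \<le> sin (\<bar>s - t\<bar> / 2)"
    using assms by (intro sin_ge_chord) auto
  also have "\<dots> \<le> \<bar>sin ((s - t) / 2)\<bar>"
  proof -
    have "\<bar>s - t\<bar> / 2 = (s - t) / 2 \<or> \<bar>s - t\<bar> / 2 = - ((s - t) / 2)"
      by (auto simp: abs_if field_simps)
    then show ?thesis
      by (metis abs_ge_minus_self abs_ge_self sin_minus)
  qed
  finally show ?thesis
    by (simp add: norm_cis_diff field_simps)
qed

lemma trig_sum_lipschitz:
  assumes B: "\<And>t. cmod (\<Sum>n\<in>S. of_int n * q n * cis (of_int n * t)) \<le> B"
  shows "cmod ((\<Sum>n\<in>S. q n * cis (of_int n * s)) - (\<Sum>n\<in>S. q n * cis (of_int n * t))) \<le> B * \<bar>s - t\<bar>"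
proof -
  define Q where "Q = (\<lambda>t. \<Sum>n\<in>S. q n * cis (of_int n * t))"
  have der: "(Q has_vector_derivative (\<i> * (\<Sum>n\<in>S. of_int n * q n * cis (of_int n * t)))) (at t)" for t
  proof -
    have "((\<lambda>t. cis (of_int n * t)) has_vector_derivative (\<i> * of_int n * cis (of_int n * t))) (at t)" for n
    proof -
      have "((\<lambda>z. exp (\<i> * (of_int n * z))) has_field_derivative
          (\<i> * of_int n * exp (\<i> * (of_int n * of_real t)))) (at (of_real t))"
        by (auto intro!: derivative_eq_intros)
      from has_vector_derivative_real_field [OF this] show ?thesis
        by (simp add: cis_conv_exp)
    qed
    then have "(Q has_vector_derivative (\<Sum>n\<in>S. q n * (\<i> * of_int n * cis (of_int n * t)))) (at t)"
      unfolding Q_def by (intro has_vector_derivative_sum has_vector_derivative_mult_right)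
    then show ?thesis
      by (simp add: sum_distrib_left mult_ac)
  qed
  have less: "cmod (Q s - Q t) \<le> B * s - B * t" if "t < s" for s t
  proof (rule differentiable_bound_general [OF that])
    show "continuous_on {t..s} Q"
      using der by (intro continuous_at_imp_continuous_on ballI has_vector_derivative_continuous)
    show "(Q has_vector_derivative (\<i> * (\<Sum>n\<in>S. of_int n * q n * cis (of_int n * x)))) (at x)" for x
      by (rule der)
    show "((\<lambda>x. B * x) has_vector_derivative B) (at x)" for x
      by (auto intro!: derivative_eq_intros simp: has_real_derivative_iff_has_vector_derivative [symmetric])
  qed (use B in \<open>auto simp: norm_mult intro!: continuous_intros\<close>)
  show ?thesis
    using less [of s t] less [of t s]
    by (cases s t rule: linorder_cases) (auto simp: Q_def norm_minus_commute algebra_simps)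
qed

lemma isum_mult_right: "isum n f * c = isum n (\<lambda>j. f j * (c :: complex))"
  by (simp add: isum_def left_diff_distrib sum_distrib_right)

text \<open>The \<open>isum\<close> is the divided difference of \<open>z^n\<close>. Stated as a
  product, the identity needs no exception on the diagonal.\<close>

lemma isum_geometric:
  "isum n (\<lambda>j. cis (of_int j * s) * cis (of_int (n - 1 - j) * t)) * (cis s - cis t)
    = cis (of_int n * s) - cis (of_int n * t)"
proof -
  define G where "G = (\<lambda>j. cis (of_int j * s) * cis (of_int (n - j) * t))"
  have "cis (of_int j * s) * cis (of_int (n - 1 - j) * t) * (cis s - cis t) = G (j + 1) - G j" for j
  proof -
    have "G (j + 1) = cis (of_int j * s) * cis s * cis (of_int (n - 1 - j) * t)"
      by (simp add: G_def cis_mult algebra_simps)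
    moreover have "G j = cis (of_int j * s) * (cis (of_int (n - 1 - j) * t) * cis t)"
      by (simp add: G_def cis_mult algebra_simps)
    ultimately show ?thesis by (simp add: algebra_simps)
  qed
  then show ?thesis
    using isum_telescope [of n G] by (simp add: isum_mult_right G_def)
qed

text \<open>Off the diagonal the symbol is a difference quotient over the chord, on the diagonal it
  is the derivative up to a unimodular factor. The mean value bound involves the arc, which is
  compared with the chord.\<close>

lemma divided_difference_bound:
  assumes B: "\<And>t. cmod (\<Sum>n\<in>S. of_int n * q n * cis (of_int n * t)) \<le> B"
  shows "cmod (\<Sum>n\<in>S. q n * isum n (\<lambda>j. cis (of_int j * s) * cis (of_int (n - 1 - j) * t))) \<le> pi / 2 * B"
proof (cases "cis s = cis t")
  case True
  have B0: "0 \<le> B" using order_trans [OF norm_ge_zero B] .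
  have "isum n (\<lambda>j. cis (of_int j * s) * cis (of_int (n - 1 - j) * t)) = of_int n * (cis (of_int n * t) * cis (- t))" for n
  proof -
    have "cis (of_int j * s) * cis (of_int (n - 1 - j) * t) = cis (of_int n * t) * cis (- t)" for j
    proof -
      have "cis (of_int j * s) = cis (of_int j * t)"
        using True by (simp flip: cis_power_int)
      then show ?thesis by (simp add: cis_mult algebra_simps)
    qed
    then show ?thesis by (simp add: isum_const)
  qed
  then have "(\<Sum>n\<in>S. q n * isum n (\<lambda>j. cis (of_int j * s) * cis (of_int (n - 1 - j) * t)))
      = (\<Sum>n\<in>S. of_int n * q n * cis (of_int n * t)) * cis (- t)"
    by (simp add: sum_distrib_left mult_ac)
  then have "cmod (\<Sum>n\<in>S. q n * isum n (\<lambda>j. cis (of_int j * s) * cis (of_int (n - 1 - j) * t))) \<le> 1 * B"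
    using B [of t] by (simp add: norm_mult)
  also have "\<dots> \<le> pi / 2 * B"
    using pi_ge_two B0 by (intro mult_right_mono) auto
  finally show ?thesis .
next
  case False
  \<comment> \<open>Subtracting whole periods puts the representative \<open>u\<close> of
    \<open>t\<close> within \<open>\<pi>\<close> of \<open>s\<close>, where the arc is at most
    \<open>\<pi>/2\<close> times the chord.\<close>
  define k where "k = round ((s - t) / (2 * pi))"
  define u where "u = t + 2 * pi * of_int k"
  have "\<bar>(s - t) / (2 * pi) - of_int k\<bar> \<le> 1 / 2"
    unfolding k_def using of_int_round_abs_le [of "(s - t) / (2 * pi)"] by (simp add: abs_minus_commute)
  then have "\<bar>(s - t) / (2 * pi) - of_int k\<bar> * (2 * pi) \<le> 1 / 2 * (2 * pi)"
    by (intro mult_right_mono) auto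
  also have "\<bar>(s - t) / (2 * pi) - of_int k\<bar> * (2 * pi) = \<bar>((s - t) / (2 * pi) - of_int k) * (2 * pi)\<bar>"
    by (simp add: abs_mult)
  also have "((s - t) / (2 * pi) - of_int k) * (2 * pi) = s - u"
    by (simp add: u_def field_simps)
  finally have su: "\<bar>s - u\<bar> \<le> pi" by simp
  have cu: "cis (of_int n * u) = cis (of_int n * t)" for n
  proof -
    have "cis u = cis t"
      by (simp add: u_def cis_multiple_2pi flip: cis_mult)
    then show ?thesis by (simp flip: cis_power_int)
  qed
  let ?\<phi> = "\<Sum>n\<in>S. q n * isum n (\<lambda>j. cis (of_int j * s) * cis (of_int (n - 1 - j) * t))"
  have "?\<phi> * (cis s - cis t) = (\<Sum>n\<in>S. q n * cis (of_int n * s)) - (\<Sum>n\<in>S. q n * cis (of_int n * u))"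
  proof -
    have "?\<phi> * (cis s - cis t) = (\<Sum>n\<in>S. q n * (cis (of_int n * s) - cis (of_int n * t)))"
      by (simp only: sum_distrib_right mult.assoc isum_geometric)
    then show ?thesis
      by (simp add: right_diff_distrib sum_subtractf cu)
  qed
  then have "cmod ?\<phi> * cmod (cis s - cis t) \<le> B * \<bar>s - u\<bar>"
    using trig_sum_lipschitz [OF B, of s u] by (simp flip: norm_mult)
  also have "\<dots> \<le> B * (pi / 2 * cmod (cis s - cis u))"
    using norm_cis_diff_ge [OF su] order_trans [OF norm_ge_zero B] by (intro mult_left_mono) auto
  also have "cis u = cis t" using cu [of 1] by simp
  finally have "cmod ?\<phi> * cmod (cis s - cis t) \<le> (pi / 2 * B) * cmod (cis s - cis t)"
    by (simp add: mult_ac)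
  then show ?thesis
    using False by simp
qed

text \<open>The multiplier bound expects one finite family; the sign of \<open>n\<close> absorbs the
  two cases of \<open>isum\<close>.\<close>

lemma isum_eq_sum: "isum n f = (\<Sum>j\<in>{0..<n} \<union> {n..<0}. of_int (sgn n) * (f j :: complex))"
proof (cases "n \<ge> 0")
  case True
  then show ?thesis
    by (cases "n = 0") (auto simp: isum_def)
next
  case False
  then show ?thesis
    by (simp add: isum_def sum_negf)
qed

text \<open>\<open>q(U) - q(V)\<close> is the multiplier with symbol the divided difference of
  \<open>q\<close> applied to \<open>U - V\<close>, so the scalar Lipschitz constant passes to the
  Hilbert-Schmidt norm.\<close>

lemma trig_poly_hs_lipschitz:
  assumes U: "unitary_op U" and V: "unitary_op V" and D: "hilbert_schmidt (U - V)" and T: "hilbert_schmidt T"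
    and S: "finite S"
    and B: "\<And>t. cmod (\<Sum>n\<in>S. of_int n * q n * cis (of_int n * t)) \<le> B"
  shows "cmod (\<Sum>n\<in>S. q n * hsi (op_powi U n - op_powi V n) T) \<le> pi / 2 * B * (hs_norm (U - V) * hs_norm T)"
proof -
  define J where "J = (\<lambda>n::int. {0..<n} \<union> {n..<0})"
  define I where "I = Sigma S J"
  define g where "g = (\<lambda>i::int \<times> int. q (fst i) * of_int (sgn (fst i)))"
  \<comment> \<open>A pair \<open>(n, j)\<close> is sent to the exponents
    \<open>(j, n - 1 - j)\<close> of \<open>U\<close> and \<open>V\<close> in the telescoped
    \<open>n\<close>-th power difference.\<close>
  define c where "c = (\<lambda>i::int \<times> int. (snd i, fst i - 1 - snd i))"
  have fin: "finite I"
    using S by (auto simp: I_def J_def)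
  have regroup: "(\<Sum>i\<in>I. g i * F (c i)) = (\<Sum>n\<in>S. q n * isum n (\<lambda>j. F (j, n - 1 - j)))" for F :: "int \<times> int \<Rightarrow> complex"
  proof -
    have "(\<Sum>i\<in>I. g i * F (c i)) = (\<Sum>n\<in>S. \<Sum>j\<in>J n. g (n, j) * F (c (n, j)))"
      using sum.Sigma [of S J "\<lambda>n j. g (n, j) * F (c (n, j))"] S
      by (simp add: I_def J_def case_prod_unfold)
    then show ?thesis
      by (simp add: isum_eq_sum J_def g_def c_def sum_distrib_left mult.assoc)
  qed
  have hs: "hsi (op_powi U n - op_powi V n) T = isum n (\<lambda>j. hsi (sandwich U V (U - V) (j, n - 1 - j)) T)" for n
  proof -
    have h: "hilbert_schmidt (sandwich U V (U - V) (j, n - 1 - j))" for j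
      by (rule hilbert_schmidt_sandwich [OF U V D])
    have "op_powi U n - op_powi V n = isum n (\<lambda>j. sandwich U V (U - V) (j, n - 1 - j))"
      unfolding powi_diff_isum [OF U V] sandwich_def fst_conv snd_conv ..
    then show ?thesis
      unfolding isum_def
      by (simp only: hsi_diff_left [OF hilbert_schmidt_sum hilbert_schmidt_sum T, OF h h] hsi_sum_left [OF h T])
  qed
  have "cmod (\<Sum>i\<in>I. g i * hsi (sandwich U V (U - V) (c i)) T) \<le> (pi / 2 * B) * (hs_norm (U - V) * hs_norm T)"
  proof (rule hs_multiplier_bound [OF U V D T fin])
    fix s t
    have "(\<Sum>i\<in>I. g i * (cis (of_int (fst (c i)) * s) * cis (of_int (snd (c i)) * t)))
        = (\<Sum>n\<in>S. q n * isum n (\<lambda>j. cis (of_int j * s) * cis (of_int (n - 1 - j) * t)))"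
      using regroup [of "\<lambda>d. cis (of_int (fst d) * s) * cis (of_int (snd d) * t)"] by simp
    then show "cmod (\<Sum>i\<in>I. g i * (cis (of_int (fst (c i)) * s) * cis (of_int (snd (c i)) * t))) \<le> pi / 2 * B"
      using divided_difference_bound [OF B, of s t] by simp
  qed
  then show ?thesis
    unfolding regroup [of "\<lambda>d. hsi (sandwich U V (U - V) d) T"] hs .
qed

section \<open>The trace of the Taylor remainder\<close>

lemma path_remainder_0: "path_remainder X V 0 n = 0"
  by (simp add: path_remainder_def blinfun_compose_simps)

lemma dpow_0: "dpow 0 V n = 0"
  by (simp add: dpow_def isum_def blinfun_compose_simps)

lemma skew_op_0: "skew_op 0"
  by (simp add: skew_op_def)

text \<open>\<open>Y = 0\<close> yields the basic estimate, small \<open>X - Y\<close> the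
  continuity in the generator. Both need the explicit factor \<open>hs_norm (X - Y)\<close>.\<close>

lemma path_remainder_trace_diff_bound:
  assumes X: "skew_op X" "hilbert_schmidt X" and Y: "skew_op Y" "hilbert_schmidt Y" and V: "unitary_op V"
    and S: "finite S"
    and B: "\<And>t. cmod (\<Sum>n\<in>S. (of_int n)\<^sup>2 * a n * cis (of_int n * t)) \<le> B"
  shows "cmod (\<Sum>n\<in>S. a n * (trace_op (path_remainder X V 1 n) - trace_op (path_remainder Y V 1 n)))
    \<le> pi / 4 * B * (hs_norm (X - Y) * (hs_norm X + hs_norm Y))"
proof -
  define U where "U = (\<lambda>s. exp_op (s *\<^sub>R X) o\<^sub>L V)"
  define W where "W = (\<lambda>s. exp_op (s *\<^sub>R Y) o\<^sub>L V)"
  have U: "unitary_op (U s)" and W: "unitary_op (W s)" for s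
    unfolding U_def W_def by (intro unitary_op_compose unitary_exp_path X Y V)+
  have B0: "0 \<le> B" using order_trans [OF norm_ge_zero B] .
  define f where "f = (\<lambda>s. \<Sum>n\<in>S. a n * (trace_op (path_remainder X V s n) - trace_op (path_remainder Y V s n)))"
  define f' where "f' = (\<lambda>s. \<Sum>n\<in>S. a n * (of_int n * trace_op (X o\<^sub>L (op_powi (U s) n - op_powi V n))
      - of_int n * trace_op (Y o\<^sub>L (op_powi (W s) n - op_powi V n))))"
  have der: "(f has_vector_derivative f' s) (at s)" for s
    unfolding f_def f'_def U_def W_def
    by (intro has_vector_derivative_sum has_vector_derivative_mult_right has_vector_derivative_diff
        path_remainder_trace_derivative X Y V)
  define \<delta> where "\<delta> = hs_norm (X - Y) * (hs_norm X + hs_norm Y)"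
  have bound: "cmod (f' s) \<le> pi / 2 * B * (s * \<delta>)" if s: "0 \<le> s" for s
  proof -
    have UW: "U s - W s = (exp_op (s *\<^sub>R X) - exp_op (s *\<^sub>R Y)) o\<^sub>L V"
      by (simp add: U_def W_def blinfun_compose_simps)
    note E = exp_path_diff_hs [OF X Y, of s]
    have hUW: "hilbert_schmidt (U s - W s)"
      unfolding UW by (intro hilbert_schmidt_compose_right E) (simp add: V)
    have "hs_norm (U s - W s) \<le> norm V * hs_norm (exp_op (s *\<^sub>R X) - exp_op (s *\<^sub>R Y))"
      unfolding UW by (intro hilbert_schmidt_compose_right E) (simp add: V)
    also have "\<dots> \<le> 1 * (\<bar>s\<bar> * hs_norm (X - Y))"
      by (intro mult_mono unitary_op_norm_le V E) auto
    finally have nUW: "hs_norm (U s - W s) \<le> s * hs_norm (X - Y)"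
      using s by simp
    have hWV: "hilbert_schmidt (W s - V)" "hs_norm (W s - V) \<le> s * hs_norm Y"
      using path_diff_hs [OF Y V, of s] s by (simp_all add: W_def)
    have XY: "hilbert_schmidt (X - Y)"
      by (intro hilbert_schmidt_diff X Y)
    \<comment> \<open>One factor \<open>n\<close> comes from differentiating the trace in
      \<open>s\<close>, the other from the Lipschitz constant of the resulting polynomial; together
      they form the second derivative bounded by \<open>B\<close>.\<close>
    define q where "q = (\<lambda>n. of_int n * a n)"
    have q: "cmod (\<Sum>n\<in>S. of_int n * q n * cis (of_int n * t)) \<le> B" for t
      using B [of t] by (simp add: q_def power2_eq_square mult_ac)
    \<comment> \<open>Inserting \<open>W\<close> separates the change of the path, of size
      \<open>s\<close> times \<open>hs_norm (X - Y)\<close>, from the change of the generator, where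
      \<open>W - V\<close> is of size \<open>s\<close> times \<open>hs_norm Y\<close>.\<close>
    have tr: "trace_op (X o\<^sub>L (op_powi (U s) n - op_powi V n)) - trace_op (Y o\<^sub>L (op_powi (W s) n - op_powi V n))
        = hsi (op_powi (U s) n - op_powi (W s) n) (adj X) + hsi (op_powi (W s) n - op_powi V n) (adj (X - Y))" for n
    proof -
      note h1 = powi_diff_hs(1) [OF U W hUW, of n] and h2 = powi_diff_hs(1) [OF W V hWV(1), of n]
      have "op_powi (U s) n - op_powi V n = (op_powi (U s) n - op_powi (W s) n) + (op_powi (W s) n - op_powi V n)"
        by simp
      then have "hsi (op_powi (U s) n - op_powi V n) (adj X)
          = hsi (op_powi (U s) n - op_powi (W s) n) (adj X) + hsi (op_powi (W s) n - op_powi V n) (adj X)"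
        by (simp only: hsi_add_left [OF h1 h2 hilbert_schmidt_adj [OF X(2)]])
      moreover have "hsi (op_powi (W s) n - op_powi V n) (adj (X - Y))
          = hsi (op_powi (W s) n - op_powi V n) (adj X) - hsi (op_powi (W s) n - op_powi V n) (adj Y)"
        using X Y by (simp add: adj_diff hsi_diff_right hilbert_schmidt_adj h2)
      ultimately show ?thesis
        using X Y by (simp add: trace_op_compose)
    qed
    have "f' s = (\<Sum>n\<in>S. q n * (trace_op (X o\<^sub>L (op_powi (U s) n - op_powi V n))
        - trace_op (Y o\<^sub>L (op_powi (W s) n - op_powi V n))))"
      unfolding f'_def q_def by (intro sum.cong refl) (simp add: algebra_simps)
    also have "\<dots> = (\<Sum>n\<in>S. q n * hsi (op_powi (U s) n - op_powi (W s) n) (adj X))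
        + (\<Sum>n\<in>S. q n * hsi (op_powi (W s) n - op_powi V n) (adj (X - Y)))"
      unfolding tr by (simp add: distrib_left sum.distrib)
    also have "cmod \<dots> \<le> pi / 2 * B * (hs_norm (U s - W s) * hs_norm (adj X))
        + pi / 2 * B * (hs_norm (W s - V) * hs_norm (adj (X - Y)))"
      by (intro norm_triangle_le add_mono trig_poly_hs_lipschitz U W V hUW hWV S q hilbert_schmidt_adj X XY)
    also have "\<dots> \<le> pi / 2 * B * ((s * hs_norm (X - Y)) * hs_norm X)
        + pi / 2 * B * ((s * hs_norm Y) * hs_norm (X - Y))"
      using nUW hWV(2) s B0 unfolding hs_norm_adj [OF X(2)] hs_norm_adj [OF XY]
      by (intro add_mono mult_left_mono mult_right_mono) auto
    also have "\<dots> = pi / 2 * B * (s * \<delta>)"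
      by (simp add: \<delta>_def algebra_simps)
    finally show ?thesis .
  qed
  \<comment> \<open>The derivative bound grows linearly in \<open>s\<close>; its integral over
    \<open>[0, 1]\<close> halves \<open>\<pi>/2\<close>.\<close>
  have "norm (f 1 - f 0) \<le> pi / 4 * B * \<delta> * 1\<^sup>2 - pi / 4 * B * \<delta> * 0\<^sup>2"
  proof (rule differentiable_bound_general)
    show "continuous_on {0..1} f"
      using der by (intro continuous_at_imp_continuous_on ballI has_vector_derivative_continuous)
    show "(f has_vector_derivative f' x) (at x)" for x by (rule der)
    show "((\<lambda>x. pi / 4 * B * \<delta> * x\<^sup>2) has_vector_derivative (pi / 2 * B * (x * \<delta>))) (at x)" for x
      by (auto intro!: derivative_eq_intros simp: has_real_derivative_iff_has_vector_derivative [symmetric])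
    show "norm (f' x) \<le> pi / 2 * B * (x * \<delta>)" if "0 < x" for x
      using bound [of x] that by simp
  qed (auto intro!: continuous_intros)
  moreover have "f 0 = 0"
    by (simp add: f_def path_remainder_0)
  ultimately show ?thesis
    by (simp add: f_def \<delta>_def)
qed

lemma path_remainder_trace_le:
  assumes X: "skew_op X" "hilbert_schmidt X" and V: "unitary_op V" and S: "finite S"
    and B: "\<And>t. cmod (\<Sum>n\<in>S. (of_int n)\<^sup>2 * a n * cis (of_int n * t)) \<le> B"
  shows "cmod (\<Sum>n\<in>S. a n * trace_op (path_remainder X V 1 n)) \<le> pi / 4 * B * (hs_norm X)\<^sup>2"
  using path_remainder_trace_diff_bound [OF X skew_op_0 hilbert_schmidt_0 V S B]
  by (simp add: path_remainder_def dpow_0 blinfun_compose_simps power2_eq_square)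

text \<open>The general Lipschitz estimate would allow growth like \<open>n^2\<close>. Here
  \<open>Y = Y P\<close> has a finite trace bound of its own, so the difference of two unitary
  powers may be estimated by two in operator norm.\<close>

lemma path_remainder_trace_linear_growth:
  assumes Y: "skew_op Y" "hilbert_schmidt Y" and V: "unitary_op V"
    and P: "hilbert_schmidt P" and YP: "Y o\<^sub>L P = Y"
  shows "cmod (trace_op (path_remainder Y V 1 n)) \<le> 2 * hs_norm Y * hs_norm P * \<bar>real_of_int n\<bar>"
proof -
  define K where "K = 2 * hs_norm Y * hs_norm P * \<bar>real_of_int n\<bar>"
  define f where "f = (\<lambda>s. trace_op (path_remainder Y V s n))"
  define W where "W = (\<lambda>s. exp_op (s *\<^sub>R Y) o\<^sub>L V)"
  have W: "unitary_op (W s)" for s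
    unfolding W_def by (intro unitary_op_compose unitary_exp_path Y V)
  have der: "(f has_vector_derivative (of_int n * trace_op (Y o\<^sub>L (op_powi (W s) n - op_powi V n)))) (at s)" for s
    unfolding f_def W_def by (intro path_remainder_trace_derivative Y V)
  have bound: "cmod (of_int n * trace_op (Y o\<^sub>L (op_powi (W s) n - op_powi V n))) \<le> K" for s
  proof -
    let ?T = "op_powi (W s) n - op_powi V n"
    have cl: "clinear ?T"
      by (intro clinear_diff unitary_op_clinear unitary_op_powi W V)
    have "norm ?T \<le> 1 + 1"
      using norm_triangle_ineq4 [of "op_powi (W s) n" "op_powi V n"]
        unitary_op_norm_le [OF unitary_op_powi [OF W], of s n] unitary_op_norm_le [OF unitary_op_powi [OF V], of n]
      by linarith
    then have "hs_norm (P o\<^sub>L ?T) \<le> (1 + 1) * hs_norm P"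
      using hilbert_schmidt_compose_right(2) [OF cl P] mult_right_mono [OF _ hs_norm_nonneg [of P]]
      by (meson order_trans)
    then have *: "hs_norm Y * hs_norm (P o\<^sub>L ?T) \<le> hs_norm Y * (2 * hs_norm P)"
      by (intro mult_left_mono) auto
    have "Y o\<^sub>L ?T = Y o\<^sub>L (P o\<^sub>L ?T)"
      by (subst YP [symmetric]) (rule blinfun_compose_assoc)
    then have "trace_bound (Y o\<^sub>L ?T) (hs_norm Y * (2 * hs_norm P))"
      using trace_bound.compose [OF Y(2) hilbert_schmidt_compose_right(1) [OF cl P] *] by simp
    then have "cmod (trace_op (Y o\<^sub>L ?T)) \<le> hs_norm Y * (2 * hs_norm P)"
      by (rule trace_op_bound)
    then have "\<bar>real_of_int n\<bar> * cmod (trace_op (Y o\<^sub>L ?T)) \<le> \<bar>real_of_int n\<bar> * (hs_norm Y * (2 * hs_norm P))"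
      by (intro mult_left_mono) auto
    then show ?thesis
      by (simp add: norm_mult K_def mult_ac)
  qed
  have "norm (f 1 - f 0) \<le> K * 1 - K * 0"
  proof (rule differentiable_bound_general)
    show "continuous_on {0..1} f"
      using der by (intro continuous_at_imp_continuous_on ballI has_vector_derivative_continuous)
    show "(f has_vector_derivative (of_int n * trace_op (Y o\<^sub>L (op_powi (W x) n - op_powi V n)))) (at x)" for x
      by (rule der)
    show "((\<lambda>x. K * x) has_vector_derivative K) (at x)" for x
      by (auto intro!: derivative_eq_intros simp: has_real_derivative_iff_has_vector_derivative [symmetric])
  qed (use bound in \<open>auto intro!: continuous_intros\<close>)
  then show ?thesis
    by (simp add: f_def K_def path_remainder_0)
qed

section \<open>Approximation by finite rank operators\<close>

definition onb_proj :: "'a::chilbert_space set \<Rightarrow> 'a \<Rightarrow>\<^sub>L 'a" where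
  "onb_proj F = Blinfun (\<lambda>x. \<Sum>e\<in>F. cinner x e *\<^sub>C e)"

lemma onb_proj_apply: "blinfun_apply (onb_proj F) x = (\<Sum>e\<in>F. cinner x e *\<^sub>C e)"
  unfolding onb_proj_def
  by (subst bounded_linear_Blinfun_apply)
    (auto intro!: bounded_linear_sum bounded_linear_compose [OF scaleC.bounded_linear_left cinner.bounded_linear_left])

lemma clinear_onb_proj [simp]: "clinear (onb_proj F)"
  by (simp add: clinear_def onb_proj_apply cinner_scaleC_left scaleC.sum_right scaleC_scaleC)

lemma adj_onb_proj: "adj (onb_proj F) = onb_proj F"
proof (rule adj_eqI)
  fix x y
  show "cinner (blinfun_apply (onb_proj F) x) y = cinner x (blinfun_apply (onb_proj F) y)"
    unfolding onb_proj_apply cinner.sum_left cinner.sum_right cinner_scaleC_left cinner_scaleC_right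
    by (intro sum.cong refl) (subst (3) cinner_commute, simp)
qed

lemma onb_proj_onb:
  assumes "finite F" "F \<subseteq> some_onb" "e \<in> some_onb"
  shows "blinfun_apply (onb_proj F) e = (if e \<in> F then e else 0)"
proof -
  have "cinner e f = (if f = e then 1 else 0)" if "f \<in> F" for f
    using is_onb_orthonormal [OF is_onb_some_onb] assms that unfolding orthonormal_def by (metis subsetD)
  then have "blinfun_apply (onb_proj F) e = (\<Sum>f\<in>F. if f = e then e else 0)"
    unfolding onb_proj_apply by (intro sum.cong) (auto simp: scaleC.zero_left)
  then show ?thesis
    using assms by simp
qed

lemma onb_proj_idem:
  assumes "finite F" "F \<subseteq> some_onb"
  shows "onb_proj F o\<^sub>L onb_proj F = onb_proj F"
proof (rule blinfun_eqI)
  fix x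
  have "blinfun_apply (onb_proj F o\<^sub>L onb_proj F) x = (\<Sum>e\<in>F. cinner x e *\<^sub>C blinfun_apply (onb_proj F) e)"
    using clinear_onb_proj [of F]
    by (simp add: onb_proj_apply [of F x] blinfun.sum_right clinear_def)
  also have "\<dots> = (\<Sum>e\<in>F. cinner x e *\<^sub>C e)"
    by (intro sum.cong refl) (simp add: onb_proj_onb [OF assms subsetD [OF assms(2)]])
  finally show "blinfun_apply (onb_proj F o\<^sub>L onb_proj F) x = blinfun_apply (onb_proj F) x"
    by (simp add: onb_proj_apply)
qed

lemma norm_onb_proj:
  assumes F: "finite F" "F \<subseteq> some_onb"
  shows "norm (onb_proj F) \<le> 1"
proof (rule norm_blinfun_bound)
  fix x
  note B = is_onb_orthonormal [OF is_onb_some_onb]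
  have "(norm (blinfun_apply (onb_proj F) x))\<^sup>2 \<le> (norm x)\<^sup>2"
    unfolding onb_proj_apply orthonormal_norm_sum [OF B F] by (rule bessel_finite [OF B F])
  then show "norm (blinfun_apply (onb_proj F) x) \<le> 1 * norm x"
    using power2_le_imp_le by fastforce
qed simp

lemma hilbert_schmidt_onb_proj:
  assumes F: "finite F" "F \<subseteq> some_onb"
  shows "hilbert_schmidt (onb_proj F)"
proof -
  have "(\<lambda>e. (norm (blinfun_apply (onb_proj F) e))\<^sup>2) summable_on some_onb
      \<longleftrightarrow> (\<lambda>e. (norm (blinfun_apply (onb_proj F) e))\<^sup>2) summable_on F"
    by (rule summable_on_cong_neutral) (use F in \<open>auto simp: onb_proj_onb\<close>)
  then show ?thesis
    using F by (simp add: hilbert_schmidt_def)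
qed

text \<open>The compression of \<open>X\<close> by a finite projection from both sides stays skew.
  The projection is itself Hilbert-Schmidt and serves as the right factor \<open>P\<close>.\<close>

lemma skew_finite_rank_approx:
  assumes X: "skew_op X" "hilbert_schmidt X" and \<epsilon>: "\<epsilon> > 0"
  obtains Y P where "skew_op Y" "hilbert_schmidt Y" "hilbert_schmidt P" "Y o\<^sub>L P = Y" "hs_norm (X - Y) \<le> \<epsilon>"
proof -
  let ?B = "some_onb :: 'a set" and ?f = "\<lambda>e. (norm (blinfun_apply X e))\<^sup>2"
  note sX = hilbert_schmidt_summable [OF X(2)]
  \<comment> \<open>The squared norm of \<open>X - X P\<close> is the tail of the defining sum
    outside \<open>F\<close>, hence the square in the tolerance.\<close>
  obtain F where F: "finite F" "F \<subseteq> ?B" and "dist (sum ?f F) (infsum ?f ?B) \<le> (\<epsilon> / 2)\<^sup>2"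
    using infsum_finite_approximation [OF sX, of "(\<epsilon> / 2)\<^sup>2"] \<epsilon> by auto
  then have Fle: "infsum ?f ?B - sum ?f F \<le> (\<epsilon> / 2)\<^sup>2"
    by (simp add: dist_real_def)
  let ?P = "onb_proj F"
  have hXP: "hilbert_schmidt (X o\<^sub>L ?P)"
    by (rule hilbert_schmidt_compose_right(1) [OF clinear_onb_proj X(2)])
  have hD: "hilbert_schmidt (X - (X o\<^sub>L ?P))"
    by (rule hilbert_schmidt_diff [OF X(2) hXP])
  have "(hs_norm (X - (X o\<^sub>L ?P)))\<^sup>2 = infsum ?f (?B - F)"
    unfolding hs_norm_power2
    by (rule infsum_cong_neutral) (use F in \<open>auto simp: blinfun.diff_left onb_proj_onb\<close>)
  also have "\<dots> = infsum ?f ?B - infsum ?f F"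
    using sX F by (intro infsum_Diff) auto
  also have "\<dots> \<le> (\<epsilon> / 2)\<^sup>2"
    using F Fle by simp
  finally have 1: "hs_norm (X - (X o\<^sub>L ?P)) \<le> \<epsilon> / 2"
    by (rule power2_le_imp_le) (use \<epsilon> in simp)
  \<comment> \<open>Skewness makes the error of the left cut-off the negative adjoint of the right
    one, so the same \<open>F\<close> controls both.\<close>
  have "adj (X - (?P o\<^sub>L X)) = - (X - (X o\<^sub>L ?P))"
    using X by (simp add: adj_diff adj_compose adj_onb_proj skew_op_def blinfun_compose_simps)
  moreover have hPX: "hilbert_schmidt (X - (?P o\<^sub>L X))"
    by (intro hilbert_schmidt_diff hilbert_schmidt_compose_left X clinear_onb_proj)
  ultimately have 2: "hs_norm (X - (?P o\<^sub>L X)) \<le> \<epsilon> / 2"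
    using 1 hs_norm_adj [OF hPX] by (simp only: hs_norm_uminus)
  define Y where "Y = ?P o\<^sub>L (X o\<^sub>L ?P)"
  have eq: "X - Y = (X - (X o\<^sub>L ?P)) + ((X - (?P o\<^sub>L X)) o\<^sub>L ?P)"
    by (simp add: Y_def blinfun_compose_simps blinfun_compose_assoc)
  have h3: "hilbert_schmidt ((X - (?P o\<^sub>L X)) o\<^sub>L ?P)" "hs_norm ((X - (?P o\<^sub>L X)) o\<^sub>L ?P) \<le> 1 * hs_norm (X - (?P o\<^sub>L X))"
    using hilbert_schmidt_compose_right [OF clinear_onb_proj hPX, of F]
      mult_right_mono [OF norm_onb_proj [OF F] hs_norm_nonneg, of "X - (?P o\<^sub>L X)"] by auto
  show ?thesis
  proof (rule that [of Y ?P])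
    show "skew_op Y"
      using X by (simp add: skew_op_def Y_def adj_compose adj_onb_proj blinfun_compose_simps blinfun_compose_assoc)
    show "hilbert_schmidt Y"
      unfolding Y_def by (intro hilbert_schmidt_compose_left hXP) simp
    show "hilbert_schmidt ?P" by (rule hilbert_schmidt_onb_proj [OF F])
    show "Y o\<^sub>L ?P = Y"
      by (simp add: Y_def blinfun_compose_assoc onb_proj_idem [OF F])
    show "hs_norm (X - Y) \<le> \<epsilon>"
      unfolding eq using hs_norm_triangle [OF hD h3(1)] h3(2) 1 2 by simp
  qed
qed

section \<open>Fourier series of integrable functions on the circle\<close>

abbreviation circle_measure :: "real measure" where
  "circle_measure \<equiv> restrict_space lebesgue {0..2 * pi}"

abbreviation fexp :: "int \<Rightarrow> real \<Rightarrow> complex" where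
  "fexp n t \<equiv> cis (of_int n * t)"

lemma fexp_add: "fexp (m + n) t = fexp m t * fexp n t"
  by (simp add: cis_mult distrib_right)

lemma finite_measure_circle: "finite_measure circle_measure"
  by (rule finite_measureI) (simp add: emeasure_restrict_space)

lemma measure_circle [simp]: "measure circle_measure {0..2 * pi} = 2 * pi"
  by (simp add: measure_restrict_space)

lemma integrable_circle_iff: "integrable circle_measure f \<longleftrightarrow> set_integrable lebesgue {0..2 * pi} f"
  for f :: "real \<Rightarrow> 'b::{banach, second_countable_topology}"
  by (simp add: integrable_restrict_space set_integrable_def)

lemma integral_circle: "integral\<^sup>L circle_measure f = (LINT t:{0..2 * pi}|lebesgue. f t)"
  for f :: "real \<Rightarrow> 'b::{banach, second_countable_topology}"
  by (simp add: integral_restrict_space set_lebesgue_integral_def)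

lemma integrable_circle_continuous:
  fixes f :: "real \<Rightarrow> 'b::euclidean_space"
  assumes "continuous_on UNIV f"
  shows "integrable circle_measure f"
  unfolding integrable_circle_iff
  by (rule absolutely_integrable_continuous_real) (rule continuous_on_subset [OF assms], simp)

lemma integral_circle_bound:
  fixes f :: "real \<Rightarrow> complex"
  assumes "integrable circle_measure f" "\<And>t. cmod (f t) \<le> B"
  shows "cmod (integral\<^sup>L circle_measure f) \<le> 2 * pi * B"
proof -
  interpret finite_measure circle_measure by (rule finite_measure_circle)
  have "cmod (integral\<^sup>L circle_measure f) \<le> (\<integral>t. cmod (f t) \<partial>circle_measure)"
    by (rule integral_norm_bound)
  also have "\<dots> \<le> (\<integral>t. B \<partial>circle_measure)"
    using assms by (intro integral_mono integrable_norm integrable_const) auto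
  finally show ?thesis
    by simp
qed

lemma integral_fexp: "(\<integral>t. fexp n t \<partial>circle_measure) = of_real (if n = 0 then 2 * pi else 0)"
proof (cases "n = 0")
  case True
  interpret finite_measure circle_measure by (rule finite_measure_circle)
  show ?thesis
    using True by (simp add: scaleR_conv_of_real)
next
  case False
  define F where "F = (\<lambda>t. fexp n t / (\<i> * of_int n))"
  have "(F has_vector_derivative fexp n t) (at t within {0..2 * pi})" for t
  proof -
    have "((\<lambda>z. exp (\<i> * (of_int n * z)) / (\<i> * of_int n)) has_field_derivative
        exp (\<i> * (of_int n * of_real t))) (at (of_real t))"
      using False by (auto intro!: derivative_eq_intros simp: mult_ac)
    from has_vector_derivative_real_field [OF this] show ?thesis
      by (simp add: F_def cis_conv_exp)
  qed
  then have "(fexp n has_integral (F (2 * pi) - F 0)) {0..2 * pi}"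
    by (intro fundamental_theorem_of_calculus) auto
  moreover have "fexp n (2 * pi) = 1"
    by (metis Ints_of_int cis_multiple_2pi mult.commute)
  ultimately have "integral {0..2 * pi} (fexp n) = 0"
    by (simp add: integral_unique F_def)
  moreover have "set_integrable lebesgue {0..2 * pi} (fexp n)"
    by (rule absolutely_integrable_continuous_real) (auto intro!: continuous_intros)
  ultimately show ?thesis
    using False by (simp add: integral_circle set_lebesgue_integral_eq_integral)
qed

lemma integrable_fexp: "integrable circle_measure (fexp n)"
  by (rule integrable_circle_continuous) (auto intro!: continuous_intros)

lemma integrable_fexp_mult:
  assumes f: "integrable circle_measure f"
  shows "integrable circle_measure (\<lambda>t. fexp n t * f t)"
proof (rule Bochner_Integration.integrable_bound [OF integrable_norm [OF f]])
  show "(\<lambda>t. fexp n t * f t) \<in> borel_measurable circle_measure"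
    using borel_measurable_integrable [OF f] borel_measurable_integrable [OF integrable_fexp] by measurable
qed (simp add: norm_mult)

section \<open>Fejer means and their norm bound\<close>

text \<open>Moments are taken against \<open>fexp n\<close> without conjugation, so
  \<open>\<gamma> n\<close> multiplies \<open>fexp (- n)\<close>. The double sum over differences
  produces the usual triangular weights and displays the kernel as a square.\<close>

definition fejer :: "(int \<Rightarrow> complex) \<Rightarrow> nat \<Rightarrow> real \<Rightarrow> complex" where
  "fejer \<gamma> N t = (\<Sum>j<N. \<Sum>k<N. \<gamma> (int j - int k) * fexp (int k - int j) t) / (2 * pi * of_nat N)"

text \<open>The functional sending \<open>e\<^sup>i\<^sup>n\<^sup>t\<close> to \<open>\<gamma> n\<close> is bounded by \<open>C\<close> for the supremum norm.\<close>

definition trig_bounded :: "(int \<Rightarrow> complex) \<Rightarrow> real \<Rightarrow> bool" where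
  "trig_bounded \<gamma> C \<longleftrightarrow> (\<forall>S g B. finite S \<longrightarrow> (\<forall>t. cmod (\<Sum>n\<in>S. g n * fexp n t) \<le> B) \<longrightarrow>
      cmod (\<Sum>n\<in>S. g n * \<gamma> n) \<le> C * B)"

text \<open>Collects equal frequencies, so that the double sums of Fejer type can be tested
  directly.\<close>

lemma trig_bounded_family:
  assumes \<gamma>: "trig_bounded \<gamma> C" and I: "finite I"
    and B: "\<And>t. cmod (\<Sum>i\<in>I. g i * fexp (c i) t) \<le> B"
  shows "cmod (\<Sum>i\<in>I. g i * \<gamma> (c i)) \<le> C * B"
proof -
  define g' where "g' = (\<lambda>n. \<Sum>i\<in>{i \<in> I. c i = n}. g i)"
  have regroup: "(\<Sum>i\<in>I. g i * F (c i)) = (\<Sum>n\<in>c ` I. g' n * F n)" for F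
    unfolding g'_def sum_distrib_right
    by (subst sum.image_gen [OF I, of _ c]) (auto intro!: sum.cong)
  show ?thesis
    using \<gamma> I B unfolding regroup trig_bounded_def regroup [of "\<lambda>n. fexp n _"] by blast
qed

lemma continuous_on_fejer: "continuous_on UNIV (fejer \<gamma> N)"
  unfolding fejer_def divide_inverse by (intro continuous_intros)

lemma integrable_fejer: "integrable circle_measure (fejer \<gamma> N)"
  by (rule integrable_circle_continuous [OF continuous_on_fejer])

lemma fejer_diff: "fejer (\<lambda>n. \<gamma> n - \<gamma>' n) N t = fejer \<gamma> N t - fejer \<gamma>' N t"
  by (simp add: fejer_def left_diff_distrib sum_subtractf diff_divide_distrib)

text \<open>The squared modulus supplies the positivity of the Fejer kernel.\<close>

lemma fejer_kernel:
  "(\<Sum>j<N. \<Sum>k<N. fexp (int j - int k) t) = of_real ((cmod (\<Sum>j<N. fexp (int j) t))\<^sup>2)"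
proof -
  have "(\<Sum>j<N. \<Sum>k<N. fexp (int j - int k) t) = (\<Sum>j<N. fexp (int j) t) * cnj (\<Sum>k<N. fexp (int k) t)"
    unfolding cnj_sum sum_product
    by (intro sum.cong refl) (simp add: cis_cnj cis_mult left_diff_distrib)
  then show ?thesis
    by (simp only: complex_norm_square)
qed

lemma integral_fejer_kernel:
  "(\<integral>t. (cmod (\<Sum>j<N. fexp (int j) (s - t)))\<^sup>2 \<partial>circle_measure) = 2 * pi * real N"
proof -
  have eq: "complex_of_real ((cmod (\<Sum>j<N. fexp (int j) (s - t)))\<^sup>2)
      = (\<Sum>j<N. \<Sum>k<N. fexp (int j - int k) s * fexp (int k - int j) t)" for t
    unfolding fejer_kernel [symmetric]
    by (intro sum.cong refl) (simp add: cis_mult algebra_simps)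
  have "complex_of_real (\<integral>t. (cmod (\<Sum>j<N. fexp (int j) (s - t)))\<^sup>2 \<partial>circle_measure)
      = (\<integral>t. (\<Sum>j<N. \<Sum>k<N. fexp (int j - int k) s * fexp (int k - int j) t) \<partial>circle_measure)"
    unfolding eq [symmetric] by (rule integral_complex_of_real [symmetric])
  also have "\<dots> = (\<Sum>j<N. \<Sum>k<N. fexp (int j - int k) s * of_real (if int k - int j = 0 then 2 * pi else 0))"
    by (simp add: Bochner_Integration.integral_sum integrable_fexp integral_fexp
        del: of_int_diff of_int_of_nat_eq)
  also have "\<dots> = (\<Sum>j<N. \<Sum>k<N. of_real (if k = j then 2 * pi else 0))"
    by (intro sum.cong refl) auto
  also have "\<dots> = complex_of_real (2 * pi * real N)"
    by (simp flip: of_real_sum)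
  finally show ?thesis
    by (simp only: of_real_eq_iff)
qed

text \<open>
  By duality: \<open>\<bar>\<sigma>\<^sub>N\<bar> = h \<sigma>\<^sub>N\<close> for a measurable \<open>h\<close> of modulus at most one, and pairing
  \<open>h\<close> with \<open>\<sigma>\<^sub>N\<close> amounts to applying the functional to the Fejer mean of \<open>h\<close>, which is again
  bounded by one since the Fejer kernel is positive.
\<close>

lemma fejer_L1_bound:
  assumes \<gamma>: "trig_bounded \<gamma> C" and N: "N > 0"
  shows "(\<integral>t. cmod (fejer \<gamma> N t) \<partial>circle_measure) \<le> C"
proof -
  \<comment> \<open>The conjugate phase of the mean; \<open>inverse 0 = 0\<close> sets
    \<open>h\<close> to zero where the mean vanishes.\<close>
  define h where "h = (\<lambda>t. cnj (fejer \<gamma> N t) * of_real (inverse (cmod (fejer \<gamma> N t))))"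
  define K where "K = 2 * pi * real N"
  have K: "K > 0" using N by (simp add: K_def)
  have m1 [measurable]: "(\<lambda>t. cnj (fejer \<gamma> N t)) \<in> borel_measurable circle_measure"
    by (intro borel_measurable_integrable integrable_circle_continuous continuous_intros continuous_on_fejer)
  have m2 [measurable]: "(\<lambda>t. cmod (fejer \<gamma> N t)) \<in> borel_measurable circle_measure"
    by (intro borel_measurable_integrable integrable_circle_continuous continuous_intros continuous_on_fejer)
  have mh: "h \<in> borel_measurable circle_measure"
    unfolding h_def by measurable
  have h1: "cmod (h t) \<le> 1" for t
    by (cases "fejer \<gamma> N t = 0") (simp_all add: h_def norm_mult norm_inverse)
  have ih: "integrable circle_measure h"
  proof -
    interpret finite_measure circle_measure by (rule finite_measure_circle)
    show ?thesis by (rule integrable_const_bound [of _ 1]) (use mh h1 in auto)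
  qed
  have ihe: "integrable circle_measure (\<lambda>t. h t * fexp n t)" for n
    using integrable_fexp_mult [OF ih, of n] by (simp add: mult.commute)
  have hf: "complex_of_real (cmod (fejer \<gamma> N t)) = h t * fejer \<gamma> N t" for t
  proof -
    have "h t * fejer \<gamma> N t = fejer \<gamma> N t * cnj (fejer \<gamma> N t) * of_real (inverse (cmod (fejer \<gamma> N t)))"
      by (simp add: h_def mult_ac)
    also have "\<dots> = of_real ((cmod (fejer \<gamma> N t))\<^sup>2 * inverse (cmod (fejer \<gamma> N t)))"
      unfolding complex_norm_square [symmetric] of_real_mult ..
    finally show ?thesis
      by (cases "fejer \<gamma> N t = 0") (simp_all add: power2_eq_square)
  qed
  \<comment> \<open>With these coefficients the sum against \<open>\<gamma>\<close> is the integral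
    of \<open>h\<close> times the mean, and the sum against \<open>fexp\<close> is the Fejer mean of
    \<open>h\<close>.\<close>
  define g where "g = (\<lambda>(j, k). (\<integral>t. h t * fexp (int k - int j) t \<partial>circle_measure) / K)"
  have "complex_of_real (\<integral>t. cmod (fejer \<gamma> N t) \<partial>circle_measure) = (\<integral>t. h t * fejer \<gamma> N t \<partial>circle_measure)"
    unfolding hf [symmetric] by (rule integral_complex_of_real [symmetric])
  also have "\<dots> = (\<integral>t. (\<Sum>j<N. \<Sum>k<N. \<gamma> (int j - int k) / K * (h t * fexp (int k - int j) t)) \<partial>circle_measure)"
    by (intro Bochner_Integration.integral_cong refl)
      (simp add: fejer_def K_def sum_distrib_left sum_divide_distrib mult_ac del: of_int_diff of_int_of_nat_eq)
  also have "\<dots> = (\<Sum>j<N. \<Sum>k<N. \<gamma> (int j - int k) / K * (\<integral>t. h t * fexp (int k - int j) t \<partial>circle_measure))"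
    by (simp add: Bochner_Integration.integral_sum ihe del: of_int_diff of_int_of_nat_eq)
  also have "\<dots> = (\<Sum>i\<in>{..<N} \<times> {..<N}. g i * \<gamma> (int (fst i) - int (snd i)))"
    by (simp add: sum.cartesian_product g_def case_prod_unfold mult_ac)
  finally have 1: "complex_of_real (\<integral>t. cmod (fejer \<gamma> N t) \<partial>circle_measure)
      = (\<Sum>i\<in>{..<N} \<times> {..<N}. g i * \<gamma> (int (fst i) - int (snd i)))" .
  have "cmod (\<Sum>i\<in>{..<N} \<times> {..<N}. g i * \<gamma> (int (fst i) - int (snd i))) \<le> C * 1"
  proof (rule trig_bounded_family [OF \<gamma>])
    fix s
    define F where "F = (\<lambda>t. (cmod (\<Sum>j<N. fexp (int j) (s - t)))\<^sup>2)"
    have Fc: "continuous_on UNIV F"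
      unfolding F_def by (intro continuous_intros)
    have Fe: "complex_of_real (F t) = (\<Sum>j<N. \<Sum>k<N. fexp (int k - int j) t * fexp (int j - int k) s)" for t
      unfolding F_def fejer_kernel [symmetric]
      by (intro sum.cong refl) (simp add: cis_mult algebra_simps)
    have "(\<Sum>i\<in>{..<N} \<times> {..<N}. g i * fexp (int (fst i) - int (snd i)) s)
        = (\<Sum>j<N. \<Sum>k<N. (\<integral>t. h t * fexp (int k - int j) t \<partial>circle_measure) * (fexp (int j - int k) s / K))"
      by (simp add: sum.cartesian_product g_def case_prod_unfold del: of_int_diff of_int_of_nat_eq)
    also have "\<dots> = (\<integral>t. (\<Sum>j<N. \<Sum>k<N. h t * fexp (int k - int j) t * (fexp (int j - int k) s / K)) \<partial>circle_measure)"
      by (simp add: Bochner_Integration.integral_sum ihe del: of_int_diff of_int_of_nat_eq)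
    also have "\<dots> = (\<integral>t. h t * of_real (F t / K) \<partial>circle_measure)"
      by (intro Bochner_Integration.integral_cong refl)
        (simp add: Fe sum_distrib_left sum_divide_distrib mult_ac del: of_int_diff of_int_of_nat_eq)
    finally have "cmod (\<Sum>i\<in>{..<N} \<times> {..<N}. g i * fexp (int (fst i) - int (snd i)) s)
        = cmod (\<integral>t. h t * of_real (F t / K) \<partial>circle_measure)" by simp
    also have "\<dots> \<le> (\<integral>t. cmod (h t * of_real (F t / K)) \<partial>circle_measure)"
      by (rule integral_norm_bound)
    also have "\<dots> \<le> (\<integral>t. F t / K \<partial>circle_measure)"
    proof (rule integral_mono')
      show "integrable circle_measure (\<lambda>t. F t / K)"
        using Fc K by (intro integrable_circle_continuous continuous_intros) auto
      show "cmod (h t * of_real (F t / K)) \<le> F t / K" for t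
        using mult_right_mono [OF h1, of "F t / K" t] K by (simp add: norm_mult F_def norm_divide norm_power)
    qed (use K in \<open>simp add: F_def\<close>)
    also have "\<dots> = 1"
      using N integral_fejer_kernel [of s N] by (simp add: F_def K_def)
    finally show "cmod (\<Sum>i\<in>{..<N} \<times> {..<N}. g i * fexp (int (fst i) - int (snd i)) s) \<le> 1" .
  qed simp
  then show ?thesis
    unfolding 1 [symmetric] norm_of_real by simp
qed

text \<open>Equal to \<open>max 0 (N - \<bar>n\<bar>)\<close>, the number of ways to write
  \<open>n\<close> as a difference of indices below \<open>N\<close>.\<close>

definition overlap :: "nat \<Rightarrow> int \<Rightarrow> nat" where
  "overlap N n = card {k \<in> {..<N}. int k + n \<in> {0..<int N}}"

lemma overlap_le: "overlap N n \<le> N"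
  unfolding overlap_def using card_mono [of "{..<N}" "{k \<in> {..<N}. int k + n \<in> {0..<int N}}"] by auto

lemma overlap_ratio: "(\<lambda>N. real (overlap N n) / real N) \<longlonglongrightarrow> 1"
proof (rule tendsto_sandwich)
  let ?m = "nat \<bar>n\<bar>"
  show "eventually (\<lambda>N. 1 - 2 * real ?m / real N \<le> real (overlap N n) / real N) sequentially"
    using eventually_gt_at_top [of "2 * ?m"]
  proof eventually_elim
    case (elim N)
    have "{?m..<N - ?m} \<subseteq> {k \<in> {..<N}. int k + n \<in> {0..<int N}}"
      by auto
    then have "card {?m..<N - ?m} \<le> overlap N n"
      unfolding overlap_def by (intro card_mono) auto
    then have "real N - 2 * real ?m \<le> real (overlap N n)"
      using elim by simp
    moreover have "1 - 2 * real ?m / real N = (real N - 2 * real ?m) / real N"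
      using elim by (simp add: diff_divide_distrib)
    ultimately show ?case
      by (simp add: divide_right_mono)
  qed
  show "eventually (\<lambda>N. real (overlap N n) / real N \<le> 1) sequentially"
    by (rule always_eventually) (auto simp: divide_le_eq_1 overlap_le)
  have "(\<lambda>N. 1 - 2 * real ?m / real N) \<longlonglongrightarrow> 1 - 0"
    by (intro tendsto_intros lim_const_over_n)
  then show "(\<lambda>N. 1 - 2 * real ?m / real N) \<longlonglongrightarrow> 1" by simp
qed simp

text \<open>\<open>S\<close> may exceed the range of the differences because the overlap vanishes
  outside it; this freedom later provides common index sets.\<close>

lemma fejer_sum_regroup:
  assumes "finite S" "{- int N<..<int N} \<subseteq> S"
  shows "(\<Sum>j<N. \<Sum>k<N. F (int j - int k)) = (\<Sum>n\<in>S. of_nat (overlap N n) * (F n :: complex))"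
proof -
  have "(\<Sum>j<N. \<Sum>k<N. F (int j - int k)) = (\<Sum>k<N. \<Sum>j<N. F (int j - int k))"
    by (rule sum.swap)
  also have "\<dots> = (\<Sum>k<N. \<Sum>n\<in>S. if int k + n \<in> {0..<int N} then F n else 0)"
  proof (intro sum.cong refl)
    fix k assume k: "k \<in> {..<N}"
    have "(\<Sum>j<N. F (int j - int k)) = (\<Sum>n\<in>{n \<in> S. int k + n \<in> {0..<int N}}. F n)"
      by (rule sum.reindex_bij_witness [where i = "\<lambda>n. nat (int k + n)" and j = "\<lambda>j. int j - int k"])
        (use k assms in \<open>auto simp: subset_iff\<close>)
    also have "\<dots> = (\<Sum>n\<in>S. if int k + n \<in> {0..<int N} then F n else 0)"
      by (rule sum.inter_filter [OF assms(1)])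
    finally show "(\<Sum>j<N. F (int j - int k)) = (\<Sum>n\<in>S. if int k + n \<in> {0..<int N} then F n else 0)" .
  qed
  also have "\<dots> = (\<Sum>n\<in>S. \<Sum>k<N. if int k + n \<in> {0..<int N} then F n else 0)"
    by (rule sum.swap)
  also have "\<dots> = (\<Sum>n\<in>S. of_nat (overlap N n) * F n)"
    by (intro sum.cong refl) (simp add: overlap_def sum.inter_filter [symmetric] del: atLeastLessThan_iff)
  finally show ?thesis .
qed

lemma fejer_eq_sum:
  assumes "finite S" "{- int N<..<int N} \<subseteq> S"
  shows "fejer \<gamma> N t = (\<Sum>n\<in>S. of_real (real (overlap N n) / real N) * \<gamma> n * fexp (- n) t) / (2 * pi)"
proof -
  have "fejer \<gamma> N t = (\<Sum>j<N. \<Sum>k<N. \<gamma> (int j - int k) * fexp (- (int j - int k)) t) / (2 * pi * of_nat N)"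
    by (simp add: fejer_def)
  also have "(\<Sum>j<N. \<Sum>k<N. \<gamma> (int j - int k) * fexp (- (int j - int k)) t)
      = (\<Sum>n\<in>S. of_nat (overlap N n) * (\<gamma> n * fexp (- n) t))"
    by (rule fejer_sum_regroup [OF assms])
  finally show ?thesis
    by (simp add: sum_divide_distrib mult_ac)
qed

lemma fejer_coeff:
  "(\<integral>t. fexp n t * fejer \<gamma> N t \<partial>circle_measure) = of_real (real (overlap N n) / real N) * \<gamma> n"
proof -
  \<comment> \<open>Inserting \<open>n\<close> guarantees that the orthogonality sum contains its
    diagonal term even for frequencies outside the range of the mean.\<close>
  define S where "S = insert n {- int N<..<int N}"
  have S: "finite S" "{- int N<..<int N} \<subseteq> S" by (auto simp: S_def)
  have key: "cis (t * of_int (n - m)) = cis (t * of_int n) * cis (- (t * of_int m))" for m t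
    by (simp add: cis_mult algebra_simps)
  have "(\<integral>t. fexp n t * fejer \<gamma> N t \<partial>circle_measure)
      = (\<integral>t. (\<Sum>m\<in>S. of_real (real (overlap N m) / real N) * \<gamma> m / (2 * pi) * fexp (n - m) t) \<partial>circle_measure)"
    unfolding fejer_eq_sum [OF S]
    by (intro Bochner_Integration.integral_cong refl)
      (simp add: sum_distrib_left sum_divide_distrib key mult_ac del: of_int_diff)
  also have "\<dots> = (\<Sum>m\<in>S. of_real (real (overlap N m) / real N) * \<gamma> m / (2 * pi) * of_real (if n - m = 0 then 2 * pi else 0))"
    by (simp add: Bochner_Integration.integral_sum integrable_fexp integral_fexp del: of_int_diff)
  also have "\<dots> = (\<Sum>m\<in>S. if m = n then of_real (real (overlap N n) / real N) * \<gamma> n else 0)"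
    by (intro sum.cong refl) auto
  also have "\<dots> = of_real (real (overlap N n) / real N) * \<gamma> n"
    using S by (simp add: S_def)
  finally show ?thesis .
qed

lemma trig_sum_L2:
  assumes "finite S"
  shows "(\<integral>t. (cmod (\<Sum>n\<in>S. a n * fexp (- n) t))\<^sup>2 \<partial>circle_measure) = 2 * pi * (\<Sum>n\<in>S. (cmod (a n))\<^sup>2)"
proof -
  have "complex_of_real ((cmod (\<Sum>n\<in>S. a n * fexp (- n) t))\<^sup>2) = (\<Sum>n\<in>S. \<Sum>m\<in>S. a n * cnj (a m) * fexp (m - n) t)" for t
    unfolding complex_norm_square cnj_sum sum_product
  proof (intro sum.cong refl)
    fix n m
    have "fexp (m - n) t = fexp (- n) t * cnj (fexp (- m) t)"
      by (simp add: cis_cnj cis_mult algebra_simps)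
    then show "a n * fexp (- n) t * cnj (a m * fexp (- m) t) = a n * cnj (a m) * fexp (m - n) t"
      by (simp only: complex_cnj_mult mult_ac)
  qed
  then have "complex_of_real (\<integral>t. (cmod (\<Sum>n\<in>S. a n * fexp (- n) t))\<^sup>2 \<partial>circle_measure)
      = (\<integral>t. (\<Sum>n\<in>S. \<Sum>m\<in>S. a n * cnj (a m) * fexp (m - n) t) \<partial>circle_measure)"
    by (subst integral_complex_of_real [symmetric]) simp
  also have "\<dots> = (\<Sum>n\<in>S. \<Sum>m\<in>S. a n * cnj (a m) * of_real (if m - n = 0 then 2 * pi else 0))"
    by (simp add: Bochner_Integration.integral_sum integrable_fexp integral_fexp del: of_int_diff)
  also have "\<dots> = (\<Sum>n\<in>S. \<Sum>m\<in>S. if m = n then 2 * pi * (a n * cnj (a n)) else 0)"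
    by (intro sum.cong refl) auto
  also have "\<dots> = (\<Sum>n\<in>S. 2 * pi * (a n * cnj (a n)))"
    using assms by simp
  also have "\<dots> = complex_of_real (2 * pi * (\<Sum>n\<in>S. (cmod (a n))\<^sup>2))"
    unfolding of_real_mult of_real_sum complex_norm_square sum_distrib_left by simp
  finally show ?thesis
    by (simp only: of_real_eq_iff)
qed

section \<open>Convergence of Fejer means and representation by an integrable function\<close>

text \<open>The pointwise inequality \<open>x \<le> \<delta>/2 + x^2/(2 \<delta>)\<close>,
  integrated over a circle of length \<open>2 \<pi>\<close>; the parameter is tuned by the user of
  the lemma.\<close>

lemma L1_le_L2:
  fixes f :: "real \<Rightarrow> complex"
  assumes f: "continuous_on UNIV f" and \<delta>: "\<delta> > 0"
  shows "(\<integral>t. cmod (f t) \<partial>circle_measure) \<le> pi * \<delta> + (\<integral>t. (cmod (f t))\<^sup>2 \<partial>circle_measure) / (2 * \<delta>)"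
proof -
  interpret finite_measure circle_measure by (rule finite_measure_circle)
  have i1: "integrable circle_measure (\<lambda>t. cmod (f t))" and i2: "integrable circle_measure (\<lambda>t. (cmod (f t))\<^sup>2)"
    by (intro integrable_circle_continuous continuous_intros f)+
  have "(\<integral>t. cmod (f t) \<partial>circle_measure) \<le> (\<integral>t. \<delta> / 2 + (cmod (f t))\<^sup>2 / (2 * \<delta>) \<partial>circle_measure)"
  proof (rule integral_mono)
    show "cmod (f t) \<le> \<delta> / 2 + (cmod (f t))\<^sup>2 / (2 * \<delta>)" for t
      using sum_squares_bound [of \<delta> "cmod (f t)"] \<delta> by (simp add: field_simps power2_eq_square)
  qed (auto intro!: i1 i2)
  also have "\<dots> = pi * \<delta> + (\<integral>t. (cmod (f t))\<^sup>2 \<partial>circle_measure) / (2 * \<delta>)"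
    using i2 \<delta> by simp
  finally show ?thesis .
qed

text \<open>Riesz-Fischer: an almost everywhere convergent subsequence defines the limit, and
  Fatou's lemma carries the Cauchy estimate over to it.\<close>

lemma L1_complete:
  fixes s :: "nat \<Rightarrow> 'a \<Rightarrow> complex"
  assumes s: "\<And>n. integrable M (s n)"
    and cauchy: "\<And>e. e > 0 \<Longrightarrow> \<exists>N. \<forall>i\<ge>N. \<forall>j\<ge>N. (\<integral>x. norm (s i x - s j x) \<partial>M) < e"
  obtains u where "integrable M u" "(\<lambda>n. \<integral>x. norm (u x - s n x) \<partial>M) \<longlonglongrightarrow> 0"
proof -
  obtain r where r: "strict_mono r" "AE x in M. Cauchy (\<lambda>i. s (r i) x)"
    by (rule cauchy_L1_AE_cauchy_subseq [OF s cauchy]) blast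
  define u where "u = (\<lambda>x. lim (\<lambda>i. s (r i) x))"
  have ms [measurable]: "s n \<in> borel_measurable M" for n
    by (rule borel_measurable_integrable [OF s])
  have mu [measurable]: "u \<in> borel_measurable M"
    unfolding u_def by measurable
  have bound: "\<exists>N. \<forall>n\<ge>N. (\<integral>\<^sup>+x. ennreal (norm (u x - s n x)) \<partial>M) \<le> ennreal e" if e: "e > 0" for e
  proof -
    obtain N where N: "\<And>i j. i \<ge> N \<Longrightarrow> j \<ge> N \<Longrightarrow> (\<integral>x. norm (s i x - s j x) \<partial>M) < e"
      using cauchy [OF e] by blast
    have "(\<integral>\<^sup>+x. ennreal (norm (u x - s n x)) \<partial>M) \<le> ennreal e" if n: "n \<ge> N" for n
    proof -
      have "AE x in M. ennreal (norm (u x - s n x)) = liminf (\<lambda>k. ennreal (norm (s (r k) x - s n x)))"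
        using r(2)
      proof eventually_elim
        case (elim x)
        then have "(\<lambda>k. s (r k) x) \<longlonglongrightarrow> u x"
          by (simp add: u_def Cauchy_convergent_iff convergent_LIMSEQ_iff)
        then have "(\<lambda>k. ennreal (norm (s (r k) x - s n x))) \<longlonglongrightarrow> ennreal (norm (u x - s n x))"
          by (intro tendsto_intros tendsto_ennrealI)
        then show ?case
          by (intro lim_imp_Liminf [symmetric]) auto
      qed
      then have "(\<integral>\<^sup>+x. ennreal (norm (u x - s n x)) \<partial>M)
          = (\<integral>\<^sup>+x. liminf (\<lambda>k. ennreal (norm (s (r k) x - s n x))) \<partial>M)"
        by (rule nn_integral_cong_AE)
      also have "\<dots> \<le> liminf (\<lambda>k. \<integral>\<^sup>+x. ennreal (norm (s (r k) x - s n x)) \<partial>M)"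
        by (rule nn_integral_liminf) measurable
      also have "\<dots> \<le> limsup (\<lambda>k. \<integral>\<^sup>+x. ennreal (norm (s (r k) x - s n x)) \<partial>M)"
        by (rule Liminf_le_Limsup) simp
      also have "\<dots> \<le> ennreal e"
      proof (rule Limsup_bounded)
        show "eventually (\<lambda>k. (\<integral>\<^sup>+x. ennreal (norm (s (r k) x - s n x)) \<partial>M) \<le> ennreal e) sequentially"
          using eventually_ge_at_top [of N]
        proof eventually_elim
          case (elim k)
          have "r k \<ge> N"
            using elim strict_mono_imp_increasing [OF r(1), of k] by simp
          then have "(\<integral>x. norm (s (r k) x - s n x) \<partial>M) \<le> e"
            using N [of "r k" n] n by simp
          then show ?case
            by (subst nn_integral_eq_integral) (auto intro!: s ennreal_leI)
        qed
      qed
      finally show ?thesis .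
    qed
    then show ?thesis by blast
  qed
  have iu: "integrable M u"
  proof -
    obtain N where "(\<integral>\<^sup>+x. ennreal (norm (u x - s N x)) \<partial>M) \<le> ennreal 1"
      using bound [of 1] by auto
    then have "(\<integral>\<^sup>+x. ennreal (norm (u x - s N x)) \<partial>M) < \<infinity>"
      by (rule order_le_less_trans) simp
    then have "integrable M (\<lambda>x. u x - s N x)"
      by (intro integrableI_bounded) simp_all
    from Bochner_Integration.integrable_add [OF this s [of N]] show ?thesis by simp
  qed
  have "(\<lambda>n. \<integral>x. norm (u x - s n x) \<partial>M) \<longlonglongrightarrow> 0"
  proof (rule LIMSEQ_I)
    fix e :: real assume e: "e > 0"
    then obtain N where N: "\<And>n. n \<ge> N \<Longrightarrow> (\<integral>\<^sup>+x. ennreal (norm (u x - s n x)) \<partial>M) \<le> ennreal (e / 2)"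
      using bound [of "e / 2"] by auto
    have "norm ((\<integral>x. norm (u x - s n x) \<partial>M) - 0) < e" if "n \<ge> N" for n
    proof -
      have "ennreal (\<integral>x. norm (u x - s n x) \<partial>M) \<le> ennreal (e / 2)"
        using N [OF that] by (subst (asm) nn_integral_eq_integral) (auto intro!: iu s)
      then have "(\<integral>x. norm (u x - s n x) \<partial>M) \<le> e / 2"
        using e by (simp add: ennreal_le_iff)
      then show ?thesis
        using e by (simp add: abs_of_nonneg)
    qed
    then show "\<exists>N. \<forall>n\<ge>N. norm ((\<integral>x. norm (u x - s n x) \<partial>M) - 0) < e" by blast
  qed
  with iu show ?thesis by (rule that)
qed

text \<open>\<open>g\<close> is the Fourier series truncated to finitely many frequencies, near all
  late means. A common neighbour is enough for the Cauchy property, so the limit need not be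
  identified.\<close>

lemma fejer_square_summable:
  assumes \<gamma>: "(\<lambda>n. (cmod (\<gamma> n))\<^sup>2) summable_on (UNIV :: int set)" and \<epsilon>: "\<epsilon> > 0"
  obtains g N0 where "continuous_on UNIV g" "\<And>N. N \<ge> N0 \<Longrightarrow> (\<integral>t. cmod (fejer \<gamma> N t - g t) \<partial>circle_measure) \<le> \<epsilon>"
proof -
  \<comment> \<open>Makes \<open>\<pi> \<delta>\<close> equal to \<open>\<epsilon>/2\<close>; with
    \<open>\<kappa> = \<epsilon> \<delta>\<close> the quadratic term
    \<open>\<kappa>/(2 \<delta>)\<close> is the other half.\<close>
  define \<delta> where "\<delta> = \<epsilon> / (2 * pi)"
  define \<kappa> where "\<kappa> = \<epsilon> * \<delta>"
  have \<delta>: "\<delta> > 0" and \<kappa>: "\<kappa> > 0" using \<epsilon> by (auto simp: \<delta>_def \<kappa>_def)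
  let ?f = "\<lambda>n. (cmod (\<gamma> n))\<^sup>2"
  obtain F where F: "finite F" "dist (sum ?f F) (infsum ?f UNIV) \<le> \<kappa> / 2"
    using infsum_finite_approximation [OF \<gamma>, of "\<kappa> / 2"] \<kappa> by auto
  have tail: "sum ?f G \<le> \<kappa> / 2" if G: "finite G" "G \<inter> F = {}" for G
  proof -
    have "sum ?f F + sum ?f G = sum ?f (F \<union> G)"
      using F G by (subst sum.union_disjoint) auto
    also have "\<dots> \<le> infsum ?f UNIV"
      using F G by (intro finite_sum_le_infsum \<gamma>) auto
    finally show ?thesis
      using F(2) unfolding dist_real_def by linarith
  qed
  define w where "w = (\<lambda>N n. real (overlap N n) / real N)"
  have w01: "0 \<le> w N n" "w N n \<le> 1" for N n
    using overlap_le [of N n] by (auto simp: w_def divide_le_eq_1)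
  have "(\<lambda>N. \<Sum>n\<in>F. (w N n - 1)\<^sup>2 * ?f n) \<longlonglongrightarrow> (\<Sum>n\<in>F. (1 - 1)\<^sup>2 * ?f n)"
    unfolding w_def by (intro tendsto_intros overlap_ratio)
  then have "eventually (\<lambda>N. (\<Sum>n\<in>F. (w N n - 1)\<^sup>2 * ?f n) < \<kappa> / 2) sequentially"
    using \<kappa> by (intro order_tendstoD) auto
  then obtain N0 where N0: "\<And>N. N \<ge> N0 \<Longrightarrow> (\<Sum>n\<in>F. (w N n - 1)\<^sup>2 * ?f n) < \<kappa> / 2"
    by (auto simp: eventually_sequentially)
  define g where "g = (\<lambda>t. (\<Sum>n\<in>F. \<gamma> n * fexp (- n) t) / (2 * pi))"
  have gc: "continuous_on UNIV g"
    unfolding g_def divide_inverse by (intro continuous_intros)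
  have "(\<integral>t. cmod (fejer \<gamma> N t - g t) \<partial>circle_measure) \<le> \<epsilon>" if N: "N \<ge> N0" for N
  proof -
    define S where "S = F \<union> {- int N<..<int N}"
    have S: "finite S" "{- int N<..<int N} \<subseteq> S" "F \<subseteq> S" using F by (auto simp: S_def)
    \<comment> \<open>The error weight: on \<open>F\<close> the defect of the Fejer weight from one,
      elsewhere the weight itself, which is at most one and meets only the small tail.\<close>
    define v where "v = (\<lambda>n. w N n - (if n \<in> F then 1 else 0))"
    define a where "a = (\<lambda>n. of_real (v n) * \<gamma> n / (2 * pi))"
    have eq: "fejer \<gamma> N t - g t = (\<Sum>n\<in>S. a n * fexp (- n) t)" for t
    proof -
      have "(\<Sum>n\<in>F. \<gamma> n * fexp (- n) t) = (\<Sum>n\<in>S. (if n \<in> F then 1 else 0) * \<gamma> n * fexp (- n) t)"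
        by (rule sum.mono_neutral_cong_left) (use S in auto)
      then have "fejer \<gamma> N t - g t = ((\<Sum>n\<in>S. of_real (w N n) * \<gamma> n * fexp (- n) t)
          - (\<Sum>n\<in>S. (if n \<in> F then 1 else 0) * \<gamma> n * fexp (- n) t)) / (2 * pi)"
        unfolding fejer_eq_sum [OF S(1,2)] g_def w_def diff_divide_distrib by (simp only:)
      also have "\<dots> = (\<Sum>n\<in>S. a n * fexp (- n) t)"
        unfolding sum_subtractf [symmetric] sum_divide_distrib
        by (intro sum.cong refl) (simp add: a_def v_def algebra_simps diff_divide_distrib)
      finally show ?thesis .
    qed
    have "(\<integral>t. (cmod (fejer \<gamma> N t - g t))\<^sup>2 \<partial>circle_measure) = 2 * pi * (\<Sum>n\<in>S. (cmod (a n))\<^sup>2)"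
      unfolding eq by (rule trig_sum_L2 [OF S(1)])
    also have "\<dots> = (\<Sum>n\<in>S. (v n)\<^sup>2 * ?f n) / (2 * pi)"
    proof -
      have "2 * pi * (cmod (a n))\<^sup>2 = (v n)\<^sup>2 * ?f n / (2 * pi)" for n
      proof -
        have "(cmod (a n))\<^sup>2 = (v n)\<^sup>2 * ?f n / (2 * pi)\<^sup>2"
          by (simp add: a_def norm_mult norm_divide power_mult_distrib power_divide)
        then show ?thesis by (simp add: power2_eq_square)
      qed
      then show ?thesis by (simp add: sum_distrib_left sum_divide_distrib)
    qed
    also have "\<dots> \<le> (\<Sum>n\<in>S. (v n)\<^sup>2 * ?f n) / 1"
      using pi_ge_two by (intro divide_left_mono sum_nonneg) auto
    also have "\<dots> = (\<Sum>n\<in>F. (v n)\<^sup>2 * ?f n) + (\<Sum>n\<in>S - F. (v n)\<^sup>2 * ?f n)"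
      using sum.subset_diff [OF S(3) S(1)] by (simp add: add.commute)
    also have "\<dots> \<le> \<kappa> / 2 + \<kappa> / 2"
    proof (rule add_mono)
      show "(\<Sum>n\<in>F. (v n)\<^sup>2 * ?f n) \<le> \<kappa> / 2"
        using N0 [OF N] by (simp add: v_def)
      have "(\<Sum>n\<in>S - F. (v n)\<^sup>2 * ?f n) \<le> (\<Sum>n\<in>S - F. 1 * ?f n)"
        using w01 by (intro sum_mono mult_right_mono) (auto simp: v_def power_le_one)
      also have "\<dots> \<le> \<kappa> / 2"
        using tail [of "S - F"] S by auto
      finally show "(\<Sum>n\<in>S - F. (v n)\<^sup>2 * ?f n) \<le> \<kappa> / 2" .
    qed
    finally have L2: "(\<integral>t. (cmod (fejer \<gamma> N t - g t))\<^sup>2 \<partial>circle_measure) \<le> \<kappa>" by simp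
    have "(\<integral>t. cmod (fejer \<gamma> N t - g t) \<partial>circle_measure)
        \<le> pi * \<delta> + (\<integral>t. (cmod (fejer \<gamma> N t - g t))\<^sup>2 \<partial>circle_measure) / (2 * \<delta>)"
      by (intro L1_le_L2 continuous_intros continuous_on_fejer gc \<delta>)
    also have "\<dots> \<le> pi * \<delta> + \<kappa> / (2 * \<delta>)"
      using L2 \<delta> by (intro add_left_mono divide_right_mono) auto
    also have "\<dots> = \<epsilon>"
      using \<delta> by (simp add: \<kappa>_def) (simp add: \<delta>_def)
    finally show ?thesis .
  qed
  with gc show ?thesis by (rule that)
qed

text \<open>The means of \<open>\<gamma> - \<gamma>'\<close> are small uniformly in \<open>N\<close>
  by duality, and those of \<open>\<gamma>'\<close> approach a fixed function. Together the means of
  \<open>\<gamma>\<close> are Cauchy in \<open>L\<^sup>1\<close>, which rules out a singular limit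
  measure.\<close>

lemma trig_bounded_representation:
  assumes \<gamma>: "trig_bounded \<gamma> C"
    and approx: "\<And>\<epsilon>. \<epsilon> > 0 \<Longrightarrow> \<exists>\<gamma>'. trig_bounded (\<lambda>n. \<gamma> n - \<gamma>' n) \<epsilon> \<and> (\<lambda>n. (cmod (\<gamma>' n))\<^sup>2) summable_on UNIV"
  obtains \<eta> where "integrable circle_measure \<eta>" "\<And>n. (\<integral>t. fexp n t * \<eta> t \<partial>circle_measure) = \<gamma> n"
    "(\<integral>t. cmod (\<eta> t) \<partial>circle_measure) \<le> C"
proof -
  \<comment> \<open>The index is shifted because the mean of order zero is a division by zero and
    has no norm bound.\<close>
  define s where "s = (\<lambda>N. fejer \<gamma> (Suc N))"
  have isn: "integrable circle_measure (s N)" for N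
    unfolding s_def by (rule integrable_fejer)
  have "\<exists>N. \<forall>i\<ge>N. \<forall>j\<ge>N. (\<integral>t. norm (s i t - s j t) \<partial>circle_measure) < e" if e: "e > 0" for e
  proof -
    \<comment> \<open>Each mean is within \<open>e/8 + e/8\<close> of \<open>g\<close>, so two of
      them differ by at most \<open>e/2\<close>.\<close>
    obtain \<gamma>' where \<gamma>': "trig_bounded (\<lambda>n. \<gamma> n - \<gamma>' n) (e / 8)" "(\<lambda>n. (cmod (\<gamma>' n))\<^sup>2) summable_on UNIV"
      using approx [of "e / 8"] e by auto
    have e8: "e / 8 > 0" using e by simp
    obtain g N0 where g: "continuous_on UNIV g"
      and N0: "\<And>N. N \<ge> N0 \<Longrightarrow> (\<integral>t. cmod (fejer \<gamma>' N t - g t) \<partial>circle_measure) \<le> e / 8"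
      by (rule fejer_square_summable [OF \<gamma>'(2) e8]) blast
    have ig: "integrable circle_measure g"
      by (rule integrable_circle_continuous [OF g])
    have close: "(\<integral>t. cmod (s i t - g t) \<partial>circle_measure) \<le> e / 4" if i: "i \<ge> N0" for i
    proof -
      have "(\<integral>t. cmod (s i t - g t) \<partial>circle_measure)
          \<le> (\<integral>t. cmod (fejer (\<lambda>n. \<gamma> n - \<gamma>' n) (Suc i) t) + cmod (fejer \<gamma>' (Suc i) t - g t) \<partial>circle_measure)"
        by (intro integral_mono integrable_norm Bochner_Integration.integrable_add Bochner_Integration.integrable_diff isn ig integrable_fejer)
          (simp add: s_def fejer_diff norm_diff_triangle_ineq, metis norm_triangle_ineq diff_add_cancel add_diff_eq)
      also have "\<dots> = (\<integral>t. cmod (fejer (\<lambda>n. \<gamma> n - \<gamma>' n) (Suc i) t) \<partial>circle_measure)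
          + (\<integral>t. cmod (fejer \<gamma>' (Suc i) t - g t) \<partial>circle_measure)"
        by (intro Bochner_Integration.integral_add integrable_norm Bochner_Integration.integrable_diff ig integrable_fejer)
      also have "\<dots> \<le> e / 8 + e / 8"
        using i by (intro add_mono fejer_L1_bound \<gamma>' N0) auto
      finally show ?thesis by simp
    qed
    have "(\<integral>t. norm (s i t - s j t) \<partial>circle_measure) < e" if ij: "i \<ge> N0" "j \<ge> N0" for i j
    proof -
      have "(\<integral>t. norm (s i t - s j t) \<partial>circle_measure)
          \<le> (\<integral>t. cmod (s i t - g t) + cmod (s j t - g t) \<partial>circle_measure)"
      proof (intro integral_mono integrable_norm Bochner_Integration.integrable_add Bochner_Integration.integrable_diff isn ig)
        show "norm (s i t - s j t) \<le> cmod (s i t - g t) + cmod (s j t - g t)" for t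
          using norm_triangle_ineq4 [of "s i t - g t" "s j t - g t"] by simp
      qed
      also have "\<dots> = (\<integral>t. cmod (s i t - g t) \<partial>circle_measure) + (\<integral>t. cmod (s j t - g t) \<partial>circle_measure)"
        by (intro Bochner_Integration.integral_add integrable_norm Bochner_Integration.integrable_diff isn ig)
      also have "\<dots> \<le> e / 4 + e / 4"
        by (intro add_mono close ij)
      finally show ?thesis using e by simp
    qed
    then show ?thesis by blast
  qed
  then obtain \<eta> where \<eta>: "integrable circle_measure \<eta>"
    and lim: "(\<lambda>n. \<integral>t. norm (\<eta> t - s n t) \<partial>circle_measure) \<longlonglongrightarrow> 0"
    by (rule L1_complete [OF isn]) blast
  have "(\<integral>t. fexp n t * \<eta> t \<partial>circle_measure) = \<gamma> n" for n
  proof -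
    have "(\<lambda>k. (\<integral>t. fexp n t * \<eta> t \<partial>circle_measure) - (\<integral>t. fexp n t * s k t \<partial>circle_measure)) \<longlonglongrightarrow> 0"
    proof (rule Lim_null_comparison [OF _ lim], rule always_eventually, rule allI)
      fix k
      have "(\<integral>t. fexp n t * \<eta> t \<partial>circle_measure) - (\<integral>t. fexp n t * s k t \<partial>circle_measure)
          = (\<integral>t. fexp n t * (\<eta> t - s k t) \<partial>circle_measure)"
        unfolding right_diff_distrib
        by (rule Bochner_Integration.integral_diff [symmetric]) (intro integrable_fexp_mult \<eta> isn)+
      also have "cmod \<dots> \<le> (\<integral>t. cmod (fexp n t * (\<eta> t - s k t)) \<partial>circle_measure)"
        by (rule integral_norm_bound)
      finally show "norm ((\<integral>t. fexp n t * \<eta> t \<partial>circle_measure) - (\<integral>t. fexp n t * s k t \<partial>circle_measure))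
          \<le> (\<integral>t. norm (\<eta> t - s k t) \<partial>circle_measure)"
        by (simp add: norm_mult)
    qed
    moreover have "(\<lambda>k. \<integral>t. fexp n t * s k t \<partial>circle_measure) \<longlonglongrightarrow> of_real 1 * \<gamma> n"
      unfolding s_def fejer_coeff
      by (intro tendsto_intros LIMSEQ_Suc [OF overlap_ratio])
    ultimately have "(\<lambda>k. (\<integral>t. fexp n t * \<eta> t \<partial>circle_measure)) \<longlonglongrightarrow> 0 + of_real 1 * \<gamma> n"
      using tendsto_add by fastforce
    then show ?thesis
      by (simp add: LIMSEQ_const_iff)
  qed
  moreover have "(\<integral>t. cmod (\<eta> t) \<partial>circle_measure) \<le> C"
  proof -
    have "(\<integral>t. cmod (\<eta> t) \<partial>circle_measure) \<le> C + (\<integral>t. norm (\<eta> t - s k t) \<partial>circle_measure)" for k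
    proof -
      have "(\<integral>t. cmod (\<eta> t) \<partial>circle_measure) \<le> (\<integral>t. cmod (s k t) + norm (\<eta> t - s k t) \<partial>circle_measure)"
      proof (intro integral_mono integrable_norm Bochner_Integration.integrable_add Bochner_Integration.integrable_diff isn \<eta>)
        show "cmod (\<eta> t) \<le> cmod (s k t) + norm (\<eta> t - s k t)" for t
          using norm_triangle_ineq [of "s k t" "\<eta> t - s k t"] by simp
      qed
      also have "\<dots> = (\<integral>t. cmod (s k t) \<partial>circle_measure) + (\<integral>t. norm (\<eta> t - s k t) \<partial>circle_measure)"
        by (intro Bochner_Integration.integral_add integrable_norm Bochner_Integration.integrable_diff isn \<eta>)
      also have "\<dots> \<le> C + (\<integral>t. norm (\<eta> t - s k t) \<partial>circle_measure)"
        unfolding s_def by (intro add_right_mono fejer_L1_bound \<gamma>) simp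
      finally show ?thesis .
    qed
    moreover have "(\<lambda>k. C + (\<integral>t. norm (\<eta> t - s k t) \<partial>circle_measure)) \<longlonglongrightarrow> C + 0"
      by (intro tendsto_intros lim)
    ultimately show ?thesis
      using LIMSEQ_le_const [of _ "C + 0" "\<integral>t. cmod (\<eta> t) \<partial>circle_measure"] by fastforce
  qed
  ultimately show ?thesis
    using \<eta> that by blast
qed

section \<open>Uniqueness of Fourier coefficients\<close>

definition fourier_null :: "(real \<Rightarrow> complex) \<Rightarrow> bool" where
  "fourier_null h \<longleftrightarrow> integrable circle_measure h \<and> (\<forall>n. (\<integral>t. fexp n t * h t \<partial>circle_measure) = 0)"

lemma fourier_null_integrable [simp]: "fourier_null h \<Longrightarrow> integrable circle_measure h"
  by (simp add: fourier_null_def)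

lemma fourier_null_add:
  assumes "fourier_null g" "fourier_null h"
  shows "fourier_null (\<lambda>t. g t + h t)"
  unfolding fourier_null_def
proof (intro conjI allI)
  show "integrable circle_measure (\<lambda>t. g t + h t)"
    using assms by simp
  fix n
  show "(\<integral>t. fexp n t * (g t + h t) \<partial>circle_measure) = 0"
    using assms unfolding distrib_left
    by (subst Bochner_Integration.integral_add) (auto intro: integrable_fexp_mult simp: fourier_null_def)
qed

lemma fourier_null_cmult:
  assumes "fourier_null h"
  shows "fourier_null (\<lambda>t. c * h t)"
  unfolding fourier_null_def
proof (intro conjI allI)
  show "integrable circle_measure (\<lambda>t. c * h t)"
    using assms by simp
  fix n
  have "(\<integral>t. fexp n t * (c * h t) \<partial>circle_measure) = (\<integral>t. c * (fexp n t * h t) \<partial>circle_measure)"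
    by (simp add: mult.left_commute)
  then show "(\<integral>t. fexp n t * (c * h t) \<partial>circle_measure) = 0"
    using assms by (simp add: fourier_null_def)
qed

lemma fourier_null_shift:
  assumes "fourier_null h"
  shows "fourier_null (\<lambda>t. fexp m t * h t)"
  unfolding fourier_null_def
proof (intro conjI allI)
  show "integrable circle_measure (\<lambda>t. fexp m t * h t)"
    using assms by (simp add: integrable_fexp_mult)
  fix n
  have "(\<integral>t. fexp n t * (fexp m t * h t) \<partial>circle_measure) = (\<integral>t. fexp (n + m) t * h t \<partial>circle_measure)"
    by (simp only: fexp_add mult.assoc)
  then show "(\<integral>t. fexp n t * (fexp m t * h t) \<partial>circle_measure) = 0"
    using assms by (simp only: fourier_null_def)
qed

text \<open>Keeping the whole null property, for arbitrary \<open>h\<close>, instead of one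
  vanishing integral lets a product be absorbed one factor at a time. Linear functions reduce to
  sine and cosine, that is, to shifts by one.\<close>

lemma fourier_null_polynomial:
  fixes P :: "complex \<Rightarrow> real"
  assumes "real_polynomial_function P" "fourier_null h"
  shows "fourier_null (\<lambda>t. of_real (P (cis t)) * h t)"
  using assms
proof (induction arbitrary: h)
  case (linear f)
  note hyps = linear
  interpret bounded_linear f by (rule hyps(1))
  have "of_real (f (cis t)) * h t
      = of_real (f 1) * (1 / 2 * (fexp 1 t * h t + fexp (- 1) t * h t))
        + of_real (f \<i>) * (1 / (2 * \<i>) * (fexp 1 t * h t + (- 1) * (fexp (- 1) t * h t)))" for t
  proof -
    have "cis t = cos t *\<^sub>R 1 + sin t *\<^sub>R \<i>"
      by (simp add: complex_eq_iff)
    then have "f (cis t) = cos t * f 1 + sin t * f \<i>"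
      by (simp only: add scaleR real_scaleR_def)
    moreover have "complex_of_real (cos t) = 1 / 2 * (fexp 1 t + fexp (- 1) t)"
      "complex_of_real (sin t) = 1 / (2 * \<i>) * (fexp 1 t + (- 1) * fexp (- 1) t)"
      by (simp_all add: complex_eq_iff Re_divide Im_divide)
    ultimately show ?thesis
      by (simp only: of_real_add of_real_mult) (simp add: algebra_simps diff_divide_distrib add_divide_distrib)
  qed
  then show ?case
    using hyps(2) by (simp only:) (intro fourier_null_add fourier_null_cmult fourier_null_shift)
next
  case (const c)
  then show ?case by (rule fourier_null_cmult)
next
  case (add f1 f2)
  have "fourier_null (\<lambda>t. of_real (f1 (cis t)) * h t + of_real (f2 (cis t)) * h t)"
    by (intro fourier_null_add add)
  then show ?case by (simp add: distrib_right)
next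
  case (mult f1 f2)
  have "fourier_null (\<lambda>t. of_real (f1 (cis t)) * (of_real (f2 (cis t)) * h t))"
    by (intro mult)
  then show ?case by (simp add: mult.assoc)
qed

text \<open>Uniform approximation on the unit circle by real polynomials, with error measured
  against the \<open>L\<^sup>1\<close> norm of \<open>h\<close>.\<close>

lemma fourier_null_continuous:
  fixes F :: "complex \<Rightarrow> real"
  assumes F: "continuous_on UNIV F" and h: "fourier_null h"
  shows "(\<integral>t. of_real (F (cis t)) * h t \<partial>circle_measure) = 0"
proof -
  define I where "I = (\<integral>t. cmod (h t) \<partial>circle_measure)"
  have I0: "0 \<le> I" by (simp add: I_def)
  have mult: "integrable circle_measure (\<lambda>t. of_real (G (cis t)) * h t)" if G: "continuous_on UNIV G" for G :: "complex \<Rightarrow> real"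
  proof -
    have "compact (G ` sphere 0 1)"
      by (intro compact_continuous_image continuous_on_subset [OF G]) auto
    then obtain B where B: "\<And>z. z \<in> sphere 0 1 \<Longrightarrow> \<bar>G z\<bar> \<le> B"
      using compact_imp_bounded bounded_real by (metis imageI)
    have "continuous_on UNIV (\<lambda>t. complex_of_real (G (cis t)))"
      by (intro continuous_intros continuous_on_compose2 [OF G]) auto
    then have m: "(\<lambda>t. complex_of_real (G (cis t))) \<in> borel_measurable circle_measure"
      by (intro borel_measurable_integrable integrable_circle_continuous)
    show ?thesis
    proof (rule Bochner_Integration.integrable_bound)
      show "integrable circle_measure (\<lambda>t. B * cmod (h t))"
        using h by simp
      show "(\<lambda>t. of_real (G (cis t)) * h t) \<in> borel_measurable circle_measure"
        using m borel_measurable_integrable [OF fourier_null_integrable [OF h]] by (rule borel_measurable_times)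
      show "AE t in circle_measure. norm (of_real (G (cis t)) * h t) \<le> norm (B * cmod (h t))"
      proof (rule AE_I2)
        fix t
        have "\<bar>G (cis t)\<bar> \<le> B" by (rule B) simp
        then show "norm (of_real (G (cis t)) * h t) \<le> norm (B * cmod (h t))"
          by (simp add: norm_mult abs_mult mult_right_mono)
      qed
    qed
  qed
  have "cmod (\<integral>t. of_real (F (cis t)) * h t \<partial>circle_measure) \<le> 0 + e" if e: "e > 0" for e
  proof -
    define d where "d = e / (I + 1)"
    have d: "d > 0" using e I0 by (simp add: d_def)
    obtain P where P: "real_polynomial_function P" "\<And>z. z \<in> sphere 0 1 \<Longrightarrow> \<bar>F z - P z\<bar> < d"
      by (rule Stone_Weierstrass_real_polynomial_function [OF compact_sphere continuous_on_subset [OF F subset_UNIV] d]) blast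
    have Pc: "continuous_on UNIV P"
      using P(1) by (simp add: real_polynomial_function_eq continuous_on_polymonial_function)
    have "(\<integral>t. of_real (P (cis t)) * h t \<partial>circle_measure) = 0"
      using fourier_null_polynomial [OF P(1) h] unfolding fourier_null_def by (metis (no_types, lifting) Bochner_Integration.integral_cong cis_zero mult_1 mult_zero_left of_int_0)
    then have "(\<integral>t. of_real (F (cis t)) * h t \<partial>circle_measure)
        = (\<integral>t. of_real (F (cis t)) * h t - of_real (P (cis t)) * h t \<partial>circle_measure)"
      by (subst Bochner_Integration.integral_diff) (auto intro: mult F Pc)
    also have "cmod \<dots> \<le> (\<integral>t. cmod (of_real (F (cis t)) * h t - of_real (P (cis t)) * h t) \<partial>circle_measure)"
      by (rule integral_norm_bound)
    also have "\<dots> \<le> (\<integral>t. d * cmod (h t) \<partial>circle_measure)"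
    proof (rule integral_mono)
      show "integrable circle_measure (\<lambda>t. cmod (of_real (F (cis t)) * h t - of_real (P (cis t)) * h t))"
        by (intro integrable_norm Bochner_Integration.integrable_diff mult F Pc)
      show "integrable circle_measure (\<lambda>t. d * cmod (h t))"
        using h by simp
      fix t
      have "\<bar>F (cis t) - P (cis t)\<bar> \<le> d"
        using P(2) [of "cis t"] by simp
      moreover have "cmod (of_real (F (cis t)) * h t - of_real (P (cis t)) * h t) = \<bar>F (cis t) - P (cis t)\<bar> * cmod (h t)"
        unfolding left_diff_distrib [symmetric] of_real_diff [symmetric] norm_mult norm_of_real ..
      ultimately show "cmod (of_real (F (cis t)) * h t - of_real (P (cis t)) * h t) \<le> d * cmod (h t)"
        by (simp add: mult_right_mono)
    qed
    also have "\<dots> = d * I"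
      by (simp add: I_def)
    also have "\<dots> \<le> d * (I + 1)"
      using d by (intro mult_left_mono) auto
    also have "\<dots> = e"
      using I0 by (simp add: d_def)
    finally show ?thesis by simp
  qed
  then have "cmod (\<integral>t. of_real (F (cis t)) * h t \<partial>circle_measure) \<le> 0"
    by (rule field_le_epsilon)
  then show ?thesis by simp
qed

text \<open>Only the two endpoints are identified by \<open>cis\<close>, so it suffices that one of
  the points is interior.\<close>

lemma cis_inj_interior:
  assumes "0 < s" "s < 2 * pi" "0 \<le> t" "t \<le> 2 * pi" "cis s = cis t"
  shows "s = t"
proof -
  have "cis (s - t) = 1"
    using assms(5) by (simp add: cis_divide [symmetric])
  then obtain n :: int where "s - t = of_int n * (2 * pi)"
    using cos_one_2pi_int [of "s - t"] by (auto simp: complex_eq_iff mult.assoc)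
  moreover have "\<bar>s - t\<bar> < 2 * pi"
    using assms by auto
  ultimately have "\<bar>real_of_int n\<bar> * (2 * pi) < 1 * (2 * pi)"
    by (simp add: abs_mult)
  then have "\<bar>real_of_int n\<bar> < 1"
    by (rule mult_right_less_imp_less) simp
  then have "n = 0" by linarith
  then show ?thesis
    using \<open>s - t = of_int n * (2 * pi)\<close> by simp
qed

text \<open>Indicators of open sets are monotone limits of continuous functions of \<open>e\<^sup>i\<^sup>t\<close>.\<close>

lemma fourier_null_open:
  assumes h: "fourier_null h" and U: "open U"
  shows "(\<integral>t. indicator U t *\<^sub>R h t \<partial>circle_measure) = 0"
proof -
  \<comment> \<open>Removing the endpoints costs a null set and makes \<open>cis t\<close> lie
    outside the image of the complement for every \<open>t\<close> in \<open>V\<close>. It also puts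
    \<open>0\<close> into the complement, so \<open>K\<close> is nonempty and \<open>infdist\<close>
    to it is meaningful.\<close>
  define V where "V = U \<inter> {0<..<2 * pi}"
  have V: "open V" "V \<subseteq> {0<..<2 * pi}" using U by (auto simp: V_def)
  define K where "K = cis ` ({0..2 * pi} - V)"
  have "compact ({0..2 * pi} - V)"
    using V(1) by (intro compact_diff) auto
  then have "closed K"
    unfolding K_def by (intro compact_imp_closed compact_continuous_image continuous_intros)
  moreover have "0 \<in> {0..2 * pi} - V"
    using V(2) by auto
  then have "K \<noteq> {}"
    unfolding K_def by blast
  ultimately have K: "closed K" "K \<noteq> {}" .
  \<comment> \<open>Truncated multiples of the distance to \<open>K\<close>: zero on
    \<open>K\<close>, and eventually one at each point outside it.\<close>
  define F where "F = (\<lambda>k z. min 1 (real k * infdist z K))"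
  have Fc: "continuous_on UNIV (F k)" for k
    unfolding F_def by (intro continuous_intros)
  have F01: "0 \<le> F k z" "F k z \<le> 1" for k z
    by (auto simp: F_def infdist_nonneg)
  have lim: "(\<lambda>k. F k (cis t)) \<longlonglongrightarrow> indicator V t" if t: "t \<in> {0..2 * pi}" for t
  proof (cases "t \<in> V")
    case True
    have "cis t \<notin> K"
    proof
      assume "cis t \<in> K"
      then obtain s where s: "s \<in> {0..2 * pi}" "s \<notin> V" "cis t = cis s"
        by (auto simp: K_def)
      then have "t = s"
        using True V by (intro cis_inj_interior) auto
      then show False using s True by simp
    qed
    then have pos: "infdist (cis t) K > 0"
      using K in_closed_iff_infdist_zero [of K "cis t"] infdist_nonneg [of "cis t" K] by linarith
    obtain k0 :: nat where k0: "1 / infdist (cis t) K < real k0"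
      using reals_Archimedean2 by blast
    have "eventually (\<lambda>k. F k (cis t) = 1) sequentially"
      using eventually_ge_at_top [of k0]
    proof eventually_elim
      case (elim k)
      then have "1 / infdist (cis t) K \<le> real k"
        using k0 by linarith
      then have "1 \<le> real k * infdist (cis t) K"
        using pos by (simp add: divide_le_eq)
      then show ?case by (simp add: F_def)
    qed
    then show ?thesis
      using True by (simp add: tendsto_eventually)
  next
    case False
    then have "infdist (cis t) K = 0"
      using t by (intro infdist_zero) (auto simp: K_def)
    then show ?thesis
      using False by (simp add: F_def)
  qed
  have mh: "h \<in> borel_measurable circle_measure"
    by (rule borel_measurable_integrable [OF fourier_null_integrable [OF h]])
  have Vs: "V \<in> sets lebesgue" "{0..2 * pi} \<in> sets lebesgue"
    using V by auto
  have "(\<lambda>k. \<integral>t. of_real (F k (cis t)) * h t \<partial>circle_measure) \<longlonglongrightarrow> (\<integral>t. indicator V t *\<^sub>R h t \<partial>circle_measure)"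
  proof (rule integral_dominated_convergence [where w = "\<lambda>t. cmod (h t)"])
    show "(\<lambda>t. indicator V t *\<^sub>R h t) \<in> borel_measurable circle_measure"
    proof (intro borel_measurable_scaleR mh borel_measurable_indicator')
      show "{t \<in> space circle_measure. t \<in> V} \<in> sets circle_measure"
        using Vs V by (auto simp: sets_restrict_space intro!: image_eqI [of _ _ V])
    qed
    show "(\<lambda>t. of_real (F k (cis t)) * h t) \<in> borel_measurable circle_measure" for k
    proof (intro borel_measurable_times mh borel_measurable_integrable integrable_circle_continuous)
      show "continuous_on UNIV (\<lambda>t. complex_of_real (F k (cis t)))"
        by (intro continuous_intros continuous_on_compose2 [OF Fc]) auto
    qed
    show "AE t in circle_measure. (\<lambda>k. of_real (F k (cis t)) * h t) \<longlonglongrightarrow> indicator V t *\<^sub>R h t"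
      unfolding scaleR_conv_of_real
      by (rule AE_I2) (intro tendsto_intros lim, simp)
    show "AE t in circle_measure. norm (of_real (F k (cis t)) * h t) \<le> cmod (h t)" for k
      using F01 by (intro AE_I2) (simp add: norm_mult mult_left_le_one_le)
  qed (use h in simp)
  then have "(\<integral>t. indicator V t *\<^sub>R h t \<partial>circle_measure) = 0"
    by (simp add: fourier_null_continuous [OF Fc h] LIMSEQ_const_iff)
  moreover have "(\<integral>t. indicator U t *\<^sub>R h t \<partial>circle_measure) = (\<integral>t. indicator V t *\<^sub>R h t \<partial>circle_measure)"
  proof (rule integral_cong_AE)
    have "negligible {0, 2 * pi}" by simp
    then have "AE t in lebesgue. t \<notin> {0, 2 * pi}"
      unfolding negligible_iff_null_sets by (rule AE_not_in)
    then have "AE t in circle_measure. t \<notin> {0, 2 * pi}"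
      by (subst AE_restrict_space_iff) auto
    then show "AE t in circle_measure. indicator U t *\<^sub>R h t = indicator V t *\<^sub>R h t"
    proof (rule AE_mp, intro AE_I2 impI)
      fix t assume "t \<in> space circle_measure" "t \<notin> {0, 2 * pi}"
      then have "t \<in> {0<..<2 * pi}" by auto
      then show "indicator U t *\<^sub>R h t = indicator V t *\<^sub>R h t"
        by (simp add: V_def indicator_def)
    qed
    have "{t \<in> space circle_measure. t \<in> W} \<in> sets circle_measure" if "open W" for W
      using that by (auto simp: sets_restrict_space intro!: image_eqI [of _ _ W])
    then show "(\<lambda>t. indicator U t *\<^sub>R h t) \<in> borel_measurable circle_measure"
      "(\<lambda>t. indicator V t *\<^sub>R h t) \<in> borel_measurable circle_measure"
      using U V by (auto intro!: borel_measurable_scaleR mh borel_measurable_indicator')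
  qed
  ultimately show ?thesis by simp
qed

text \<open>A measurable set differs from a countable intersection of open sets by a null set.
  Finite intersections are open and decrease to it, so dominated convergence extends the vanishing
  integrals to all measurable sets.\<close>

lemma fourier_null_AE_zero:
  assumes h: "fourier_null h"
  shows "AE t in circle_measure. h t = 0"
proof -
  interpret finite_measure circle_measure by (rule finite_measure_circle)
  show ?thesis
  proof (rule density_zero [OF fourier_null_integrable [OF h]])
    fix A assume "A \<in> sets circle_measure"
    then have A: "A \<in> sets lebesgue"
      by (auto simp: sets_restrict_space)
    obtain C T where C: "gdelta C" "T \<in> null_sets lebesgue" "A \<union> T = C" "disjnt A T"
      by (rule lebesgue_set_almost_gdelta [OF A])
    obtain G :: "nat \<Rightarrow> real set" where G: "\<And>n. open (G n)" "C = \<Inter> (range G)"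
      using C(1) by (auto simp: gdelta.simps)
    define W where "W = (\<lambda>n. \<Inter>k\<le>n. G k)"
    have W: "open (W n)" for n
      unfolding W_def using G by (intro open_INT) auto
    have mh: "h \<in> borel_measurable circle_measure"
      by (rule borel_measurable_integrable [OF fourier_null_integrable [OF h]])
    have ms: "(\<lambda>t. indicator S t *\<^sub>R h t) \<in> borel_measurable circle_measure" if "S \<in> sets lebesgue" for S
    proof (intro borel_measurable_scaleR mh borel_measurable_indicator')
      show "{t \<in> space circle_measure. t \<in> S} \<in> sets circle_measure"
        using that by (auto simp: sets_restrict_space intro!: image_eqI [of _ _ S])
    qed
    have Cs: "C \<in> sets lebesgue"
      using A C(2) unfolding C(3) [symmetric] by (rule sets.Un [OF _ null_setsD2])
    have "(\<lambda>n. \<integral>t. indicator (W n) t *\<^sub>R h t \<partial>circle_measure) \<longlonglongrightarrow> (\<integral>t. indicator C t *\<^sub>R h t \<partial>circle_measure)"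
    proof (rule integral_dominated_convergence [where w = "\<lambda>t. cmod (h t)"])
      show "(\<lambda>t. indicator C t *\<^sub>R h t) \<in> borel_measurable circle_measure" by (rule ms [OF Cs])
      show "(\<lambda>t. indicator (W n) t *\<^sub>R h t) \<in> borel_measurable circle_measure" for n
        using W by (intro ms) auto
      show "AE t in circle_measure. (\<lambda>n. indicator (W n) t *\<^sub>R h t) \<longlonglongrightarrow> indicator C t *\<^sub>R h t"
      proof (intro AE_I2 tendsto_intros)
        fix t
        have "eventually (\<lambda>n. indicator (W n) t = (indicator C t :: real)) sequentially"
        proof (cases "t \<in> C")
          case True
          then show ?thesis by (auto simp: W_def G(2) indicator_def)
        next
          case False
          then obtain m where "t \<notin> G m" by (auto simp: G(2))
          then have "t \<notin> W n" if "n \<ge> m" for n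
            using that by (auto simp: W_def)
          then show ?thesis
            using False by (auto simp: eventually_sequentially indicator_def)
        qed
        then show "(\<lambda>n. indicator (W n) t) \<longlonglongrightarrow> (indicator C t :: real)"
          by (rule tendsto_eventually)
      qed
      show "AE t in circle_measure. norm (indicator (W n) t *\<^sub>R h t) \<le> cmod (h t)" for n
        by (intro AE_I2) (simp add: indicator_def)
    qed (use h in simp)
    then have "(\<integral>t. indicator C t *\<^sub>R h t \<partial>circle_measure) = 0"
      by (simp add: fourier_null_open [OF h W] LIMSEQ_const_iff)
    moreover have "(\<integral>t. indicator A t *\<^sub>R h t \<partial>circle_measure) = (\<integral>t. indicator C t *\<^sub>R h t \<partial>circle_measure)"
    proof (rule integral_cong_AE)
      have "AE t in lebesgue. t \<notin> T"
        by (rule AE_not_in [OF C(2)])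
      then have "AE t in circle_measure. t \<notin> T"
        by (subst AE_restrict_space_iff) auto
      then show "AE t in circle_measure. indicator A t *\<^sub>R h t = indicator C t *\<^sub>R h t"
        by eventually_elim (auto simp: C(3) [symmetric] indicator_def)
    qed (auto intro: ms A Cs)
    ultimately show "set_lebesgue_integral circle_measure A h = 0"
      by (simp add: set_lebesgue_integral_def)
  qed
qed

lemma fourier_coefficients_unique:
  assumes \<eta>1: "integrable circle_measure \<eta>1" and \<eta>2: "integrable circle_measure \<eta>2"
    and eq: "\<And>n. n \<noteq> 0 \<Longrightarrow> (\<integral>t. fexp n t * \<eta>1 t \<partial>circle_measure) = (\<integral>t. fexp n t * \<eta>2 t \<partial>circle_measure)"
  shows "\<exists>c. AE t in lebesgue. t \<in> {0..2 * pi} \<longrightarrow> \<eta>1 t = \<eta>2 t + c"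
proof -
  \<comment> \<open>Chosen so that the difference has mean zero; this fixes the one coefficient that
    the hypotheses leave free.\<close>
  define c where "c = ((\<integral>t. \<eta>1 t \<partial>circle_measure) - (\<integral>t. \<eta>2 t \<partial>circle_measure)) / (2 * pi)"
  define h where "h = (\<lambda>t. \<eta>1 t - \<eta>2 t - c)"
  interpret finite_measure circle_measure by (rule finite_measure_circle)
  have "fourier_null h"
    unfolding fourier_null_def
  proof (intro conjI allI)
    show "integrable circle_measure h"
      unfolding h_def by (intro Bochner_Integration.integrable_diff \<eta>1 \<eta>2 integrable_const)
    fix n
    have "(\<integral>t. fexp n t * h t \<partial>circle_measure)
        = (\<integral>t. fexp n t * \<eta>1 t - fexp n t * \<eta>2 t - fexp n t * c \<partial>circle_measure)"
      by (simp add: h_def right_diff_distrib)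
    also have "\<dots> = (\<integral>t. fexp n t * \<eta>1 t \<partial>circle_measure) - (\<integral>t. fexp n t * \<eta>2 t \<partial>circle_measure)
        - (\<integral>t. fexp n t \<partial>circle_measure) * c"
      by (simp add: integrable_fexp_mult integrable_fexp \<eta>1 \<eta>2)
    also have "\<dots> = 0"
    proof (cases "n = 0")
      case True
      then show ?thesis
        by (simp add: c_def scaleR_conv_of_real)
    next
      case False
      then show ?thesis
        using eq [OF False] by (simp add: integral_fexp)
    qed
    finally show "(\<integral>t. fexp n t * h t \<partial>circle_measure) = 0" .
  qed
  then have "AE t in circle_measure. h t = 0"
    by (rule fourier_null_AE_zero)
  then have "AE t in lebesgue. t \<in> {0..2 * pi} \<longrightarrow> h t = 0"
    by (subst (asm) AE_restrict_space_iff) auto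
  then have "AE t in lebesgue. t \<in> {0..2 * pi} \<longrightarrow> \<eta>1 t = \<eta>2 t + c"
    by (rule AE_mp) (auto simp: h_def algebra_simps)
  then show ?thesis by blast
qed

section \<open>The trace formula\<close>

text \<open>Dividing by \<open>n^2\<close> undoes two derivatives, which is possible only after
  removing the mean; the removal at most doubles the supremum, hence the factor two. At
  \<open>n = 0\<close> division by zero gives the coefficient the value zero.\<close>

lemma trig_bounded_second_antiderivative:
  assumes \<rho>: "\<And>S a B. finite S \<Longrightarrow> (\<And>t. cmod (\<Sum>n\<in>S. (of_int n)\<^sup>2 * a n * fexp n t) \<le> B) \<Longrightarrow>
      cmod (\<Sum>n\<in>S. a n * \<rho> n) \<le> c * B"
  shows "trig_bounded (\<lambda>n. - \<rho> n / (of_int n)\<^sup>2) (2 * c)"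
  unfolding trig_bounded_def
proof (intro allI impI)
  fix S g B assume S: "finite (S :: int set)" and B: "\<forall>t. cmod (\<Sum>n\<in>S. g n * fexp n t) \<le> B"
  define S' where "S' = S - {0}"
  define a where "a = (\<lambda>n. - g n / (of_int n)\<^sup>2)"
  define g0 where "g0 = (if 0 \<in> S then g 0 else 0)"
  have split: "(\<Sum>n\<in>S. F n) = (\<Sum>n\<in>S'. F n) + (if 0 \<in> S then F 0 else 0)" for F :: "int \<Rightarrow> complex"
    using S by (auto simp: S'_def sum.remove add.commute)
  \<comment> \<open>The constant coefficient is the mean of the polynomial over the circle and is
    therefore bounded by \<open>B\<close>.\<close>
  have "(\<integral>t. (\<Sum>n\<in>S. g n * fexp n t) \<partial>circle_measure) = (\<Sum>n\<in>S. g n * of_real (if n = 0 then 2 * pi else 0))"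
    by (simp add: Bochner_Integration.integral_sum integrable_fexp integral_fexp)
  also have "\<dots> = 2 * pi * g0"
    unfolding split by (simp add: S'_def g0_def)
  finally have "cmod (2 * pi * g0) \<le> 2 * pi * B"
    using integral_circle_bound [of "\<lambda>t. \<Sum>n\<in>S. g n * fexp n t" B] B
    by (simp add: integrable_fexp Bochner_Integration.integrable_sum)
  then have g0: "cmod g0 \<le> B"
    by (simp add: norm_mult)
  have "cmod (\<Sum>n\<in>S'. a n * \<rho> n) \<le> c * (2 * B)"
  proof (rule \<rho>)
    show "finite S'" using S by (simp add: S'_def)
    fix t
    have "(\<Sum>n\<in>S'. (of_int n)\<^sup>2 * a n * fexp n t) = - (\<Sum>n\<in>S'. g n * fexp n t)"
      unfolding sum_negf [symmetric] by (intro sum.cong refl) (simp add: a_def S'_def)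
    also have "\<dots> = g0 - (\<Sum>n\<in>S. g n * fexp n t)"
      unfolding split [of "\<lambda>n. g n * fexp n t"] by (simp add: g0_def)
    also have "cmod \<dots> \<le> cmod g0 + cmod (\<Sum>n\<in>S. g n * fexp n t)"
      by (rule norm_triangle_ineq4)
    also have "\<dots> \<le> B + B"
      by (intro add_mono g0 B [rule_format])
    finally show "cmod (\<Sum>n\<in>S'. (of_int n)\<^sup>2 * a n * fexp n t) \<le> 2 * B" by simp
  qed
  moreover have "(\<Sum>n\<in>S. g n * (- \<rho> n / (of_int n)\<^sup>2)) = (\<Sum>n\<in>S'. a n * \<rho> n)"
    unfolding split by (simp add: a_def)
  ultimately show "cmod (\<Sum>n\<in>S. g n * (- \<rho> n / (of_int n)\<^sup>2)) \<le> 2 * c * B"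
    by simp
qed

lemma trig_bounded_mono: "trig_bounded \<gamma> C \<Longrightarrow> C \<le> D \<Longrightarrow> trig_bounded \<gamma> D"
  unfolding trig_bounded_def by (meson mult_right_mono norm_ge_zero order_trans)

lemma summable_on_inverse_square_int: "(\<lambda>n::int. 1 / (real_of_int n)\<^sup>2) summable_on UNIV"
proof -
  have s: "(\<lambda>n::nat. 1 / (real n)\<^sup>2) summable_on UNIV"
    using inverse_power_summable [of 2, where 'a = real]
    by (intro norm_summable_imp_summable_on) (simp add: inverse_eq_divide)
  have 1: "(\<lambda>n::int. 1 / (real_of_int n)\<^sup>2) summable_on (range int)"
    using s by (subst summable_on_reindex) (auto simp: o_def)
  have 2: "(\<lambda>n::int. 1 / (real_of_int n)\<^sup>2) summable_on (range (\<lambda>n. - int n))"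
    using s by (subst summable_on_reindex) (auto simp: o_def inj_on_def)
  have "UNIV = range int \<union> range (\<lambda>n. - int n)"
    by (auto simp: image_iff) (metis int_cases2)
  then show ?thesis
    using summable_on_union [OF 1 2] by simp
qed

text \<open>The basic estimate supplies the norm bound, the estimate for two generators the
  approximability by square summable sequences.\<close>

lemma path_remainder_representation:
  assumes X: "skew_op X" "hilbert_schmidt X" and V: "unitary_op V"
  obtains \<eta> where "integrable circle_measure \<eta>"
    "\<And>n. (\<integral>t. fexp n t * \<eta> t \<partial>circle_measure) = - trace_op (path_remainder X V 1 n) / (of_int n)\<^sup>2"
    "(\<integral>t. cmod (\<eta> t) \<partial>circle_measure) \<le> pi / 2 * (hs_norm X)\<^sup>2"
proof -
  define \<rho> where "\<rho> = (\<lambda>Y n. trace_op (path_remainder Y V 1 n))"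
  have "trig_bounded (\<lambda>n. - \<rho> X n / (of_int n)\<^sup>2) (2 * (pi / 4 * (hs_norm X)\<^sup>2))"
  proof (rule trig_bounded_second_antiderivative)
    fix S :: "int set" and a B
    assume "finite S" "\<And>t. cmod (\<Sum>n\<in>S. (of_int n)\<^sup>2 * a n * fexp n t) \<le> B"
    from path_remainder_trace_le [OF X V this]
    show "cmod (\<Sum>n\<in>S. a n * \<rho> X n) \<le> pi / 4 * (hs_norm X)\<^sup>2 * B"
      by (simp add: \<rho>_def mult_ac)
  qed
  then have main: "trig_bounded (\<lambda>n. - \<rho> X n / (of_int n)\<^sup>2) (pi / 2 * (hs_norm X)\<^sup>2)"
    by (simp add: mult.assoc)
  have approx: "\<exists>\<gamma>'. trig_bounded (\<lambda>n. - \<rho> X n / (of_int n)\<^sup>2 - \<gamma>' n) \<epsilon> \<and> (\<lambda>n. (cmod (\<gamma>' n))\<^sup>2) summable_on UNIV"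
    if \<epsilon>: "\<epsilon> > 0" for \<epsilon>
  proof -
    \<comment> \<open>For \<open>d \<le> 1\<close> the approximant satisfies
      \<open>hs_norm Y \<le> hs_norm X + 1\<close>, so the sum of the norms is at most
      \<open>2 * hs_norm X + 1\<close>; \<open>M\<close> is this times the doubled constant
      \<open>\<pi>/4\<close>.\<close>
    define M where "M = pi / 2 * (2 * hs_norm X + 1)"
    define d where "d = min 1 (\<epsilon> / M)"
    have M: "M > 0"
      unfolding M_def by (intro mult_pos_pos) (auto intro: add_nonneg_pos)
    then have d: "d > 0" "d \<le> 1" "d \<le> \<epsilon> / M"
      using \<epsilon> by (auto simp: d_def)
    then have dM: "d * (pi / 2 * (2 * hs_norm X + 1)) \<le> \<epsilon>"
      using M by (simp add: pos_le_divide_eq M_def)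
    obtain Y P where Y: "skew_op Y" "hilbert_schmidt Y" and P: "hilbert_schmidt P" "Y o\<^sub>L P = Y"
      and XY: "hs_norm (X - Y) \<le> d"
      by (rule skew_finite_rank_approx [OF X d(1)]) blast
    define \<gamma>' where "\<gamma>' = (\<lambda>n. - \<rho> Y n / (of_int n)\<^sup>2)"
    define \<delta> where "\<delta> = hs_norm (X - Y) * (hs_norm X + hs_norm Y)"
    have "hs_norm Y \<le> hs_norm X + hs_norm (X - Y)"
      using hs_norm_diff_le [OF X(2) hilbert_schmidt_diff [OF X(2) Y(2)]] by simp
    then have "hs_norm X + hs_norm Y \<le> 2 * hs_norm X + 1"
      using XY d(2) by linarith
    then have "\<delta> \<le> d * (2 * hs_norm X + 1)"
      unfolding \<delta>_def using XY d(1) by (intro mult_mono) (auto intro: add_nonneg_nonneg)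
    then have "pi / 2 * \<delta> \<le> pi / 2 * (d * (2 * hs_norm X + 1))"
      by (intro mult_left_mono) auto
    also have "\<dots> = d * (pi / 2 * (2 * hs_norm X + 1))"
      by (rule mult.left_commute)
    also note dM
    finally have \<delta>: "2 * (pi / 4 * \<delta>) \<le> \<epsilon>"
      by simp
    have "trig_bounded (\<lambda>n. - (\<rho> X n - \<rho> Y n) / (of_int n)\<^sup>2) (2 * (pi / 4 * \<delta>))"
    proof (rule trig_bounded_second_antiderivative)
      fix S :: "int set" and a B
      assume "finite S" "\<And>t. cmod (\<Sum>n\<in>S. (of_int n)\<^sup>2 * a n * fexp n t) \<le> B"
      from path_remainder_trace_diff_bound [OF X Y V this]
      show "cmod (\<Sum>n\<in>S. a n * (\<rho> X n - \<rho> Y n)) \<le> pi / 4 * \<delta> * B"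
        by (simp add: \<rho>_def \<delta>_def mult_ac)
    qed
    then have "trig_bounded (\<lambda>n. - \<rho> X n / (of_int n)\<^sup>2 - \<gamma>' n) (2 * (pi / 4 * \<delta>))"
      by (simp add: \<gamma>'_def diff_divide_distrib)
    then have 1: "trig_bounded (\<lambda>n. - \<rho> X n / (of_int n)\<^sup>2 - \<gamma>' n) \<epsilon>"
      by (rule trig_bounded_mono [OF _ \<delta>])
    \<comment> \<open>Linear growth of the trace divided by \<open>n^2\<close> leaves
      \<open>K / \<bar>n\<bar>\<close>, which is square summable.\<close>
    define K where "K = 2 * hs_norm Y * hs_norm P"
    have "(cmod (\<gamma>' n))\<^sup>2 \<le> K\<^sup>2 * (1 / (real_of_int n)\<^sup>2)" for n
    proof (cases "n = 0")
      case False
      have "cmod (\<rho> Y n) \<le> K * \<bar>real_of_int n\<bar>"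
        unfolding \<rho>_def K_def by (rule path_remainder_trace_linear_growth [OF Y V P])
      then have "cmod (\<gamma>' n) \<le> K * \<bar>real_of_int n\<bar> / \<bar>real_of_int n\<bar>\<^sup>2"
        unfolding \<gamma>'_def by (simp add: norm_divide norm_power divide_right_mono)
      also have "\<dots> = K / \<bar>real_of_int n\<bar>"
      proof -
        have "K * a / a\<^sup>2 = K / a" for a :: real
          by (simp add: power2_eq_square)
        then show ?thesis .
      qed
      finally have "(cmod (\<gamma>' n))\<^sup>2 \<le> (K / \<bar>real_of_int n\<bar>)\<^sup>2"
        by (rule power_mono) simp
      then show ?thesis by (simp add: power_divide)
    qed (simp add: \<gamma>'_def)
    then have "(\<lambda>n. (cmod (\<gamma>' n))\<^sup>2) summable_on UNIV"
      by (intro summable_on_comparison_test [OF summable_on_cmult_right [OF summable_on_inverse_square_int, of "K\<^sup>2"]]) auto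
    with 1 show ?thesis by blast
  qed
  show ?thesis
  proof (rule trig_bounded_representation [OF main approx])
    fix \<eta> assume "integrable circle_measure \<eta>"
      "\<And>n. (\<integral>t. fexp n t * \<eta> t \<partial>circle_measure) = - \<rho> X n / (of_int n)\<^sup>2"
      "(\<integral>t. cmod (\<eta> t) \<partial>circle_measure) \<le> pi / 2 * (hs_norm X)\<^sup>2"
    then show ?thesis
      using that [of \<eta>] by (simp add: \<rho>_def)
  qed
qed

section \<open>Reduction of the trace formula to Fourier coefficients\<close>

lemma second_deriv_circle_eq:
  "second_deriv_circle a t = (\<Sum>r | a r \<noteq> 0. - (of_int r)\<^sup>2 * a r * fexp r t)"
proof -
  have d: "((\<lambda>t. c * fexp n t) has_vector_derivative (\<i> * of_int n * c * fexp n t)) (at t)" for n c t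
  proof -
    have "((\<lambda>z. c * exp (\<i> * (of_int n * z))) has_field_derivative
        (\<i> * of_int n * c * exp (\<i> * (of_int n * of_real t)))) (at (of_real t))"
      by (auto intro!: derivative_eq_intros)
    from has_vector_derivative_real_field [OF this] show ?thesis
      by (simp add: cis_conv_exp)
  qed
  have p: "trig_poly a (exp (\<i> * complex_of_real v)) = (\<Sum>r | a r \<noteq> 0. a r * fexp r v)" for v
    by (simp add: trig_poly_def cis_conv_exp [symmetric] cis_power_int)
  have "vector_derivative (\<lambda>v. trig_poly a (exp (\<i> * complex_of_real v))) (at u)
      = (\<Sum>r | a r \<noteq> 0. (\<i> * of_int r * a r) * fexp r u)" for u
    unfolding p by (intro vector_derivative_at has_vector_derivative_sum d)
  then have "second_deriv_circle a t = vector_derivative (\<lambda>u. \<Sum>r | a r \<noteq> 0. (\<i> * of_int r * a r) * fexp r u) (at t)"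
    by (simp add: second_deriv_circle_def)
  also have "\<dots> = (\<Sum>r | a r \<noteq> 0. \<i> * of_int r * (\<i> * of_int r * a r) * fexp r t)"
    by (intro vector_derivative_at has_vector_derivative_sum d)
  also have "\<dots> = (\<Sum>r | a r \<noteq> 0. - (of_int r)\<^sup>2 * a r * fexp r t)"
    by (intro sum.cong refl) (simp add: power2_eq_square mult_ac)
  finally show ?thesis .
qed

context
  fixes U U0 A X :: "'a::chilbert_space \<Rightarrow>\<^sub>L 'a"
  assumes U0: "unitary_op U0" and A: "selfadjoint_op A" "hilbert_schmidt A"
    and U: "U = exp_op (scaleC_op \<i> A) o\<^sub>L U0"
  defines "X \<equiv> scaleC_op \<i> A"
begin

lemma skew_X: "skew_op X" and hs_X: "hilbert_schmidt X" and hs_norm_X: "hs_norm X = hs_norm A"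
proof -
  show "skew_op X"
    using A(1) scaleC_op_minus1 [of "scaleC_op \<i> A"]
    by (simp add: skew_op_def X_def selfadjoint_op_def adj_scaleC_op)
      (auto intro!: blinfun_eqI simp: blinfun.minus_left scaleC.minus_left)
qed (simp_all add: X_def hilbert_schmidt_scaleC A hs_norm_scaleC)

lemma unitary_path_eq: "unitary_path A U0 s = exp_op (s *\<^sub>R X) o\<^sub>L U0"
proof -
  have "scaleC_op (\<i> * complex_of_real s) A = s *\<^sub>R X"
    unfolding X_def scaleR_eq_scaleC_op by (rule blinfun_eqI) (simp add: scaleC_scaleC mult.commute)
  then show ?thesis by (simp add: unitary_path_def)
qed

lemma bounded_linear_scaleC_op: "bounded_linear (scaleC_op c :: ('a \<Rightarrow>\<^sub>L 'a) \<Rightarrow> _)"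
proof (rule bounded_linear_intro [where K = "cmod c"])
  show "scaleC_op c (S + T) = scaleC_op c S + scaleC_op c T" for S T :: "'a \<Rightarrow>\<^sub>L 'a"
    by (rule blinfun_eqI) (simp add: blinfun.add_left scaleC.add_right)
  show "scaleC_op c (r *\<^sub>R T) = r *\<^sub>R scaleC_op c T" for r and T :: "'a \<Rightarrow>\<^sub>L 'a"
    by (rule blinfun_eqI) (simp add: blinfun.scaleR_left scaleC.scaleR_right)
  show "norm (scaleC_op c T) \<le> norm T * cmod c" for T :: "'a \<Rightarrow>\<^sub>L 'a"
  proof (rule norm_blinfun_bound)
    show "norm (blinfun_apply (scaleC_op c T) x) \<le> norm T * cmod c * norm x" for x
      using mult_left_mono [OF norm_blinfun [of T x] norm_ge_zero [of c]]
      by (simp add: norm_scaleC mult_ac)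
  qed simp
qed

lemma trig_poly_op_derivative:
  "((\<lambda>s. trig_poly_op a (unitary_path A U0 s)) has_vector_derivative
    (\<Sum>r | a r \<noteq> 0. scaleC_op (a r) (dpow X U0 r))) (at 0)"
  unfolding trig_poly_op_def unitary_path_eq
  by (intro has_vector_derivative_sum bounded_linear.has_vector_derivative [OF bounded_linear_scaleC_op]
      op_powi_path_has_vector_derivative skew_X U0)

lemma taylor_remainder_eq:
  "taylor_remainder a A U U0 = (\<Sum>r | a r \<noteq> 0. scaleC_op (a r) (path_remainder X U0 1 r))"
proof -
  interpret scaleC_op: bounded_linear "scaleC_op c :: ('a \<Rightarrow>\<^sub>L 'a) \<Rightarrow> _" for c
    by (rule bounded_linear_scaleC_op)
  show ?thesis
    unfolding taylor_remainder_def vector_derivative_at [OF trig_poly_op_derivative]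
    unfolding trig_poly_op_def path_remainder_def
    by (simp add: U X_def scaleC_op.diff sum_subtractf)
qed

lemma path_remainder_bounded: "\<exists>c. \<forall>r. trace_bound (path_remainder X U0 1 r) (c r)"
  by (rule exI, rule allI, rule path_remainder_trace_bound [OF skew_X hs_X U0])

lemma taylor_remainder_trace_bound: "\<exists>c. trace_bound (taylor_remainder a A U U0) c"
proof -
  obtain c where c: "\<And>r. trace_bound (path_remainder X U0 1 r) (c r)"
    using path_remainder_bounded by blast
  show ?thesis
    unfolding taylor_remainder_eq by (rule exI, rule trace_bound_sum, rule trace_bound_scaleC [OF c])
qed

lemma taylor_remainder_trace:
  "trace_op (taylor_remainder a A U U0) = (\<Sum>r | a r \<noteq> 0. a r * trace_op (path_remainder X U0 1 r))"
proof -
  obtain c where c: "\<And>r. trace_bound (path_remainder X U0 1 r) (c r)"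
    using path_remainder_bounded by blast
  show ?thesis
    unfolding taylor_remainder_eq
    by (subst trace_op_sum [where c = "\<lambda>r. cmod (a r) * c r"]) (auto intro: trace_bound_scaleC c simp: trace_op_scaleC)
qed

text \<open>Both sides are linear in the coefficients, so monomials suffice. For
  \<open>n = 0\<close> the remainder and the second derivative both vanish; the mean of
  \<open>\<eta>\<close> stays unconstrained, which is the origin of the additive constant.\<close>

lemma satisfies_trace_formula_iff:
  "satisfies_trace_formula A U U0 \<eta> \<longleftrightarrow> integrable circle_measure \<eta> \<and>
    (\<forall>n. n \<noteq> 0 \<longrightarrow> (\<integral>t. fexp n t * \<eta> t \<partial>circle_measure) = - trace_op (path_remainder X U0 1 n) / (of_int n)\<^sup>2)"
proof -
  let ?\<rho> = "\<lambda>n. trace_op (path_remainder X U0 1 n)"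
  have int: "(\<integral>t. second_deriv_circle a t * \<eta> t \<partial>circle_measure)
      = (\<Sum>r | a r \<noteq> 0. - (of_int r)\<^sup>2 * a r * (\<integral>t. fexp r t * \<eta> t \<partial>circle_measure))"
    if "integrable circle_measure \<eta>" for a
  proof -
    have "second_deriv_circle a t * \<eta> t = (\<Sum>r | a r \<noteq> 0. (- (of_int r)\<^sup>2 * a r) * (fexp r t * \<eta> t))" for t
      by (simp add: second_deriv_circle_eq sum_distrib_right mult.assoc)
    then show ?thesis
      by (simp add: Bochner_Integration.integral_sum integrable_fexp_mult that)
  qed
  have "(\<forall>a. is_trig_poly a \<longrightarrow> (\<Sum>r | a r \<noteq> 0. a r * ?\<rho> r)
        = (\<Sum>r | a r \<noteq> 0. - (of_int r)\<^sup>2 * a r * (\<integral>t. fexp r t * \<eta> t \<partial>circle_measure)))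
      \<longleftrightarrow> (\<forall>n. n \<noteq> 0 \<longrightarrow> (\<integral>t. fexp n t * \<eta> t \<partial>circle_measure) = - ?\<rho> n / (of_int n)\<^sup>2)"
    (is "?L \<longleftrightarrow> ?R")
  proof
    assume L: ?L
    show ?R
    proof (intro allI impI)
      fix n :: int assume n: "n \<noteq> 0"
      \<comment> \<open>The monomial \<open>z^n\<close> isolates a single coefficient.\<close>
      define a where "a = (\<lambda>r. if r = n then 1 else 0 :: complex)"
      have a: "{r. a r \<noteq> 0} = {n}" "a n = 1" by (auto simp: a_def)
      have "?\<rho> n = - (of_int n)\<^sup>2 * (\<integral>t. fexp n t * \<eta> t \<partial>circle_measure)"
        using L [rule_format, of a] by (simp add: is_trig_poly_def a)
      then show "(\<integral>t. fexp n t * \<eta> t \<partial>circle_measure) = - ?\<rho> n / (of_int n)\<^sup>2"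
        using n by simp
    qed
  next
    assume R: ?R
    have "?\<rho> 0 = 0"
      by (simp add: path_remainder_def dpow_def)
    show ?L
    proof (intro allI impI sum.cong refl)
      fix a :: "int \<Rightarrow> complex" and r
      show "a r * ?\<rho> r = - (of_int r)\<^sup>2 * a r * (\<integral>t. fexp r t * \<eta> t \<partial>circle_measure)"
      proof (cases "r = 0")
        case True
        then show ?thesis using \<open>?\<rho> 0 = 0\<close> by simp
      next
        case False
        show ?thesis
          unfolding R [rule_format, OF False] using False by simp
      qed
    qed
  qed
  then show ?thesis
    unfolding satisfies_trace_formula_def taylor_remainder_trace
    unfolding integrable_circle_iff [symmetric] integral_circle [symmetric]
    by (auto simp: int)
qed

lemma trace_formula_exists:
  "\<exists>\<eta>. satisfies_trace_formula A U U0 \<eta> \<and>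
    (LINT t:{0..2 * pi}|lebesgue. cmod (\<eta> t)) \<le> pi / 2 * (hs_norm A)\<^sup>2"
proof -
  obtain \<eta> where "integrable circle_measure \<eta>"
    "\<And>n. (\<integral>t. fexp n t * \<eta> t \<partial>circle_measure) = - trace_op (path_remainder X U0 1 n) / (of_int n)\<^sup>2"
    "(\<integral>t. cmod (\<eta> t) \<partial>circle_measure) \<le> pi / 2 * (hs_norm X)\<^sup>2"
    by (rule path_remainder_representation [OF skew_X hs_X U0]) blast
  then show ?thesis
    unfolding satisfies_trace_formula_iff integral_circle [symmetric] hs_norm_X by blast
qed

lemma trace_formula_unique:
  assumes "satisfies_trace_formula A U U0 \<eta>1" "satisfies_trace_formula A U U0 \<eta>2"
  shows "\<exists>c. AE t in lebesgue. t \<in> {0..2 * pi} \<longrightarrow> \<eta>1 t = \<eta>2 t + c"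
  using assms unfolding satisfies_trace_formula_iff by (intro fourier_coefficients_unique) auto

text \<open>\<open>vector_derivative\<close> is a total function; this guarantees that the term in
  \<open>taylor_remainder\<close> is a genuine derivative in operator norm.\<close>

lemma trace_formula_differentiable:
  "(\<lambda>s. trig_poly_op a (unitary_path A U0 s)) differentiable (at 0)"
  using trig_poly_op_derivative by (rule differentiableI_vector)

lemma taylor_remainder_trace_class: "trace_class (taylor_remainder a A U U0)"
  using taylor_remainder_trace_bound trace_bound_trace_class by blast

end

theorem theorem4p1:
  fixes U U0 A :: "'a::chilbert_space \<Rightarrow>\<^sub>L 'a"
  assumes "separable_space (euclidean :: 'a topology)"
    and "unitary_op U" and "unitary_op U0"
    and "hilbert_schmidt (U - U0)"
    and "selfadjoint_op A" and "hilbert_schmidt A"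
    and "U = exp_op (scaleC_op \<i> A) o\<^sub>L U0"
  shows "(\<forall>a. is_trig_poly a \<longrightarrow>
            (\<lambda>s. trig_poly_op a (unitary_path A U0 s)) differentiable (at 0) \<and>
            trace_class (taylor_remainder a A U U0)) \<and>
         (\<exists>\<eta>. satisfies_trace_formula A U U0 \<eta>) \<and>
         (\<forall>\<eta>1 \<eta>2. satisfies_trace_formula A U U0 \<eta>1 \<and> satisfies_trace_formula A U U0 \<eta>2 \<longrightarrow>
            (\<exists>c::complex. AE t in lebesgue. t \<in> {0..2 * pi} \<longrightarrow> \<eta>1 t = \<eta>2 t + c)) \<and>
         (\<exists>\<eta>. satisfies_trace_formula A U U0 \<eta> \<and>
            (LINT t:{0..2 * pi}|lebesgue. cmod (\<eta> t)) \<le> pi / 2 * (hs_norm A)\<^sup>2)"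
proof (intro conjI allI impI)
  note hyps = assms(3,5-7)
  show "(\<lambda>s. trig_poly_op a (unitary_path A U0 s)) differentiable (at 0)" for a
    by (rule trace_formula_differentiable [OF hyps])
  show "trace_class (taylor_remainder a A U U0)" for a
    by (rule taylor_remainder_trace_class [OF hyps])
  show ex: "\<exists>\<eta>. satisfies_trace_formula A U U0 \<eta> \<and>
      (LINT t:{0..2 * pi}|lebesgue. cmod (\<eta> t)) \<le> pi / 2 * (hs_norm A)\<^sup>2"
    by (rule trace_formula_exists [OF hyps])
  then show "\<exists>\<eta>. satisfies_trace_formula A U U0 \<eta>" by blast
  show "\<exists>c. AE t in lebesgue. t \<in> {0..2 * pi} \<longrightarrow> \<eta>1 t = \<eta>2 t + c"
    if "satisfies_trace_formula A U U0 \<eta>1 \<and> satisfies_trace_formula A U U0 \<eta>2" for \<eta>1 \<eta>2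
    using that by (intro trace_formula_unique [OF hyps]) auto
qed

end
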